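(* Let $A=S(V,N)$ be the $N$-symmetric algebra of $V$, let $P,Q$ be $A$-bimodules, and let $p,q\ge 0$ be such that $\nu(p+q)=\nu(p)+\nu(q)$. Let $f:\bigwedge^{\nu(p)}V\to P$ and $g:\bigwedge^{\nu(q)}V\to Q$ be $k$-linear maps, viewed as Koszul cochains via the isomorphisms $\phi_m:\bigwedge^m V\to Ant_m(V^{\otimes m})$. Then for all elements $x_1<\cdots<x_{\nu(p+q)}$ of the ordered basis $(e_1,\ldots,e_n)$ of $V$, the Koszul cup product, viewed as a map $\bigwedge^{\nu(p+q)}V\to P\otimes_A Q$, is given by $$(f\underset{K}{\smile} g)(x_1\wedge\cdots\wedge x_{\nu(p+q)})=(-1)^{pq}\sum_{\sigma\in Sh(\nu(p),\nu(q))}\mathrm{sgn}(\sigma)\, f(x_{\sigma(1)}\wedge\cdots\wedge x_{\sigma(\nu(p))})\otimes_A g(x_{\sigma(\nu(p)+1)}\wedge\cdots\wedge x_{\sigma(\nu(p+q))}).$$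
   Context: $k$ is a field, $V$ a $k$-vector space of finite dimension $n\ge 2$ with ordered basis $(e_1,\ldots,e_n)$ (with $e_1<\cdots<e_n$), and $N$ is an integer with $2\le N\le n$. Tensor symbols $\otimes$ between elements of $V$ are omitted. For $m\ge1$, $Ant_m:V^{\otimes m}\to V^{\otimes m}$ is the linear map $Ant_m(z)=\sum_{\sigma\in\Sigma_m}\mathrm{sgn}(\sigma)\,\sigma\cdot z$, where $\Sigma_m$ is the group of permutations of $\{1,\ldots,m\}$ and $\sigma\cdot(x_1\ldots x_m)=x_{\sigma^{-1}(1)}\ldots x_{\sigma^{-1}(m)}$; $Ant_0=\mathrm{Id}_k$. There is an isomorphism $\phi_m:\bigwedge^m V\to Ant_m(V^{\otimes m})$, $e_{i_1}\wedge\cdots\wedge e_{i_m}\mapsto Ant_m(e_{i_1}\ldots e_{i_m})$ for $i_1<\cdots<i_m$. The $N$-symmetric algebra is $A=S(V,N)=T(V)/(R)$ with $R=Ant_N(V^{\otimes N})$. Elements of $V$ appearing as factors in bimodules mean their images in $A$. Put $W_m=\bigcap_{i+N+j=m}V^{\otimes i}\otimes R\otimes V^{\otimes j}\subseteq V^{\otimes m}$ (so $W_m=V^{\otimes m}$ for $m<N$). Define $\nu(2p')=Np'$ and $\nu(2p'+1)=Np'+1$. For all $p$ one has $W_{\nu(p)}=Ant_{\nu(p)}(V^{\otimes\nu(p)})$, so a Koszul $p$-cochain with coefficients in a bimodule $P$, i.e. a $k$-linear map $f:W_{\nu(p)}\to P$, is identified with the linear map $f\circ\phi_{\nu(p)}:\bigwedge^{\nu(p)}V\to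 P$, denoted by the same letter. Koszul cup product: for Koszul cochains $f:W_{\nu(p)}\to P$ and $g:W_{\nu(q)}\to Q$, $f\underset{K}{\smile}g:W_{\nu(p+q)}\to P\otimes_AQ$ is defined as follows, where an element of $W_{\nu(p+q)}$ is written as a (sum of) $x_1\ldots x_{\nu(p+q)}$ and $f,g$ are applied to the indicated tensor positions, using the inclusions of $W_{\nu(p+q)}$ in $V^{\otimes i}\otimes W_{\nu(p)}\otimes V^{\otimes l}\otimes W_{\nu(q)}\otimes V^{\otimes j}$. (1) If $p,q$ are not both odd (so $\nu(p+q)=\nu(p)+\nu(q)$): $(f\underset{K}{\smile}g)(x_1\ldots x_{\nu(p+q)})=f(x_1\ldots x_{\nu(p)})\otimes_A g(x_{\nu(p)+1}\ldots x_{\nu(p)+\nu(q)})$. (2) If $p,q$ are both odd (so $\nu(p+q)=\nu(p)+\nu(q)+N-2$): $(f\underset{K}{\smile}g)(x_1\ldots x_{\nu(p+q)})=-\sum_{0\le i+j\le N-2}x_1\ldots x_i\,f(x_{i+1}\ldots x_{i+\nu(p)})\,x_{i+\nu(p)+1}\ldots x_{\nu(p)+N-j-2}\otimes_A g(x_{\nu(p)+N-j-1}\ldots x_{\nu(p)+\nu(q)+N-j-2})\,x_{\nu(p)+\nu(q)+N-j-1}\ldots x_{\nu(p)+\nu(q)+N-2}$, the sum being over $i,j\ge0$. $Sh(a,b)$ denotes the set of $(a,b)$-shuffles: permutations $\sigma$ of $\{1,\ldots,a+b\}$ with $\sigma(1)<\cdots<\sigma(a)$ and $\sigma(a+1)<\cdots<\sigma(a+b)$.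 *)

theory Defs
  imports
    HOL.Vector_Spaces
    "HOL-Library.Poly_Mapping"
    "HOL-Combinatorics.Permutations"
    "HOL-Algebra.Module"
    "HOL-Algebra.QuotRing"
    "HOL-Algebra.Generated_Groups"
    "HOL-Algebra.Free_Abelian_Groups"
begin

section \<open>Algebras over a field and their quotients\<close>

text \<open>
  A \<open>k\<close>-algebra is a record of type \<open>('k, 'a) module\<close>: a (possibly noncommutative) ring together
  with the scalar multiplication by \<open>k\<close>, where \<open>k\<close> is the whole type \<open>'k\<close>.  In a quotient algebra
  the scalar \<open>c\<close> acts as multiplication by the class of \<open>c 1\<close>.
\<close>

definition quot_alg :: "('k, 'a) module \<Rightarrow> 'a set \<Rightarrow> ('k, 'a set) module" where
  "quot_alg A I =
     \<lparr>carrier = carrier (A Quot I), monoid.mult = monoid.mult (A Quot I),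
      one = monoid.one (A Quot I), ring.zero = ring.zero (A Quot I), add = ring.add (A Quot I),
      smult = (\<lambda>c X. (I +>\<^bsub>A\<^esub> (c \<odot>\<^bsub>A\<^esub> \<one>\<^bsub>A\<^esub>)) \<otimes>\<^bsub>A Quot I\<^esub> X)\<rparr>"

definition additive_on ::
  "'x set \<Rightarrow> ('x, 'm) ring_scheme \<Rightarrow> ('y, 'n) ring_scheme \<Rightarrow> ('x \<Rightarrow> 'y) \<Rightarrow> bool" where
  "additive_on D X Y h \<longleftrightarrow>
     h \<in> D \<rightarrow> carrier Y \<and> (\<forall>x\<in>D. \<forall>y\<in>D. h (x \<oplus>\<^bsub>X\<^esub> y) = h x \<oplus>\<^bsub>Y\<^esub> h y)"

definition linear_on ::
  "'x set \<Rightarrow> ('k, 'x, 'm) module_scheme \<Rightarrow> ('k, 'y, 'n) module_scheme \<Rightarrow> ('x \<Rightarrow> 'y) \<Rightarrow> bool" where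
  "linear_on D X Y h \<longleftrightarrow>
     additive_on D X Y h \<and> (\<forall>c. \<forall>x\<in>D. h (c \<odot>\<^bsub>X\<^esub> x) = c \<odot>\<^bsub>Y\<^esub> h x)"


section \<open>The tensor algebra\<close>

text \<open>
  The free algebra on the set underlying \<open>V\<close> is the monoid algebra of the free monoid of words
  in elements of \<open>V\<close>; \<open>T(V)\<close> is its quotient by the relations making the generators depend
  linearly on the vector.
\<close>

datatype 'a word = Word (letters: "'a list")

instantiation word :: (type) monoid_add
begin

definition zero_word :: "'a word" where "zero_word = Word []"

definition plus_word :: "'a word \<Rightarrow> 'a word \<Rightarrow> 'a word" where
  "plus_word u v = Word (letters u @ letters v)"

instance
  by standard (simp_all add: zero_word_def plus_word_def)

end

definition monomial :: "'v list \<Rightarrow> 'v word \<Rightarrow>\<^sub>0 'k::field" where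
  "monomial xs = Poly_Mapping.single (Word xs) 1"

definition free_alg :: "('k::field, 'v word \<Rightarrow>\<^sub>0 'k) module" where
  "free_alg =
     \<lparr>carrier = UNIV, monoid.mult = (*), one = 1, ring.zero = 0, add = (+),
      smult = (\<lambda>c z. Poly_Mapping.single 0 c * z)\<rparr>"

definition linearity_rels ::
  "('k::field \<Rightarrow> 'v::ab_group_add \<Rightarrow> 'v) \<Rightarrow> ('v word \<Rightarrow>\<^sub>0 'k) set" where
  "linearity_rels scale =
     {monomial [x + y] - monomial [x] - monomial [y] | x y. True} \<union>
     {monomial [scale c x] - Poly_Mapping.single 0 c * monomial [x] | c x. True}"

definition tensor_ideal ::
  "('k::field \<Rightarrow> 'v::ab_group_add \<Rightarrow> 'v) \<Rightarrow> ('v word \<Rightarrow>\<^sub>0 'k) set" where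
  "tensor_ideal scale = Idl\<^bsub>free_alg\<^esub> (linearity_rels scale)"

definition tensor_alg ::
  "('k::field \<Rightarrow> 'v::ab_group_add \<Rightarrow> 'v) \<Rightarrow> ('k, ('v word \<Rightarrow>\<^sub>0 'k) set) module" where
  "tensor_alg scale = quot_alg free_alg (tensor_ideal scale)"

text \<open>The tensor \<open>x\<^sub>1 \<otimes> \<dots> \<otimes> x\<^sub>m\<close> of a list of vectors.\<close>

definition tensor ::
  "('k::field \<Rightarrow> 'v::ab_group_add \<Rightarrow> 'v) \<Rightarrow> 'v list \<Rightarrow> ('v word \<Rightarrow>\<^sub>0 'k) set" where
  "tensor scale xs = tensor_ideal scale +>\<^bsub>free_alg\<^esub> monomial xs"

definition tensor_power ::
  "('k::field \<Rightarrow> 'v::ab_group_add \<Rightarrow> 'v) \<Rightarrow> nat \<Rightarrow> ('v word \<Rightarrow>\<^sub>0 'k) set set" where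
  "tensor_power scale m =
     (\<lambda>z. tensor_ideal scale +>\<^bsub>free_alg\<^esub> z) `
       {z. \<forall>w\<in>Poly_Mapping.keys z. length (letters w) = m}"

text \<open>
  \<open>\<sigma> \<cdot> (x\<^sub>1 \<dots> x\<^sub>m)\<close> has the letter with index \<open>\<sigma>\<inverse>(i)\<close> in position \<open>i\<close>; positions are counted
  from \<open>1\<close>, list indices from \<open>0\<close>.
\<close>

definition perm_list :: "(nat \<Rightarrow> nat) \<Rightarrow> 'v list \<Rightarrow> 'v list" where
  "perm_list \<sigma> xs = map (\<lambda>i. xs ! (inv_into UNIV \<sigma> i - 1)) [1..<Suc (length xs)]"

definition Ant ::
  "('k::field \<Rightarrow> 'v::ab_group_add \<Rightarrow> 'v) \<Rightarrow> nat \<Rightarrow> ('v word \<Rightarrow>\<^sub>0 'k) set \<Rightarrow> ('v word \<Rightarrow>\<^sub>0 'k) set"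
  where
  "Ant scale m = (THE h.
     h \<in> extensional (tensor_power scale m) \<and>
     linear_on (tensor_power scale m) (tensor_alg scale) (tensor_alg scale) h \<and>
     (\<forall>xs. length xs = m \<longrightarrow>
        h (tensor scale xs) =
          (\<Oplus>\<^bsub>tensor_alg scale\<^esub>\<sigma>\<in>{\<sigma>. \<sigma> permutes {1..m}}.
             [sign \<sigma>] \<cdot>\<^bsub>tensor_alg scale\<^esub> tensor scale (perm_list \<sigma> xs))))"


section \<open>The exterior algebra\<close>

definition ext_ideal ::
  "('k::field \<Rightarrow> 'v::ab_group_add \<Rightarrow> 'v) \<Rightarrow> ('v word \<Rightarrow>\<^sub>0 'k) set set" where
  "ext_ideal scale = Idl\<^bsub>tensor_alg scale\<^esub> {tensor scale [x, x] | x. True}"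

definition ext_alg ::
  "('k::field \<Rightarrow> 'v::ab_group_add \<Rightarrow> 'v) \<Rightarrow> ('k, ('v word \<Rightarrow>\<^sub>0 'k) set set) module" where
  "ext_alg scale = quot_alg (tensor_alg scale) (ext_ideal scale)"

definition wedge ::
  "('k::field \<Rightarrow> 'v::ab_group_add \<Rightarrow> 'v) \<Rightarrow> 'v list \<Rightarrow> ('v word \<Rightarrow>\<^sub>0 'k) set set" where
  "wedge scale xs = ext_ideal scale +>\<^bsub>tensor_alg scale\<^esub> tensor scale xs"

definition ext_power ::
  "('k::field \<Rightarrow> 'v::ab_group_add \<Rightarrow> 'v) \<Rightarrow> nat \<Rightarrow> ('v word \<Rightarrow>\<^sub>0 'k) set set set" where
  "ext_power scale m = (\<lambda>t. ext_ideal scale +>\<^bsub>tensor_alg scale\<^esub> t) ` tensor_power scale m"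

text \<open>The isomorphism from the exterior power onto the image of \<open>Ant\<close>, for the basis \<open>e 1, \<dots>, e n\<close>.\<close>

definition phi ::
  "('k::field \<Rightarrow> 'v::ab_group_add \<Rightarrow> 'v) \<Rightarrow> (nat \<Rightarrow> 'v) \<Rightarrow> nat \<Rightarrow> nat \<Rightarrow>
   ('v word \<Rightarrow>\<^sub>0 'k) set set \<Rightarrow> ('v word \<Rightarrow>\<^sub>0 'k) set" where
  "phi scale e n m = (THE h.
     h \<in> extensional (ext_power scale m) \<and>
     linear_on (ext_power scale m) (ext_alg scale) (tensor_alg scale) h \<and>
     (\<forall>is. length is = m \<and> set is \<subseteq> {1..n} \<and> sorted_wrt (<) is \<longrightarrow>
        h (wedge scale (map e is)) = Ant scale m (tensor scale (map e is))))"


section \<open>The \<open>N\<close>-symmetric algebra\<close>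

definition sym_rels ::
  "('k::field \<Rightarrow> 'v::ab_group_add \<Rightarrow> 'v) \<Rightarrow> nat \<Rightarrow> ('v word \<Rightarrow>\<^sub>0 'k) set set" where
  "sym_rels scale N = Ant scale N ` tensor_power scale N"

definition sym_ideal ::
  "('k::field \<Rightarrow> 'v::ab_group_add \<Rightarrow> 'v) \<Rightarrow> nat \<Rightarrow> ('v word \<Rightarrow>\<^sub>0 'k) set set" where
  "sym_ideal scale N = Idl\<^bsub>tensor_alg scale\<^esub> (sym_rels scale N)"

definition sym_alg ::
  "('k::field \<Rightarrow> 'v::ab_group_add \<Rightarrow> 'v) \<Rightarrow> nat \<Rightarrow> ('k, ('v word \<Rightarrow>\<^sub>0 'k) set set) module" where
  "sym_alg scale N = quot_alg (tensor_alg scale) (sym_ideal scale N)"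

definition sym_class ::
  "('k::field \<Rightarrow> 'v::ab_group_add \<Rightarrow> 'v) \<Rightarrow> nat \<Rightarrow> ('v word \<Rightarrow>\<^sub>0 'k) set \<Rightarrow>
   ('v word \<Rightarrow>\<^sub>0 'k) set set" where
  "sym_class scale N t = sym_ideal scale N +>\<^bsub>tensor_alg scale\<^esub> t"


section \<open>Bimodules and their tensor product\<close>

text \<open>
  \<open>smult\<close> is the left and \<open>rsmult\<close> the right action of \<open>A\<close>; the \<open>mult\<close> and \<open>one\<close> fields of the
  record are irrelevant.  As usual for algebras over \<open>k\<close>, the two actions of \<open>k\<close> agree.
\<close>

record ('a, 'p) bimodule = "('a, 'p) module" +
  rsmult :: "'p \<Rightarrow> 'a \<Rightarrow> 'p"

locale bimodule = A?: ring A + P?: abelian_group P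
  for A :: "('k, 'a, 'm) module_scheme" (structure)
    and P :: "('a, 'p, 'n) bimodule_scheme" (structure) +
  assumes lact_closed: "\<lbrakk>a \<in> carrier A; x \<in> carrier P\<rbrakk> \<Longrightarrow> a \<odot>\<^bsub>P\<^esub> x \<in> carrier P"
    and lact_add_left: "\<lbrakk>a \<in> carrier A; b \<in> carrier A; x \<in> carrier P\<rbrakk> \<Longrightarrow>
      (a \<oplus>\<^bsub>A\<^esub> b) \<odot>\<^bsub>P\<^esub> x = a \<odot>\<^bsub>P\<^esub> x \<oplus>\<^bsub>P\<^esub> b \<odot>\<^bsub>P\<^esub> x"
    and lact_add_right: "\<lbrakk>a \<in> carrier A; x \<in> carrier P; y \<in> carrier P\<rbrakk> \<Longrightarrow>
      a \<odot>\<^bsub>P\<^esub> (x \<oplus>\<^bsub>P\<^esub> y) = a \<odot>\<^bsub>P\<^esub> x \<oplus>\<^bsub>P\<^esub> a \<odot>\<^bsub>P\<^esub> y"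
    and lact_mult: "\<lbrakk>a \<in> carrier A; b \<in> carrier A; x \<in> carrier P\<rbrakk> \<Longrightarrow>
      (a \<otimes>\<^bsub>A\<^esub> b) \<odot>\<^bsub>P\<^esub> x = a \<odot>\<^bsub>P\<^esub> (b \<odot>\<^bsub>P\<^esub> x)"
    and lact_one: "x \<in> carrier P \<Longrightarrow> \<one>\<^bsub>A\<^esub> \<odot>\<^bsub>P\<^esub> x = x"
    and ract_closed: "\<lbrakk>a \<in> carrier A; x \<in> carrier P\<rbrakk> \<Longrightarrow> rsmult P x a \<in> carrier P"
    and ract_add_right: "\<lbrakk>a \<in> carrier A; b \<in> carrier A; x \<in> carrier P\<rbrakk> \<Longrightarrow>
      rsmult P x (a \<oplus>\<^bsub>A\<^esub> b) = rsmult P x a \<oplus>\<^bsub>P\<^esub> rsmult P x b"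
    and ract_add_left: "\<lbrakk>a \<in> carrier A; x \<in> carrier P; y \<in> carrier P\<rbrakk> \<Longrightarrow>
      rsmult P (x \<oplus>\<^bsub>P\<^esub> y) a = rsmult P x a \<oplus>\<^bsub>P\<^esub> rsmult P y a"
    and ract_mult: "\<lbrakk>a \<in> carrier A; b \<in> carrier A; x \<in> carrier P\<rbrakk> \<Longrightarrow>
      rsmult P x (a \<otimes>\<^bsub>A\<^esub> b) = rsmult P (rsmult P x a) b"
    and ract_one: "x \<in> carrier P \<Longrightarrow> rsmult P x \<one>\<^bsub>A\<^esub> = x"
    and lact_ract: "\<lbrakk>a \<in> carrier A; b \<in> carrier A; x \<in> carrier P\<rbrakk> \<Longrightarrow>
      rsmult P (a \<odot>\<^bsub>P\<^esub> x) b = a \<odot>\<^bsub>P\<^esub> rsmult P x b"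
    and scalars_central: "x \<in> carrier P \<Longrightarrow>
      (c \<odot>\<^bsub>A\<^esub> \<one>\<^bsub>A\<^esub>) \<odot>\<^bsub>P\<^esub> x = rsmult P x (c \<odot>\<^bsub>A\<^esub> \<one>\<^bsub>A\<^esub>)"

definition bimodule_space ::
  "('k, 'a) module \<Rightarrow> ('a, 'p) bimodule \<Rightarrow> ('k, 'p) module" where
  "bimodule_space A P =
     \<lparr>carrier = carrier P, monoid.mult = monoid.mult P, one = monoid.one P,
      ring.zero = ring.zero P, add = ring.add P,
      smult = (\<lambda>c x. (c \<odot>\<^bsub>A\<^esub> \<one>\<^bsub>A\<^esub>) \<odot>\<^bsub>P\<^esub> x)\<rparr>"

text \<open>
  \<open>P \<otimes>\<^sub>A Q\<close> is the free abelian group on \<open>P \<times> Q\<close> modulo biadditivity and \<open>A\<close>-balancedness.  The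
  (multiplicatively written) quotient group is repackaged as an additive group, as
  for the record type \<open>ring\<close>; the ring multiplication and unit of the record carry no information.
\<close>

definition balanced_rels ::
  "('k, 'a) module \<Rightarrow> ('a, 'p) bimodule \<Rightarrow> ('a, 'q) bimodule \<Rightarrow> (('p \<times> 'q) \<Rightarrow>\<^sub>0 int) set" where
  "balanced_rels A P Q =
     {frag_of (x \<oplus>\<^bsub>P\<^esub> x', y) - frag_of (x, y) - frag_of (x', y) | x x' y.
        x \<in> carrier P \<and> x' \<in> carrier P \<and> y \<in> carrier Q} \<union>
     {frag_of (x, y \<oplus>\<^bsub>Q\<^esub> y') - frag_of (x, y) - frag_of (x, y') | x y y'.
        x \<in> carrier P \<and> y \<in> carrier Q \<and> y' \<in> carrier Q} \<union>
     {frag_of (rsmult P x a, y) - frag_of (x, a \<odot>\<^bsub>Q\<^esub> y) | x a y.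
        x \<in> carrier P \<and> a \<in> carrier A \<and> y \<in> carrier Q}"

definition balanced_subgroup ::
  "('k, 'a) module \<Rightarrow> ('a, 'p) bimodule \<Rightarrow> ('a, 'q) bimodule \<Rightarrow> (('p \<times> 'q) \<Rightarrow>\<^sub>0 int) set" where
  "balanced_subgroup A P Q =
     generate (free_Abelian_group (carrier P \<times> carrier Q)) (balanced_rels A P Q)"

definition bimodule_tensor ::
  "('k, 'a) module \<Rightarrow> ('a, 'p) bimodule \<Rightarrow> ('a, 'q) bimodule \<Rightarrow> (('p \<times> 'q) \<Rightarrow>\<^sub>0 int) set ring" where
  "bimodule_tensor A P Q =
     (let G = free_Abelian_group (carrier P \<times> carrier Q) Mod balanced_subgroup A P Q
      in \<lparr>carrier = carrier G, monoid.mult = undefined, one = undefined,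
          ring.zero = monoid.one G, add = monoid.mult G\<rparr>)"

definition pure_tensor ::
  "('k, 'a) module \<Rightarrow> ('a, 'p) bimodule \<Rightarrow> ('a, 'q) bimodule \<Rightarrow> 'p \<Rightarrow> 'q \<Rightarrow>
   (('p \<times> 'q) \<Rightarrow>\<^sub>0 int) set" where
  "pure_tensor A P Q x y =
     balanced_subgroup A P Q #>\<^bsub>free_Abelian_group (carrier P \<times> carrier Q)\<^esub> frag_of (x, y)"


section \<open>Koszul cochains and the Koszul cup product\<close>

definition nu :: "nat \<Rightarrow> nat \<Rightarrow> nat" where
  "nu N p = (if even p then N * (p div 2) else N * (p div 2) + 1)"

definition koszul_W ::
  "('k::field \<Rightarrow> 'v::ab_group_add \<Rightarrow> 'v) \<Rightarrow> nat \<Rightarrow> nat \<Rightarrow> ('v word \<Rightarrow>\<^sub>0 'k) set set" where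
  "koszul_W scale N m =
     tensor_power scale m \<inter>
     (\<Inter>(i, j)\<in>{(i, j). i + N + j = m}.
        generate (add_monoid (tensor_alg scale))
          {u \<otimes>\<^bsub>tensor_alg scale\<^esub> r \<otimes>\<^bsub>tensor_alg scale\<^esub> v | u r v.
             u \<in> tensor_power scale i \<and> r \<in> sym_rels scale N \<and> v \<in> tensor_power scale j})"

text \<open>The Koszul \<open>p\<close>-cochain \<open>W\<^sub>\<nu>\<^sub>(\<^sub>p\<^sub>) \<rightarrow> P\<close> identified, through \<open>phi\<close>, with \<open>f\<close>.\<close>

definition koszul_cochain ::
  "('k::field \<Rightarrow> 'v::ab_group_add \<Rightarrow> 'v) \<Rightarrow> (nat \<Rightarrow> 'v) \<Rightarrow> nat \<Rightarrow> nat \<Rightarrow> nat \<Rightarrow>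
   (('v word \<Rightarrow>\<^sub>0 'k) set set \<Rightarrow> 'p) \<Rightarrow> ('v word \<Rightarrow>\<^sub>0 'k) set \<Rightarrow> 'p" where
  "koszul_cochain scale e n N p f =
     (\<lambda>z\<in>koszul_W scale N (nu N p).
        f (inv_into (ext_power scale (nu N p)) (phi scale e n (nu N p)) z))"

text \<open>
  For \<open>F\<close> on \<open>W\<^sub>a\<close> and \<open>G\<close> on \<open>W\<^sub>b\<close>, this is the map
  \<open>V\<^sup>\<otimes>\<^sup>i \<otimes> W\<^sub>a \<otimes> V\<^sup>\<otimes>\<^sup>l \<otimes> W\<^sub>b \<otimes> V\<^sup>\<otimes>\<^sup>j \<rightarrow> P \<otimes>\<^sub>A Q\<close> that sends \<open>u s v t w\<close> to
  \<open>u F(s) v \<otimes>\<^sub>A G(t) w\<close>.  The tensors \<open>u s v t w\<close> are closed under scalar multiplication, so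
  an additive map with these values is automatically \<open>k\<close>-linear.
\<close>

definition koszul_apply ::
  "('k::field \<Rightarrow> 'v::ab_group_add \<Rightarrow> 'v) \<Rightarrow> nat \<Rightarrow>
   (('v word \<Rightarrow>\<^sub>0 'k) set set, 'p) bimodule \<Rightarrow> (('v word \<Rightarrow>\<^sub>0 'k) set set, 'q) bimodule \<Rightarrow>
   nat \<Rightarrow> nat \<Rightarrow> nat \<Rightarrow> nat \<Rightarrow> nat \<Rightarrow>
   (('v word \<Rightarrow>\<^sub>0 'k) set \<Rightarrow> 'p) \<Rightarrow> (('v word \<Rightarrow>\<^sub>0 'k) set \<Rightarrow> 'q) \<Rightarrow>
   ('v word \<Rightarrow>\<^sub>0 'k) set \<Rightarrow> (('p \<times> 'q) \<Rightarrow>\<^sub>0 int) set" where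
  "koszul_apply scale N P Q i a l b j F G =
     (let T = tensor_alg scale;
          A = sym_alg scale N;
          cl = sym_class scale N;
          D = generate (add_monoid T)
                {u \<otimes>\<^bsub>T\<^esub> s \<otimes>\<^bsub>T\<^esub> v \<otimes>\<^bsub>T\<^esub> t \<otimes>\<^bsub>T\<^esub> w | u s v t w.
                   u \<in> tensor_power scale i \<and> s \<in> koszul_W scale N a \<and>
                   v \<in> tensor_power scale l \<and> t \<in> koszul_W scale N b \<and>
                   w \<in> tensor_power scale j}
      in THE h.
           h \<in> extensional D \<and> additive_on D T (bimodule_tensor A P Q) h \<and>
           (\<forall>u\<in>tensor_power scale i. \<forall>s\<in>koszul_W scale N a. \<forall>v\<in>tensor_power scale l.
            \<forall>t\<in>koszul_W scale N b. \<forall>w\<in>tensor_power scale j.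
              h (u \<otimes>\<^bsub>T\<^esub> s \<otimes>\<^bsub>T\<^esub> v \<otimes>\<^bsub>T\<^esub> t \<otimes>\<^bsub>T\<^esub> w) =
                pure_tensor A P Q
                  (rsmult P (cl u \<odot>\<^bsub>P\<^esub> F s) (cl v)) (rsmult Q (G t) (cl w))))"

definition koszul_cup ::
  "('k::field \<Rightarrow> 'v::ab_group_add \<Rightarrow> 'v) \<Rightarrow> nat \<Rightarrow>
   (('v word \<Rightarrow>\<^sub>0 'k) set set, 'p) bimodule \<Rightarrow> (('v word \<Rightarrow>\<^sub>0 'k) set set, 'q) bimodule \<Rightarrow>
   nat \<Rightarrow> nat \<Rightarrow>
   (('v word \<Rightarrow>\<^sub>0 'k) set \<Rightarrow> 'p) \<Rightarrow> (('v word \<Rightarrow>\<^sub>0 'k) set \<Rightarrow> 'q) \<Rightarrow>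
   ('v word \<Rightarrow>\<^sub>0 'k) set \<Rightarrow> (('p \<times> 'q) \<Rightarrow>\<^sub>0 int) set" where
  "koszul_cup scale N P Q p q F G =
     (\<lambda>z\<in>koszul_W scale N (nu N (p + q)).
        if odd p \<and> odd q
        then \<ominus>\<^bsub>bimodule_tensor (sym_alg scale N) P Q\<^esub>
               (finsum (bimodule_tensor (sym_alg scale N) P Q)
                  (\<lambda>(i, j). koszul_apply scale N P Q i (nu N p) (N - 2 - i - j) (nu N q) j F G z)
                  {(i, j). i + j \<le> N - 2})
        else koszul_apply scale N P Q 0 (nu N p) 0 (nu N q) 0 F G z)"

definition Sh :: "nat \<Rightarrow> nat \<Rightarrow> (nat \<Rightarrow> nat) set" where
  "Sh a b = {\<sigma>. \<sigma> permutes {1..a + b} \<and>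
                strict_mono_on {1..a} \<sigma> \<and> strict_mono_on {a + 1..a + b} \<sigma>}"

end

theory Submission
  imports Defs
begin

text \<open>
  The idea is that everything can be read off from coordinates.  The tensor algebra is defined as
  a quotient, but the lemma \<open>cls_eq_iff\<close> shows that an element is determined by its coefficients
  \<open>coeff ws\<close> at the words \<open>e\<^sub>w\<^sub>1 \<dots> e\<^sub>w\<^sub>m\<close> in the basis; lists \<open>ws\<close> of indices take the place of
  multi-indices.  On coordinates, \<open>Ant\<close> is the antisymmetrization of a function on lists, and
  its values are the alternating functions: those that change sign when two adjacent entries are
  exchanged and vanish when two adjacent entries agree (\<open>Ant_image\<close>).  Sorting by adjacent
  exchanges (\<open>bubble_sort_induct\<close>) shows that such a function is determined by its values on
  increasing lists (\<open>alternating_expansion\<close>).  All signs are treated by pairing off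
  permutations, hence the argument is valid in characteristic two as well.

  From this description follow all the identifications on which the definition of the cup product
  relies.  The exterior ideal is killed by the antisymmetrized coordinates, and modulo that ideal
  every tensor is a combination of increasing words with exactly these coefficients
  (\<open>tensor_normal_form\<close>); hence \<open>phi\<close> is well defined and injective, with an explicit inverse on
  alternating tensors.  Being alternating is a condition on each pair of adjacent positions, and
  since \<open>N \<ge> 2\<close> each such pair lies in a window of length \<open>N\<close>; hence \<open>W\<^sub>m\<close> consists of the alternating
  tensors (\<open>koszul_W_eq\<close>).  The map on \<open>W\<^sub>a \<otimes> W\<^sub>b\<close> induced by two cochains exists because it can be
  written in terms of the coordinates (\<open>cup_map\<close>), and it is unique because it is additive
  (\<open>koszul_apply_eq\<close>).

  The shuffle formula itself is \<open>ant_basis_shuffles\<close>: the antisymmetrization of an increasing word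
  of length \<open>a + b\<close> is the signed sum over the shuffles \<open>\<sigma>\<close> of the products of the
  antisymmetrizations of the two blocks selected by \<open>\<sigma>\<close>.  Indeed an alternating tensor is
  alternating in its first \<open>a\<close> and in its last \<open>b\<close> positions, so that it can be expanded over pairs of
  increasing words, and the pairs with a nonzero coefficient are those coming from shuffles.  Applying the
  induced map term by term gives the sum of the theorem.

  There remains the sign \<open>(-1)\<^sup>p\<^sup>q\<close>.  When \<open>p\<close> and \<open>q\<close> are not both odd, it is \<open>1\<close>.  When both are odd,
  \<open>\<nu>(p + q) = \<nu>(p) + \<nu>(q)\<close> forces \<open>N = 2\<close>; the sum over \<open>i + j \<le> N - 2\<close> then has one
  term, and its sign is the minus sign in the definition of the cup product.
\<close>

section \<open>Alternating functions on lists\<close>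

lemma length_perm_list [simp]: "length (perm_list \<sigma> xs) = length xs"
  by (simp add: perm_list_def del: upt_Suc)

lemma nth_perm_list:
  "i < length xs \<Longrightarrow> perm_list \<sigma> xs ! i = xs ! (inv_into UNIV \<sigma> (Suc i) - 1)"
  by (simp add: perm_list_def del: upt_Suc)

lemma perm_list_index:
  assumes "\<sigma> permutes {1..m}" "i < m"
  shows "\<sigma> (Suc i) \<ge> 1" "\<sigma> (Suc i) - 1 < m"
proof -
  have "\<sigma> (Suc i) \<in> {1..m}" using assms by (subst permutes_in_image[OF assms(1)]) auto
  then show "\<sigma> (Suc i) \<ge> 1" "\<sigma> (Suc i) - 1 < m" using assms(2) by auto
qed

lemma perm_list_id [simp]: "perm_list id xs = xs"
  by (intro nth_equalityI) (simp_all add: nth_perm_list)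

lemma perm_list_comp:
  assumes "\<sigma> permutes {1..length xs}" "\<tau> permutes {1..length xs}"
  shows "perm_list \<sigma> (perm_list \<tau> xs) = perm_list (\<sigma> \<circ> \<tau>) xs"
proof (intro nth_equalityI)
  fix i assume "i < length (perm_list \<sigma> (perm_list \<tau> xs))"
  then have i: "i < length xs" by simp
  have "inv_into UNIV (\<sigma> \<circ> \<tau>) = inv_into UNIV \<tau> \<circ> inv_into UNIV \<sigma>"
    using assms by (simp add: o_inv_distrib permutes_bij)
  then show "perm_list \<sigma> (perm_list \<tau> xs) ! i = perm_list (\<sigma> \<circ> \<tau>) xs ! i"
    using i perm_list_index[OF permutes_inv[OF assms(1)] i] by (simp add: nth_perm_list)
qed simp

lemma set_perm_list:
  assumes "\<sigma> permutes {1..length xs}"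
  shows "set (perm_list \<sigma> xs) = set xs"
proof -
  have sub: "set (perm_list \<tau> ys) \<subseteq> set ys" if "\<tau> permutes {1..length ys}" for \<tau> and ys :: "'a list"
  proof
    fix y assume "y \<in> set (perm_list \<tau> ys)"
    then obtain i where i: "i < length ys" "y = perm_list \<tau> ys ! i"
      by (auto simp: in_set_conv_nth)
    then show "y \<in> set ys"
      using perm_list_index[OF permutes_inv[OF that] i(1)] by (simp add: nth_perm_list)
  qed
  have "perm_list (inv_into UNIV \<sigma>) (perm_list \<sigma> xs) = xs"
    using assms by (simp add: perm_list_comp permutes_inv permutes_inv_o)
  then show ?thesis
    using sub[of \<sigma> xs] sub[of "inv_into UNIV \<sigma>" "perm_list \<sigma> xs"] assms by (auto simp: permutes_inv)
qed

lemma perm_list_inj: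
  assumes "distinct xs" "\<sigma> permutes {1..length xs}" "\<tau> permutes {1..length xs}"
    and eq: "perm_list \<sigma> xs = perm_list \<tau> xs"
  shows "\<sigma> = \<tau>"
proof -
  have "inv_into UNIV \<sigma> k = inv_into UNIV \<tau> k" for k
  proof (cases "k \<in> {1..length xs}")
    case True
    then obtain i where k: "k = Suc i" and i: "i < length xs"
      by (cases k) auto
    note b = perm_list_index[OF permutes_inv[OF assms(2)] i]
      perm_list_index[OF permutes_inv[OF assms(3)] i]
    have "xs ! (inv_into UNIV \<sigma> k - 1) = xs ! (inv_into UNIV \<tau> k - 1)"
      using arg_cong[OF eq, of "\<lambda>l. l ! i"] i k by (simp add: nth_perm_list)
    then have "inv_into UNIV \<sigma> k - 1 = inv_into UNIV \<tau> k - 1"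
      using b k assms(1) by (simp add: nth_eq_iff_index_eq)
    then show ?thesis using b k by simp
  next
    case False
    then show ?thesis using permutes_inv[OF assms(2)] permutes_inv[OF assms(3)]
      by (metis permutes_not_in)
  qed
  then have "inv_into UNIV \<sigma> = inv_into UNIV \<tau>" by blast
  then show ?thesis using assms(2,3) by (metis permutes_inv_inv)
qed

lemma perm_list_transpose:
  "perm_list (transpose (Suc (length us)) (Suc (Suc (length us)))) (us @ i # j # vs)
     = us @ j # i # vs"
proof (intro nth_equalityI)
  fix k
  assume "k < length (perm_list (transpose (Suc (length us)) (Suc (Suc (length us)))) (us @ i # j # vs))"
  then have k: "k < length (us @ i # j # vs)" by simp
  consider "k < length us" | "k = length us" | "k = Suc (length us)" | "k > Suc (length us)"
    by linarith
  then show "perm_list (transpose (Suc (length us)) (Suc (Suc (length us)))) (us @ i # j # vs) ! k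
      = (us @ j # i # vs) ! k"
    using k by cases (auto simp: nth_perm_list nth_append transpose_def nth_Cons split: nat.splits)
qed simp

definition antisym :: "('a list \<Rightarrow> 'k::comm_ring_1) \<Rightarrow> 'a list \<Rightarrow> 'k" where
  "antisym a ws =
     (\<Sum>\<sigma> | \<sigma> permutes {1..length ws}. of_int (sign \<sigma>) * a (perm_list \<sigma> ws))"

text \<open>
  The condition on equal neighbours is separate because it does not follow from the change of sign
  in characteristic two.
\<close>

definition alternating :: "nat \<Rightarrow> ('a list \<Rightarrow> 'k::comm_ring_1) \<Rightarrow> bool" where
  "alternating m a \<longleftrightarrow>
     (\<forall>us i j vs. Suc (Suc (length us + length vs)) = m \<longrightarrow>
        a (us @ j # i # vs) = - a (us @ i # j # vs) \<and> a (us @ i # i # vs) = 0)"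

text \<open>
  In characteristic two the change of sign alone does not force the sum to vanish, so the
  permutations are paired off as \<open>\<sigma>\<close> and \<open>\<sigma> \<circ> \<tau>\<close>.
\<close>

lemma signed_sum_right_invariant:
  fixes F :: "(nat \<Rightarrow> nat) \<Rightarrow> 'k::comm_ring_1"
  assumes \<tau>: "\<tau> permutes S" "sign \<tau> = -1" "\<tau> \<circ> \<tau> = id" and "finite S"
    and F: "\<And>\<sigma>. \<sigma> permutes S \<Longrightarrow> F (\<sigma> \<circ> \<tau>) = F \<sigma>"
  shows "(\<Sum>\<sigma> | \<sigma> permutes S. of_int (sign \<sigma>) * F \<sigma>) = 0"
proof -
  let ?E = "{\<sigma>. \<sigma> permutes S \<and> sign \<sigma> = 1}" and ?O = "{\<sigma>. \<sigma> permutes S \<and> sign \<sigma> = -1}"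
  have perm: "permutation \<sigma>" if "\<sigma> permutes S" for \<sigma>
    using that \<open>finite S\<close> by (auto simp: permutation_permutes)
  have fin: "finite {\<sigma>. \<sigma> permutes S}" using \<open>finite S\<close> by (rule finite_permutations)
  have split: "{\<sigma>. \<sigma> permutes S} = ?E \<union> ?O" by (auto simp: sign_def)
  have inv: "\<sigma> \<circ> \<tau> \<circ> \<tau> = \<sigma>" for \<sigma> using \<tau>(3) by (simp add: comp_assoc)
  have comp: "(\<sigma> \<circ> \<tau>) permutes S" "sign (\<sigma> \<circ> \<tau>) = - sign \<sigma>" if "\<sigma> permutes S" for \<sigma>
    using that \<tau> by (auto simp: permutes_compose sign_compose perm)
  have "(\<Sum>\<sigma>\<in>?O. of_int (sign \<sigma>) * F \<sigma>) = (\<Sum>\<sigma>\<in>?E. - F \<sigma>)"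
    by (rule sum.reindex_bij_witness[where i = "\<lambda>\<sigma>. \<sigma> \<circ> \<tau>" and j = "\<lambda>\<sigma>. \<sigma> \<circ> \<tau>"])
      (use inv comp F in auto)
  moreover have "(\<Sum>\<sigma>\<in>?E. of_int (sign \<sigma>) * F \<sigma>) = (\<Sum>\<sigma>\<in>?E. F \<sigma>)"
    by (rule sum.cong) auto
  moreover have "(\<Sum>\<sigma> | \<sigma> permutes S. of_int (sign \<sigma>) * F \<sigma>)
      = (\<Sum>\<sigma>\<in>?E. of_int (sign \<sigma>) * F \<sigma>) + (\<Sum>\<sigma>\<in>?O. of_int (sign \<sigma>) * F \<sigma>)"
    unfolding split by (rule sum.union_disjoint) (auto intro: finite_subset[OF _ fin])
  ultimately show ?thesis by (simp add: sum_negf)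
qed

lemma signed_sum_left_invariant:
  fixes F :: "(nat \<Rightarrow> nat) \<Rightarrow> 'k::comm_ring_1"
  assumes \<tau>: "\<tau> permutes S" "sign \<tau> = -1" "\<tau> \<circ> \<tau> = id" and "finite S"
    and F: "\<And>\<sigma>. \<sigma> permutes S \<Longrightarrow> F (\<tau> \<circ> \<sigma>) = F \<sigma>"
  shows "(\<Sum>\<sigma> | \<sigma> permutes S. of_int (sign \<sigma>) * F \<sigma>) = 0"
proof -
  have \<tau>inv: "inv_into UNIV \<tau> = \<tau>" using \<tau> by (metis inv_unique_comp)
  have "(\<Sum>\<sigma> | \<sigma> permutes S. of_int (sign \<sigma>) * F \<sigma>)
      = (\<Sum>\<sigma> | \<sigma> permutes S. of_int (sign (inv_into UNIV \<sigma>)) * F (inv_into UNIV \<sigma>))"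
    by (rule sum_permutations_inverse)
  also have "\<dots> = (\<Sum>\<sigma> | \<sigma> permutes S. of_int (sign \<sigma>) * F (inv_into UNIV \<sigma>))"
    by (rule sum.cong) (use \<open>finite S\<close> in \<open>auto simp: sign_inverse permutes_imp_permutation\<close>)
  also have "\<dots> = 0"
    by (rule signed_sum_right_invariant[OF assms(1-4)])
      (use F \<tau> in \<open>auto simp: o_inv_distrib permutes_bij \<tau>inv permutes_inv\<close>)
  finally show ?thesis .
qed

lemma sign_inv_permutes: "\<sigma> permutes {1..m::nat} \<Longrightarrow> sign (inv_into UNIV \<sigma>) = sign \<sigma>"
  by (rule sign_inverse, rule permutes_imp_permutation[of "{1..m}"]) auto

lemma adjacent_transposition:
  fixes k m :: nat
  assumes "Suc k < m"
  shows "transpose (Suc k) (Suc (Suc k)) permutes {1..m}"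
    "sign (transpose (Suc k) (Suc (Suc k))) = -1"
  using assms by (auto intro!: permutes_swap_id simp: sign_swap_id)

lemma antisym_add: "antisym (\<lambda>w. a w + b w) ws = antisym a ws + antisym b ws"
  by (simp add: antisym_def distrib_left sum.distrib)

lemma antisym_scale: "antisym (\<lambda>w. c * a w) ws = c * antisym a ws"
  by (simp add: antisym_def sum_distrib_left mult.left_commute)

lemma antisym_sum: "antisym (\<lambda>w. \<Sum>i\<in>I. a i w) ws = (\<Sum>i\<in>I. antisym (a i) ws)"
  unfolding antisym_def sum_distrib_left by (rule sum.swap)

lemma antisym_cong:
  "(\<And>w. length w = length ws \<Longrightarrow> set w = set ws \<Longrightarrow> a w = b w) \<Longrightarrow> antisym a ws = antisym b ws"
  unfolding antisym_def by (rule sum.cong) (auto simp: set_perm_list)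

lemma antisym_perm_list:
  assumes \<tau>: "\<tau> permutes {1..length ws}"
  shows "antisym a (perm_list \<tau> ws) = of_int (sign \<tau>) * antisym a ws"
proof -
  let ?S = "{1..length ws}"
  have sg: "sign \<sigma> = sign \<tau> * sign (\<sigma> \<circ> \<tau>)" if "\<sigma> permutes ?S" for \<sigma>
    using sign_compose[OF permutes_imp_permutation[OF _ that] permutes_imp_permutation[OF _ \<tau>]]
    by (simp add: sign_def)
  have "antisym a (perm_list \<tau> ws)
      = (\<Sum>\<sigma> | \<sigma> permutes ?S. of_int (sign \<tau>) * (of_int (sign (\<sigma> \<circ> \<tau>)) * a (perm_list (\<sigma> \<circ> \<tau>) ws)))"
    unfolding antisym_def length_perm_list
  proof (rule sum.cong[OF refl])
    fix \<sigma> assume "\<sigma> \<in> {\<sigma>. \<sigma> permutes ?S}"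
    then have \<sigma>: "\<sigma> permutes ?S" by simp
    show "of_int (sign \<sigma>) * a (perm_list \<sigma> (perm_list \<tau> ws))
        = of_int (sign \<tau>) * (of_int (sign (\<sigma> \<circ> \<tau>)) * a (perm_list (\<sigma> \<circ> \<tau>) ws))"
      unfolding perm_list_comp[OF \<sigma> \<tau>] by (subst sg[OF \<sigma>]) (simp add: mult.assoc)
  qed
  also have "\<dots> = (\<Sum>\<sigma> | \<sigma> permutes ?S. of_int (sign \<tau>) * (of_int (sign \<sigma>) * a (perm_list \<sigma> ws)))"
    by (rule sum_permutations_compose_right[OF \<tau>, symmetric])
  finally show ?thesis by (simp add: antisym_def sum_distrib_left)
qed

lemma alternating_antisym: "alternating m (antisym a)"
  unfolding alternating_def
proof (intro allI impI conjI)
  fix us vs :: "'a list" and i j :: 'a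
  assume m: "Suc (Suc (length us + length vs)) = m"
  define \<tau> where "\<tau> = transpose (Suc (length us)) (Suc (Suc (length us)))"
  have \<tau>: "\<tau> permutes {1..m}" "sign \<tau> = -1" "\<tau> \<circ> \<tau> = id"
    using adjacent_transposition[of "length us" m] m by (auto simp: \<tau>_def)
  show "antisym a (us @ j # i # vs) = - antisym a (us @ i # j # vs)"
    using antisym_perm_list[of \<tau> "us @ i # j # vs" a] \<tau> m by (simp add: \<tau>_def perm_list_transpose)
  show "antisym a (us @ i # i # vs) = 0"
  proof -
    let ?ws = "us @ i # i # vs"
    have fixed: "perm_list \<tau> ?ws = ?ws" by (simp add: \<tau>_def perm_list_transpose)
    have "(\<Sum>\<sigma> | \<sigma> permutes {1..m}. of_int (sign \<sigma>) * a (perm_list \<sigma> ?ws)) = 0"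
    proof (rule signed_sum_right_invariant[OF \<tau>])
      fix \<sigma> assume "\<sigma> permutes {1..m}"
      then have "perm_list \<sigma> (perm_list \<tau> ?ws) = perm_list (\<sigma> \<circ> \<tau>) ?ws"
        using \<tau> m by (intro perm_list_comp) auto
      then show "a (perm_list (\<sigma> \<circ> \<tau>) ?ws) = a (perm_list \<sigma> ?ws)" by (simp add: fixed)
    qed simp
    then show ?thesis using m by (simp add: antisym_def)
  qed
qed

text \<open>
  A function symmetric in two fixed adjacent positions is killed by antisymmetrization. Here the
  permutations are paired off by composing with the transposition from the left, whereas
  alternation of an antisymmetrized function uses composition from the right.
\<close>

lemma antisym_symmetric_eq_0:
  assumes "Suc (Suc k) \<le> length ws"
    and sym: "\<And>us i j vs. length us = k \<Longrightarrow> length (us @ i # j # vs) = length ws \<Longrightarrow>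
      a (us @ j # i # vs) = a (us @ i # j # vs)"
  shows "antisym a ws = 0"
proof -
  define \<tau> where "\<tau> = transpose (Suc k) (Suc (Suc k))"
  have \<tau>: "\<tau> permutes {1..length ws}" "sign \<tau> = -1" "\<tau> \<circ> \<tau> = id"
    using adjacent_transposition[of k "length ws"] assms(1) by (auto simp: \<tau>_def)
  show ?thesis unfolding antisym_def
  proof (rule signed_sum_left_invariant[OF \<tau>])
    fix \<sigma> assume \<sigma>: "\<sigma> permutes {1..length ws}"
    define xs where "xs = perm_list \<sigma> ws"
    have len: "length xs = length ws" by (simp add: xs_def)
    obtain us i j vs where xs: "xs = us @ i # j # vs" and lk: "length us = k"
    proof
      show "xs = take k xs @ xs ! k # xs ! Suc k # drop (Suc (Suc k)) xs"
        using assms(1) len by (simp add: Cons_nth_drop_Suc)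
      show "length (take k xs) = k" using assms(1) len by simp
    qed
    have "perm_list (\<tau> \<circ> \<sigma>) ws = perm_list \<tau> xs"
      unfolding xs_def using \<sigma> \<tau> by (simp add: perm_list_comp)
    also have "\<dots> = us @ j # i # vs" by (simp add: xs \<tau>_def perm_list_transpose flip: lk)
    also have "a \<dots> = a xs"
      unfolding xs by (rule sym) (use lk len xs in auto)
    finally show "a (perm_list (\<tau> \<circ> \<sigma>) ws) = a (perm_list \<sigma> ws)" by (simp add: xs_def)
  qed simp
qed

text \<open>
  Bubble sort as an induction principle: exchanging two adjacent entries in the wrong order
  makes a list lexicographically smaller.
\<close>

lemma bubble_sort_induct [consumes 2, case_names increasing repeated swap]:
  fixes ws :: "nat list"
  assumes "length ws = m" "set ws \<subseteq> S"
    and inc: "\<And>ws. length ws = m \<Longrightarrow> set ws \<subseteq> S \<Longrightarrow> sorted_wrt (<) ws \<Longrightarrow> P ws"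
    and rep: "\<And>us i vs. Suc (Suc (length us + length vs)) = m \<Longrightarrow>
      set (us @ i # i # vs) \<subseteq> S \<Longrightarrow> P (us @ i # i # vs)"
    and swap: "\<And>us i j vs. Suc (Suc (length us + length vs)) = m \<Longrightarrow>
      set (us @ i # j # vs) \<subseteq> S \<Longrightarrow> P (us @ i # j # vs) \<Longrightarrow> P (us @ j # i # vs)"
  shows "P ws"
proof -
  have "wf (lenlex less_than)" by (simp add: wf_lenlex)
  then show ?thesis using assms(1,2)
  proof (induction ws rule: wf_induct_rule)
    case (less ws)
    show ?case
    proof (cases "sorted_wrt (<) ws")
      case True
      with less.prems inc show ?thesis by blast
    next
      case False
      then obtain k where k: "Suc k < length ws" "\<not> ws ! k < ws ! Suc k"
        by (auto simp: sorted_wrt_iff_nth_Suc_transp transp_def)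
      obtain us i j vs where ws: "ws = us @ j # i # vs" and le: "i \<le> j"
      proof
        show "ws = take k ws @ ws ! k # ws ! Suc k # drop (Suc (Suc k)) ws"
          using k by (simp add: Cons_nth_drop_Suc)
        show "ws ! Suc k \<le> ws ! k" using k by simp
      qed
      have len: "Suc (Suc (length us + length vs)) = m" and set: "set (us @ i # j # vs) \<subseteq> S"
        using less.prems by (auto simp: ws)
      show ?thesis
      proof (cases "i = j")
        case True
        then show ?thesis using rep[OF len] set by (simp add: ws)
      next
        case False
        with le have "(us @ i # j # vs, us @ j # i # vs) \<in> lenlex less_than"
          by (auto simp: lenlex_conv lex_conv) (rule exI[of _ us], rule exI[of _ i], auto)
        then have "P (us @ i # j # vs)"
          using less.IH len set by (simp add: ws)
        then show ?thesis using swap[OF len] set by (simp add: ws)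
      qed
    qed
  qed
qed

definition increasing_lists :: "nat \<Rightarrow> nat set \<Rightarrow> nat list set" where
  "increasing_lists m S = {ws. length ws = m \<and> set ws \<subseteq> S \<and> sorted_wrt (<) ws}"

lemma finite_increasing_lists: "finite S \<Longrightarrow> finite (increasing_lists m S)"
  by (rule finite_subset[OF _ finite_lists_length_eq[of S m]]) (auto simp: increasing_lists_def)

text \<open>
  \<open>perm_sign ws is\<close> is the sign of the rearrangement of \<open>ws\<close> into \<open>is\<close>, when there is
  exactly one; it is zero when there is none or when letters are repeated.
\<close>

definition perm_sign :: "'a list \<Rightarrow> 'a list \<Rightarrow> 'k::comm_ring_1" where
  "perm_sign ws is = antisym (\<lambda>w. of_bool (w = is)) ws"

lemma perm_sign_neq_0D:
  assumes "perm_sign ws is \<noteq> (0::'k::comm_ring_1)"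
  obtains \<sigma> where "\<sigma> permutes {1..length ws}" "perm_list \<sigma> ws = is"
proof -
  have "\<exists>\<sigma>. \<sigma> permutes {1..length ws} \<and> of_int (sign \<sigma>) * of_bool (perm_list \<sigma> ws = is) \<noteq> (0::'k)"
  proof (rule ccontr)
    assume "\<not> ?thesis"
    then have "perm_sign ws is = (0::'k)"
      unfolding perm_sign_def antisym_def by (intro sum.neutral) blast
    with assms show False by simp
  qed
  then obtain \<sigma> where "\<sigma> permutes {1..length ws}" "perm_list \<sigma> ws = is"
    by (metis mult_zero_right of_bool_eq(1))
  with that show ?thesis .
qed

lemma perm_sign_perm_list:
  assumes "distinct is" "\<tau> permutes {1..length is}"
  shows "perm_sign (perm_list \<tau> is) is = (of_int (sign \<tau>) :: 'k::comm_ring_1)"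
proof -
  have iff: "perm_list \<sigma> is = is \<longleftrightarrow> \<sigma> = id" if "\<sigma> permutes {1..length is}" for \<sigma>
    using perm_list_inj[OF assms(1) that permutes_id] by auto
  have "perm_sign is is = (\<Sum>\<sigma> | \<sigma> permutes {1..length is}. if \<sigma> = id then 1 else (0::'k))"
    unfolding perm_sign_def antisym_def
    by (rule sum.cong) (auto simp: iff sign_id)
  also have "\<dots> = 1" by (simp add: finite_permutations permutes_id)
  finally have "perm_sign is is = (1::'k)" .
  then show ?thesis using antisym_perm_list[OF assms(2), of "\<lambda>w. of_bool (w = is) :: 'k"]
    by (simp add: perm_sign_def)
qed

lemma perm_sign_increasing:
  fixes ws "is" :: "nat list"
  assumes "sorted_wrt (<) ws" "sorted_wrt (<) is"
  shows "perm_sign ws is = (of_bool (ws = is) :: 'k::comm_ring_1)"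
proof (cases "ws = is")
  case True
  then show ?thesis
    using perm_sign_perm_list[of "is" id] assms by (simp add: strict_sorted_iff permutes_id sign_id)
next
  case False
  have "perm_sign ws is = (0::'k)"
  proof (rule ccontr)
    assume "\<not> ?thesis"
    then obtain \<sigma> where \<sigma>: "\<sigma> permutes {1..length ws}" "perm_list \<sigma> ws = is"
      by (rule perm_sign_neq_0D)
    then have "set ws = set is" using set_perm_list by blast
    then show False using False assms by (simp add: strict_sorted_equal)
  qed
  with False show ?thesis by simp
qed

lemma alternatingD:
  assumes "alternating m a" "Suc (Suc (length us + length vs)) = m"
  shows "a (us @ j # i # vs) = - a (us @ i # j # vs)" "a (us @ i # i # vs) = 0"
  using assms unfolding alternating_def by blast+

lemma alternating_scale:
  assumes "alternating m a"
  shows "alternating m (\<lambda>w. c * a w)"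
  unfolding alternating_def
proof (intro allI impI)
  fix us vs :: "'a list" and i j :: 'a
  assume len: "Suc (Suc (length us + length vs)) = m"
  have "a (us @ j # i # vs) = - a (us @ i # j # vs)" "a (us @ i # i # vs) = 0"
    by (rule alternatingD[OF assms len])+
  then show "c * a (us @ j # i # vs) = - (c * a (us @ i # j # vs)) \<and> c * a (us @ i # i # vs) = 0"
    by simp
qed

text \<open>
  Rearranging \<open>ws\<close> into \<open>is\<close> and \<open>is\<close> into \<open>ws\<close> are inverse to each other and have the same sign.
\<close>

lemma perm_sign_commute:
  assumes "length ws = length is"
  shows "perm_sign ws is = (perm_sign is ws :: 'k::comm_ring_1)"
proof -
  have eq: "perm_list (inv_into UNIV \<sigma>) ws = is \<longleftrightarrow> perm_list \<sigma> is = ws"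
    if "\<sigma> permutes {1..length ws}" for \<sigma>
    using that assms perm_list_comp[of \<sigma> ws "inv_into UNIV \<sigma>"]
      perm_list_comp[of "inv_into UNIV \<sigma>" "is" \<sigma>]
    by (auto simp: permutes_inv permutes_inv_o)
  have "perm_sign ws is = (\<Sum>\<sigma> | \<sigma> permutes {1..length ws}.
      of_int (sign (inv_into UNIV \<sigma>)) * of_bool (perm_list (inv_into UNIV \<sigma>) ws = is))"
    unfolding perm_sign_def antisym_def by (rule sum_permutations_inverse)
  also have "\<dots> = (perm_sign is ws :: 'k)"
    unfolding perm_sign_def antisym_def
    by (rule sum.cong) (use assms in \<open>auto simp: eq sign_inv_permutes\<close>)
  finally show ?thesis .
qed

lemma alternating_perm_sign: "alternating m (\<lambda>ws. perm_sign ws is :: 'k::comm_ring_1)"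
  unfolding perm_sign_def using alternating_antisym by blast

text \<open>
  Both sides alternate in \<open>ws\<close>, so by bubble sort it suffices to compare them on increasing lists,
  where \<open>perm_sign\<close> is the Kronecker delta.
\<close>

lemma alternating_expansion:
  fixes a :: "nat list \<Rightarrow> 'k::comm_ring_1"
  assumes "alternating m a" "finite S" "length ws = m" "set ws \<subseteq> S"
  shows "a ws = (\<Sum>is\<in>increasing_lists m S. a is * perm_sign ws is)"
  using assms(3,4)
proof (induction ws rule: bubble_sort_induct)
  case (increasing ws)
  then have ws: "ws \<in> increasing_lists m S" by (simp add: increasing_lists_def)
  have "(\<Sum>is\<in>increasing_lists m S. a is * perm_sign ws is)
      = (\<Sum>is\<in>increasing_lists m S. if is = ws then a is else 0)"
    by (rule sum.cong)
      (use increasing in \<open>auto simp: increasing_lists_def perm_sign_increasing\<close>)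
  also have "\<dots> = a ws" using ws finite_increasing_lists[OF \<open>finite S\<close>, of m] by simp
  finally show ?case by simp
next
  case (repeated us i vs)
  then show ?case
    using alternatingD(2)[OF assms(1), of us vs i]
      alternatingD(2)[OF alternating_perm_sign[where 'k = 'k], of us vs m i] by simp
next
  case (swap us i j vs)
  note \<open>Suc (Suc (length us + length vs)) = m\<close>[simp]
  have "a (us @ j # i # vs) = - a (us @ i # j # vs)" by (rule alternatingD[OF assms(1)]) simp
  moreover have "perm_sign (us @ j # i # vs) is = - (perm_sign (us @ i # j # vs) is ::'k)" for "is"
    by (rule alternatingD[OF alternating_perm_sign]) simp
  ultimately show ?case using swap by (simp add: sum_negf)
qed

section \<open>Quotients of algebras\<close>

context
  fixes R :: "('k, 'a) module" and I :: "'a set"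
  assumes I: "ideal I R"
begin

interpretation ideal I R by (rule I)

lemma carrier_quot_alg: "carrier (quot_alg R I) = (\<lambda>x. I +>\<^bsub>R\<^esub> x) ` carrier R"
  by (auto simp: quot_alg_def FactRing_def A_RCOSETS_defs a_r_coset_def)

lemma quot_alg_add:
  "\<lbrakk>x \<in> carrier R; y \<in> carrier R\<rbrakk> \<Longrightarrow>
     (I +>\<^bsub>R\<^esub> x) \<oplus>\<^bsub>quot_alg R I\<^esub> (I +>\<^bsub>R\<^esub> y) = I +>\<^bsub>R\<^esub> (x \<oplus>\<^bsub>R\<^esub> y)"
  by (simp add: quot_alg_def FactRing_def a_rcos_sum)

lemma quot_alg_mult:
  "\<lbrakk>x \<in> carrier R; y \<in> carrier R\<rbrakk> \<Longrightarrow>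
     (I +>\<^bsub>R\<^esub> x) \<otimes>\<^bsub>quot_alg R I\<^esub> (I +>\<^bsub>R\<^esub> y) = I +>\<^bsub>R\<^esub> (x \<otimes>\<^bsub>R\<^esub> y)"
  by (simp add: quot_alg_def FactRing_def rcoset_mult_add)

lemma quot_alg_one: "\<one>\<^bsub>quot_alg R I\<^esub> = I +>\<^bsub>R\<^esub> \<one>\<^bsub>R\<^esub>"
  by (simp add: quot_alg_def FactRing_def)

lemma quot_alg_zero: "\<zero>\<^bsub>quot_alg R I\<^esub> = I +>\<^bsub>R\<^esub> \<zero>\<^bsub>R\<^esub>"
  using a_coset_add_zero[OF a_subset] by (simp add: quot_alg_def FactRing_def)

lemma quot_alg_smult:
  assumes "c \<odot>\<^bsub>R\<^esub> \<one>\<^bsub>R\<^esub> \<in> carrier R" "x \<in> carrier R"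
  shows "c \<odot>\<^bsub>quot_alg R I\<^esub> (I +>\<^bsub>R\<^esub> x) = I +>\<^bsub>R\<^esub> ((c \<odot>\<^bsub>R\<^esub> \<one>\<^bsub>R\<^esub>) \<otimes>\<^bsub>R\<^esub> x)"
  using assms by (simp add: quot_alg_def FactRing_def rcoset_mult_add)

lemma ring_quot_alg: "ring (quot_alg R I)"
proof -
  interpret Q: ring "R Quot I" by (rule quotient_is_ring)
  show ?thesis
  proof (rule ringI)
    show "abelian_group (quot_alg R I)"
      by (rule abelian_groupI)
        (auto simp: quot_alg_def Q.a_ac intro: bexI[of _ "\<ominus>\<^bsub>R Quot I\<^esub> _"] Q.l_neg)
    show "Group.monoid (quot_alg R I)"
      by (rule monoidI) (auto simp: quot_alg_def Q.m_assoc)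
  qed (auto simp: quot_alg_def Q.l_distr Q.r_distr)
qed

lemma coset_eq_iff:
  "\<lbrakk>x \<in> carrier R; y \<in> carrier R\<rbrakk> \<Longrightarrow> (I +>\<^bsub>R\<^esub> x = I +>\<^bsub>R\<^esub> y) \<longleftrightarrow> x \<ominus>\<^bsub>R\<^esub> y \<in> I"
  using quotient_eq_iff_same_a_r_cos[OF I] by blast

end


(* Sets of positions keep the form {1..m}. *)
declare One_nat_def [simp del]

section \<open>Linear functionals on a free algebra\<close>

definition extend_linearly :: "('a \<Rightarrow> 'k) \<Rightarrow> ('a \<Rightarrow>\<^sub>0 'k) \<Rightarrow> 'k::comm_ring_1" where
  "extend_linearly g z = (\<Sum>w\<in>Poly_Mapping.keys z. Poly_Mapping.lookup z w * g w)"

lemma extend_linearly_superset: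
  assumes "finite A" "Poly_Mapping.keys z \<subseteq> A"
  shows "extend_linearly g z = (\<Sum>w\<in>A. Poly_Mapping.lookup z w * g w)"
  unfolding extend_linearly_def
  by (rule sum.mono_neutral_left) (use assms in \<open>auto simp: in_keys_iff\<close>)

lemma extend_linearly_zero [simp]: "extend_linearly g 0 = 0"
  by (simp add: extend_linearly_def)

lemma extend_linearly_single [simp]: "extend_linearly g (Poly_Mapping.single w c) = c * g w"
  by (simp add: extend_linearly_def)

lemma extend_linearly_add [simp]:
  "extend_linearly g (x + y) = extend_linearly g x + extend_linearly g y"
proof -
  let ?A = "Poly_Mapping.keys x \<union> Poly_Mapping.keys y"
  have "extend_linearly g z = (\<Sum>w\<in>?A. Poly_Mapping.lookup z w * g w)"
    if "Poly_Mapping.keys z \<subseteq> ?A" for z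
    using that by (intro extend_linearly_superset) auto
  from this[of "x + y"] this[of x] this[of y] show ?thesis
    by (simp add: Poly_Mapping.keys_add lookup_add distrib_right sum.distrib)
qed

lemma extend_linearly_sum [simp]:
  "extend_linearly g (\<Sum>i\<in>A. h i) = (\<Sum>i\<in>A. extend_linearly g (h i))"
  by (induction A rule: infinite_finite_induct) simp_all

lemma extend_linearly_uminus [simp]: "extend_linearly g (- x) = - extend_linearly g x"
  using extend_linearly_add[of g x "- x"] by (simp add: eq_neg_iff_add_eq_0 add.commute)

lemma extend_linearly_diff [simp]:
  "extend_linearly g (x - y) = extend_linearly g x - extend_linearly g y"
  using extend_linearly_add[of g x "- y"] by simp

lemma poly_mapping_monomial_induct [case_names zero single add]:
  fixes z :: "'a \<Rightarrow>\<^sub>0 'k::comm_monoid_add"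
  assumes "P 0" "\<And>w c. P (Poly_Mapping.single w c)" "\<And>x y. P x \<Longrightarrow> P y \<Longrightarrow> P (x + y)"
  shows "P z"
proof (induction z rule: update_induct)
  case const
  show ?case by (rule assms(1))
next
  case (update f a b)
  have "Poly_Mapping.update a b f = f + Poly_Mapping.single a b"
    by (rule poly_mapping_eqI)
      (use update in \<open>auto simp: lookup_update lookup_add lookup_single in_keys_iff when_def\<close>)
  with assms update show ?case by simp
qed

lemma single_zero_commute:
  fixes z :: "'a::monoid_add \<Rightarrow>\<^sub>0 'k::comm_ring_1"
  shows "z * Poly_Mapping.single 0 c = Poly_Mapping.single 0 c * z"
  by (induction z rule: poly_mapping_monomial_induct)
    (simp_all add: mult_single mult.commute distrib_left distrib_right)

lemma extend_linearly_scale [simp]: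
  fixes z :: "'a::monoid_add \<Rightarrow>\<^sub>0 'k::comm_ring_1"
  shows "extend_linearly g (Poly_Mapping.single 0 c * z) = c * extend_linearly g z"
  by (induction z rule: poly_mapping_monomial_induct)
    (simp_all add: mult_single distrib_left mult.assoc)

lemma zero_word: "(0 :: 'a word) = Word []"
  by (simp add: zero_word_def)

lemma Word_plus [simp]: "Word xs + Word ys = Word (xs @ ys)"
  by (simp add: plus_word_def)

lemma monomial_Nil: "monomial [] = 1"
  by (simp add: monomial_def flip: zero_word)

lemma monomial_append: "monomial (xs @ ys) = monomial xs * monomial ys"
  by (simp add: monomial_def mult_single)

lemma monomial_Cons: "monomial (x # xs) = monomial [x] * monomial xs"
  using monomial_append[of "[x]" xs] by simp

lemma single_word: "Poly_Mapping.single w c = Poly_Mapping.single 0 c * monomial (letters w)"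
  by (simp add: monomial_def mult_single)

lemma carrier_free_alg [simp]: "carrier free_alg = UNIV"
  and mult_free_alg [simp]: "x \<otimes>\<^bsub>free_alg\<^esub> y = x * y"
  and add_free_alg [simp]: "x \<oplus>\<^bsub>free_alg\<^esub> y = x + y"
  and zero_free_alg [simp]: "\<zero>\<^bsub>free_alg\<^esub> = 0"
  and one_free_alg [simp]: "\<one>\<^bsub>free_alg\<^esub> = 1"
  and smult_free_alg [simp]: "c \<odot>\<^bsub>free_alg\<^esub> x = Poly_Mapping.single 0 c * x"
  by (simp_all add: free_alg_def)

lemma ring_free_alg: "ring (free_alg :: ('k::field, 'v word \<Rightarrow>\<^sub>0 'k) module)"
proof (rule ringI)
  show "abelian_group (free_alg :: ('k::field, 'v word \<Rightarrow>\<^sub>0 'k) module)"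
    by (rule abelian_groupI) (auto simp: add.assoc add.commute intro: exI[of _ "- _"] left_minus)
  show "Group.monoid (free_alg :: ('k::field, 'v word \<Rightarrow>\<^sub>0 'k) module)"
    by (rule monoidI) (auto simp: mult.assoc)
qed (auto simp: distrib_left distrib_right)

lemma a_inv_free_alg [simp]: "\<ominus>\<^bsub>free_alg\<^esub> x = - x"
proof -
  interpret ring free_alg by (rule ring_free_alg)
  show ?thesis by (rule minus_equality) auto
qed

lemma a_minus_free_alg [simp]: "x \<ominus>\<^bsub>free_alg\<^esub> y = x - y"
  by (simp add: a_minus_def)


section \<open>Coordinates on the tensor algebra\<close>

locale based_space = finite_dimensional_vector_space scale "e ` {1..n}"
  for scale :: "'k::field \<Rightarrow> 'v::ab_group_add \<Rightarrow> 'v" and e :: "nat \<Rightarrow> 'v" and n :: nat +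
  assumes inj_e: "inj_on e {1..n}"
begin

abbreviation T where "T \<equiv> tensor_alg scale"

abbreviation cls :: "('v word \<Rightarrow>\<^sub>0 'k) \<Rightarrow> ('v word \<Rightarrow>\<^sub>0 'k) set" where
  "cls z \<equiv> tensor_ideal scale +>\<^bsub>free_alg\<^esub> z"

text \<open>
  Indices outside \<open>{1..n}\<close> get the coordinate \<open>0\<close>: the value of \<open>e\<close> there is arbitrary and could
  coincide with a basis vector.
\<close>

definition coord :: "nat \<Rightarrow> 'v \<Rightarrow> 'k" where
  "coord i v = (if i \<in> {1..n} then representation (e ` {1..n}) v (e i) else 0)"

lemma coord_add: "coord i (x + y) = coord i x + coord i y"
  by (simp add: coord_def representation_add independent_Basis span_Basis)

lemma coord_scale: "coord i (scale c x) = c * coord i x"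
  by (simp add: coord_def representation_scale independent_Basis span_Basis)

lemma coord_basis:
  assumes "j \<in> {1..n}"
  shows "coord i (e j) = of_bool (i = j)"
proof -
  have "representation (e ` {1..n}) (e j) = (\<lambda>v. if v = e j then 1 else 0)"
    by (rule representation_basis[OF independent_Basis imageI[OF assms]])
  then show ?thesis using assms inj_on_eq_iff[OF inj_e, of i j] by (simp add: coord_def)
qed

lemma coord_expansion: "x = (\<Sum>i\<in>{1..n}. scale (coord i x) (e i))"
proof -
  have "(\<Sum>b\<in>e ` {1..n}. scale (representation (e ` {1..n}) x b) b) = x"
    by (rule sum_representation_eq) (auto simp: independent_Basis span_Basis)
  then show ?thesis by (simp add: sum.reindex[OF inj_e] coord_def)
qed

definition word_coord :: "nat list \<Rightarrow> 'v list \<Rightarrow> 'k" where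
  "word_coord ws xs = (if length ws = length xs then prod_list (map2 coord ws xs) else 0)"

lemma word_coord_Nil [simp]: "word_coord ws [] = of_bool (ws = [])"
  by (simp add: word_coord_def)

lemma word_coord_Cons [simp]: "word_coord (i # ws) (x # xs) = coord i x * word_coord ws xs"
  by (simp add: word_coord_def)

lemma word_coord_length: "length ws \<noteq> length xs \<Longrightarrow> word_coord ws xs = 0"
  by (simp add: word_coord_def)

lemma word_coord_append_same:
  "length us = length xs \<Longrightarrow> word_coord (us @ vs) (xs @ ys) = word_coord us xs * word_coord vs ys"
  by (simp add: word_coord_def)

lemma word_coord_append:
  "word_coord ws (xs @ ys) = (\<Sum>k\<le>length ws. word_coord (take k ws) xs * word_coord (drop k ws) ys)"
proof (cases "length xs \<le> length ws")
  case True
  have "(\<Sum>k\<le>length ws. word_coord (take k ws) xs * word_coord (drop k ws) ys)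
      = (\<Sum>k\<in>{length xs}. word_coord (take k ws) xs * word_coord (drop k ws) ys)"
    by (rule sum.mono_neutral_right) (use True in \<open>auto intro!: word_coord_length\<close>)
  also have "\<dots> = word_coord ws (xs @ ys)"
    using word_coord_append_same[of "take (length xs) ws" xs "drop (length xs) ws" ys] True by simp
  finally show ?thesis ..
next
  case False
  then show ?thesis by (auto intro!: sum.neutral[symmetric] simp: word_coord_length)
qed

lemma word_coord_basis:
  "set xs \<subseteq> {1..n} \<Longrightarrow> word_coord ws (map e xs) = of_bool (ws = xs)"
proof (induction xs arbitrary: ws)
  case (Cons x xs)
  then show ?case
    by (cases ws) (auto simp: coord_basis word_coord_length)
qed simp

lemma word_coord_outside: "\<not> set ws \<subseteq> {1..n} \<Longrightarrow> word_coord ws xs = 0"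
proof (induction ws arbitrary: xs)
  case (Cons w ws)
  then show ?case by (cases xs) (auto simp: coord_def word_coord_length)
qed simp

text \<open>
  Permuting the letters of a tensor amounts to permuting the positions of the coordinate word by the
  inverse; this is what turns \<open>Ant\<close> into the antisymmetrization of coordinates.
\<close>

lemma word_coord_perm_list:
  assumes \<sigma>: "\<sigma> permutes {1..length xs}" and len: "length ws = length xs"
  shows "word_coord ws (perm_list \<sigma> xs) = word_coord (perm_list (inv_into UNIV \<sigma>) ws) xs"
proof -
  note inv = permutes_inv[OF \<sigma>]
  have Suc: "Suc (\<sigma> (Suc i) - 1) = \<sigma> (Suc i)"
    "Suc (inv_into UNIV \<sigma> (Suc i) - 1) = inv_into UNIV \<sigma> (Suc i)" if "i < length xs" for i
    using perm_list_index[OF \<sigma> that] perm_list_index[OF inv that] by simp_all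
  have "(\<Prod>i<length xs. coord (ws ! i) (xs ! (inv_into UNIV \<sigma> (Suc i) - 1)))
      = (\<Prod>j<length xs. coord (ws ! (\<sigma> (Suc j) - 1)) (xs ! j))"
    by (rule prod.reindex_bij_witness[where i = "\<lambda>j. \<sigma> (Suc j) - 1"
          and j = "\<lambda>i. inv_into UNIV \<sigma> (Suc i) - 1"])
      (use perm_list_index[OF \<sigma>] perm_list_index[OF inv] in
        \<open>auto simp: Suc permutes_inverses[OF \<sigma>]\<close>)
  then show ?thesis
    using \<sigma> len
    by (simp add: word_coord_def prod.list_conv_set_nth nth_perm_list permutes_inv_inv atLeast0LessThan)
qed

definition free_coord :: "nat list \<Rightarrow> ('v word \<Rightarrow>\<^sub>0 'k) \<Rightarrow> 'k" where
  "free_coord ws = extend_linearly (\<lambda>w. word_coord ws (letters w))"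

lemma free_coord_simps [simp]:
  "free_coord ws 0 = 0"
  "free_coord ws (x + y) = free_coord ws x + free_coord ws y"
  "free_coord ws (- x) = - free_coord ws x"
  "free_coord ws (x - y) = free_coord ws x - free_coord ws y"
  "free_coord ws (sum h A) = (\<Sum>i\<in>A. free_coord ws (h i))"
  "free_coord ws (Poly_Mapping.single 0 c * x) = c * free_coord ws x"
  "free_coord ws (Poly_Mapping.single w c) = c * word_coord ws (letters w)"
  "free_coord ws (monomial xs) = word_coord ws xs"
  by (simp_all add: free_coord_def monomial_def)

lemma free_coord_mult:
  "free_coord ws (y * z) = (\<Sum>k\<le>length ws. free_coord (take k ws) y * free_coord (drop k ws) z)"
proof (induction y rule: poly_mapping_monomial_induct)
  case (single u c)
  show ?case
  proof (induction z rule: poly_mapping_monomial_induct)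
    case (single v d)
    have "letters (u + v) = letters u @ letters v" by (simp add: plus_word_def)
    then show ?case
      by (simp add: mult_single word_coord_append sum_distrib_left mult_ac)
  qed (simp_all add: distrib_left sum.distrib)
qed (simp_all add: distrib_right sum.distrib)

lemma ideal_tensor_ideal: "ideal (tensor_ideal scale) free_alg"
  unfolding tensor_ideal_def by (rule ring.genideal_ideal[OF ring_free_alg]) simp

lemma cls_eq_iff_diff: "cls x = cls y \<longleftrightarrow> x - y \<in> tensor_ideal scale"
  using coset_eq_iff[OF ideal_tensor_ideal, of x y] by simp

lemma cls_add: "cls x \<oplus>\<^bsub>T\<^esub> cls y = cls (x + y)"
  using quot_alg_add[OF ideal_tensor_ideal, of x y] by (simp add: tensor_alg_def)

lemma cls_mult: "cls x \<otimes>\<^bsub>T\<^esub> cls y = cls (x * y)"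
  using quot_alg_mult[OF ideal_tensor_ideal, of x y] by (simp add: tensor_alg_def)

lemma cls_smult: "c \<odot>\<^bsub>T\<^esub> cls x = cls (Poly_Mapping.single 0 c * x)"
  using quot_alg_smult[OF ideal_tensor_ideal, of c x] by (simp add: tensor_alg_def)

lemma one_T: "\<one>\<^bsub>T\<^esub> = cls 1"
  using quot_alg_one[OF ideal_tensor_ideal] by (simp add: tensor_alg_def)

lemma zero_T: "\<zero>\<^bsub>T\<^esub> = cls 0"
  using quot_alg_zero[OF ideal_tensor_ideal] by (simp add: tensor_alg_def)

lemma carrier_T: "carrier T = range cls"
  using carrier_quot_alg[OF ideal_tensor_ideal] by (simp add: tensor_alg_def)

lemma ring_T: "ring T"
  unfolding tensor_alg_def by (rule ring_quot_alg[OF ideal_tensor_ideal])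

sublocale T: ring T by (rule ring_T)

text \<open>
  The common kernel of the coordinates is an ideal because the coordinates of a product are sums of
  products of coordinates, one for each way to cut the word in two.
\<close>

lemma tensor_ideal_coord:
  assumes "z \<in> tensor_ideal scale"
  shows "free_coord ws z = 0"
proof -
  let ?K = "{z. \<forall>ws. free_coord ws z = 0}"
  have "ideal ?K free_alg"
  proof (rule idealI[OF ring_free_alg])
    show "subgroup ?K (add_monoid free_alg)"
    proof (rule subgroup.intro)
      fix x assume "x \<in> ?K"
      then show "inv\<^bsub>add_monoid free_alg\<^esub> x \<in> ?K"
        unfolding a_inv_free_alg[unfolded a_inv_def] by simp
    qed auto
  qed (auto simp: free_coord_mult)
  moreover have "linearity_rels scale \<subseteq> ?K"
  proof -
    have "word_coord ws [x + y] = word_coord ws [x] + word_coord ws [y]"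
      "word_coord ws [scale c x] = c * word_coord ws [x]" for ws x y c
      by (cases ws; simp add: word_coord_def coord_add coord_scale)+
    then show ?thesis by (auto simp: linearity_rels_def)
  qed
  ultimately have "tensor_ideal scale \<subseteq> ?K"
    unfolding tensor_ideal_def by (rule ring.genideal_minimal[OF ring_free_alg])
  with assms show ?thesis by auto
qed

definition words :: "nat \<Rightarrow> nat list set" where
  "words m = {ws. set ws \<subseteq> {1..n} \<and> length ws = m}"

lemma finite_words [simp]: "finite (words m)"
  unfolding words_def by (rule finite_lists_length_eq) simp

lemma words_0: "words 0 = {[]}"
  by (auto simp: words_def)

lemma words_Suc: "words (Suc m) = (\<lambda>(i, ws). i # ws) ` ({1..n} \<times> words m)"
  by (auto simp: words_def length_Suc_conv image_iff)

lemma cls_cong: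
  "cls x = cls x' \<Longrightarrow> cls y = cls y' \<Longrightarrow> cls (x + y) = cls (x' + y')"
  "cls x = cls x' \<Longrightarrow> cls y = cls y' \<Longrightarrow> cls (x * y) = cls (x' * y')"
  by (simp_all flip: cls_add cls_mult)

lemma cls_linear_relation:
  "cls (monomial [x + y]) = cls (monomial [x] + monomial [y])"
  "cls (monomial [scale c x]) = cls (Poly_Mapping.single 0 c * monomial [x])"
proof -
  have "linearity_rels scale \<subseteq> tensor_ideal scale"
    unfolding tensor_ideal_def by (rule ring.genideal_self[OF ring_free_alg]) simp
  then show "cls (monomial [x + y]) = cls (monomial [x] + monomial [y])"
    "cls (monomial [scale c x]) = cls (Poly_Mapping.single 0 c * monomial [x])"
    by (auto simp: cls_eq_iff_diff linearity_rels_def diff_diff_eq[symmetric])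
qed

lemma cls_letter: "cls (monomial [x]) = cls (\<Sum>i\<in>{1..n}. Poly_Mapping.single 0 (coord i x) * monomial [e i])"
proof -
  have zero: "cls (monomial [0]) = cls 0"
    using cls_linear_relation(2)[of 0 0] by simp
  have "cls (monomial [\<Sum>i\<in>A. scale (c i) (e i)])
      = cls (\<Sum>i\<in>A. Poly_Mapping.single 0 (c i) * monomial [e i])" if "finite A" for A c
    using that
  proof (induction A rule: finite_induct)
    case empty
    then show ?case by (simp add: zero)
  next
    case (insert i A)
    then show ?case
      using cls_cong(1)[OF cls_linear_relation(2)[of "c i" "e i"] insert.IH]
      by (simp add: cls_linear_relation(1))
  qed
  from this[of "{1..n}" "\<lambda>i. coord i x"] show ?thesis using coord_expansion[of x] by simp
qed

lemma cls_monomial: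
  "cls (monomial xs)
     = cls (\<Sum>ws\<in>words (length xs). Poly_Mapping.single 0 (word_coord ws xs) * monomial (map e ws))"
proof (induction xs)
  case Nil
  then show ?case by (simp add: words_0)
next
  case (Cons x xs)
  have "cls (monomial (x # xs)) = cls (monomial [x] * monomial xs)"
    by (simp only: monomial_Cons[of x xs])
  also have "\<dots> = cls ((\<Sum>i\<in>{1..n}. Poly_Mapping.single 0 (coord i x) * monomial [e i]) *
      (\<Sum>ws\<in>words (length xs). Poly_Mapping.single 0 (word_coord ws xs) * monomial (map e ws)))"
    by (rule cls_cong(2)[OF cls_letter Cons.IH])
  also have "(\<Sum>i\<in>{1..n}. Poly_Mapping.single 0 (coord i x) * monomial [e i]) *
      (\<Sum>ws\<in>words (length xs). Poly_Mapping.single 0 (word_coord ws xs) * monomial (map e ws))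
      = (\<Sum>(i, ws)\<in>{1..n} \<times> words (length xs).
          Poly_Mapping.single 0 (word_coord (i # ws) (x # xs)) * monomial (map e (i # ws)))"
    unfolding sum_product sum.cartesian_product
  proof (rule sum.cong[OF refl], clarify)
    fix i ws
    have "(Poly_Mapping.single 0 (coord i x) * monomial [e i]) *
        (Poly_Mapping.single 0 (word_coord ws xs) * monomial (map e ws))
        = Poly_Mapping.single 0 (coord i x) * (monomial [e i] * Poly_Mapping.single 0 (word_coord ws xs))
          * monomial (map e ws)"
      by (simp only: mult.assoc)
    then show "(Poly_Mapping.single 0 (coord i x) * monomial [e i]) *
        (Poly_Mapping.single 0 (word_coord ws xs) * monomial (map e ws))
        = Poly_Mapping.single 0 (word_coord (i # ws) (x # xs)) * monomial (map e (i # ws))"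
      by (simp add: monomial_def mult_single)
  qed
  also have "\<dots> = (\<Sum>ws\<in>words (length (x # xs)).
      Poly_Mapping.single 0 (word_coord ws (x # xs)) * monomial (map e ws))"
    by (simp add: words_Suc sum.reindex inj_on_def case_prod_unfold del: word_coord_Cons)
  finally show ?case .
qed

text \<open>
  The degrees occurring in \<open>z\<close> are bounded, but not uniformly; allowing every large bound \<open>M\<close> makes it
  possible to add two expansions.
\<close>

lemma cls_expansion:
  "\<exists>M0. \<forall>M\<ge>M0. cls z = cls (\<Sum>m<M. \<Sum>ws\<in>words m. Poly_Mapping.single 0 (free_coord ws z) * monomial (map e ws))"
proof (induction z rule: poly_mapping_monomial_induct)
  case zero
  then show ?case by simp
next
  case (single w c)
  let ?xs = "letters w"
  have "cls (Poly_Mapping.single w c) = cls (\<Sum>m<M. \<Sum>ws\<in>words m.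
      Poly_Mapping.single 0 (free_coord ws (Poly_Mapping.single w c)) * monomial (map e ws))"
    if "M \<ge> Suc (length ?xs)" for M
  proof -
    have "(\<Sum>m<M. \<Sum>ws\<in>words m.
        Poly_Mapping.single 0 (free_coord ws (Poly_Mapping.single w c)) * monomial (map e ws))
      = (\<Sum>m\<in>{length ?xs}. \<Sum>ws\<in>words m.
        Poly_Mapping.single 0 (free_coord ws (Poly_Mapping.single w c)) * monomial (map e ws))"
      by (rule sum.mono_neutral_right)
        (use that in \<open>auto simp: words_def word_coord_length intro!: sum.neutral\<close>)
    also have "\<dots> = Poly_Mapping.single 0 c *
      (\<Sum>ws\<in>words (length ?xs). Poly_Mapping.single 0 (word_coord ws ?xs) * monomial (map e ws))"
      by (simp add: sum_distrib_left mult_single flip: mult.assoc)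
    finally show ?thesis
      using cls_cong(2)[OF refl cls_monomial[of ?xs], of "Poly_Mapping.single 0 c"]
      by (simp add: single_word[of w c])
  qed
  then show ?case by blast
next
  case (add x y)
  then obtain M1 M2 where M:
    "\<And>M. M \<ge> M1 \<Longrightarrow> cls x = cls (\<Sum>m<M. \<Sum>ws\<in>words m. Poly_Mapping.single 0 (free_coord ws x) * monomial (map e ws))"
    "\<And>M. M \<ge> M2 \<Longrightarrow> cls y = cls (\<Sum>m<M. \<Sum>ws\<in>words m. Poly_Mapping.single 0 (free_coord ws y) * monomial (map e ws))"
    by blast
  have "cls (x + y) = cls (\<Sum>m<M. \<Sum>ws\<in>words m. Poly_Mapping.single 0 (free_coord ws (x + y)) * monomial (map e ws))"
    if "M \<ge> max M1 M2" for M
    using cls_cong(1)[OF M(1)[of M] M(2)[of M]] that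
    by (simp add: single_add distrib_right sum.distrib)
  then show ?case by blast
qed

text \<open>
  Coordinates separate the points of the tensor algebra: they are well defined on classes, and a
  class can be recovered from them.
\<close>

lemma cls_eq_iff: "cls x = cls y \<longleftrightarrow> (\<forall>ws. free_coord ws x = free_coord ws y)"
proof
  assume "cls x = cls y"
  then have "x - y \<in> tensor_ideal scale" by (simp add: cls_eq_iff_diff)
  then show "\<forall>ws. free_coord ws x = free_coord ws y"
    using tensor_ideal_coord[of "x - y"] by simp
next
  assume eq: "\<forall>ws. free_coord ws x = free_coord ws y"
  obtain M1 where M1:
    "\<And>M. M \<ge> M1 \<Longrightarrow> cls x = cls (\<Sum>m<M. \<Sum>ws\<in>words m. Poly_Mapping.single 0 (free_coord ws x) * monomial (map e ws))"
    using cls_expansion[of x] by blast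
  obtain M2 where M2:
    "\<And>M. M \<ge> M2 \<Longrightarrow> cls y = cls (\<Sum>m<M. \<Sum>ws\<in>words m. Poly_Mapping.single 0 (free_coord ws y) * monomial (map e ws))"
    using cls_expansion[of y] by blast
  show "cls x = cls y"
    unfolding M1[of "max M1 M2", simplified] M2[of "max M1 M2", simplified] using eq by simp
qed

definition coeff :: "nat list \<Rightarrow> ('v word \<Rightarrow>\<^sub>0 'k) set \<Rightarrow> 'k" where
  "coeff ws t = free_coord ws (SOME z. t = cls z)"

lemma coeff_cls: "coeff ws (cls z) = free_coord ws z"
  unfolding coeff_def by (rule someI2[of _ z]) (auto simp: cls_eq_iff)

lemma cls_carrier [simp]: "cls z \<in> carrier T"
  by (simp add: carrier_T)

lemma T_eqI:
  assumes "s \<in> carrier T" "t \<in> carrier T" "\<And>ws. coeff ws s = coeff ws t"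
  shows "s = t"
proof -
  obtain x y where "s = cls x" "t = cls y" using assms by (auto simp: carrier_T)
  with assms show ?thesis by (simp add: coeff_cls cls_eq_iff)
qed

lemma smult_T_closed [simp]: "t \<in> carrier T \<Longrightarrow> c \<odot>\<^bsub>T\<^esub> t \<in> carrier T"
  by (auto simp: carrier_T cls_smult)

lemma coeff_zero [simp]: "coeff ws \<zero>\<^bsub>T\<^esub> = 0"
  by (simp add: zero_T coeff_cls)

lemma coeff_add [simp]:
  "\<lbrakk>s \<in> carrier T; t \<in> carrier T\<rbrakk> \<Longrightarrow> coeff ws (s \<oplus>\<^bsub>T\<^esub> t) = coeff ws s + coeff ws t"
  by (auto simp: carrier_T cls_add coeff_cls)

lemma coeff_a_inv [simp]: "t \<in> carrier T \<Longrightarrow> coeff ws (\<ominus>\<^bsub>T\<^esub> t) = - coeff ws t"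
  using coeff_add[of "\<ominus>\<^bsub>T\<^esub> t" t ws] by (simp add: T.l_neg eq_neg_iff_add_eq_0)

lemma coeff_minus [simp]:
  "\<lbrakk>s \<in> carrier T; t \<in> carrier T\<rbrakk> \<Longrightarrow> coeff ws (s \<ominus>\<^bsub>T\<^esub> t) = coeff ws s - coeff ws t"
  by (simp add: a_minus_def)

lemma coeff_smult [simp]: "t \<in> carrier T \<Longrightarrow> coeff ws (c \<odot>\<^bsub>T\<^esub> t) = c * coeff ws t"
  by (auto simp: carrier_T cls_smult coeff_cls)

lemma coeff_mult:
  "\<lbrakk>s \<in> carrier T; t \<in> carrier T\<rbrakk> \<Longrightarrow>
     coeff ws (s \<otimes>\<^bsub>T\<^esub> t) = (\<Sum>k\<le>length ws. coeff (take k ws) s * coeff (drop k ws) t)"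
  by (auto simp: carrier_T cls_mult coeff_cls free_coord_mult)

lemma coeff_finsum:
  "\<lbrakk>finite A; h \<in> A \<rightarrow> carrier T\<rbrakk> \<Longrightarrow> coeff ws (finsum T h A) = (\<Sum>i\<in>A. coeff ws (h i))"
  by (induction A rule: finite_induct) (auto simp: T.finsum_insert T.finsum_closed Pi_iff)

lemma coeff_sign:
  assumes "t \<in> carrier T"
  shows "[sign \<sigma>] \<cdot>\<^bsub>T\<^esub> t \<in> carrier T" "coeff ws ([sign \<sigma>] \<cdot>\<^bsub>T\<^esub> t) = of_int (sign \<sigma>) * coeff ws t"
proof -
  have "[(1::int)] \<cdot>\<^bsub>T\<^esub> t = t" "[(-1::int)] \<cdot>\<^bsub>T\<^esub> t = \<ominus>\<^bsub>T\<^esub> t"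
    using T.add.int_pow_1[OF assms] T.add.int_pow_neg[OF assms, of 1] assms
    by (simp_all add: a_inv_def)
  then show "[sign \<sigma>] \<cdot>\<^bsub>T\<^esub> t \<in> carrier T" "coeff ws ([sign \<sigma>] \<cdot>\<^bsub>T\<^esub> t) = of_int (sign \<sigma>) * coeff ws t"
    using assms by (simp_all add: sign_def)
qed

lemma tensor_carrier [simp]: "tensor scale xs \<in> carrier T"
  by (simp add: tensor_def)

lemma coeff_tensor [simp]: "coeff ws (tensor scale xs) = word_coord ws xs"
  by (simp add: tensor_def coeff_cls)

lemma coeff_outside: "t \<in> carrier T \<Longrightarrow> \<not> set ws \<subseteq> {1..n} \<Longrightarrow> coeff ws t = 0"
proof -
  assume "t \<in> carrier T" "\<not> set ws \<subseteq> {1..n}"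
  then obtain z where "t = cls z" by (auto simp: carrier_T)
  with \<open>\<not> set ws \<subseteq> {1..n}\<close> show ?thesis
    by (simp add: coeff_cls free_coord_def extend_linearly_def word_coord_outside)
qed

lemma tensor_append: "tensor scale (xs @ ys) = tensor scale xs \<otimes>\<^bsub>T\<^esub> tensor scale ys"
  by (simp add: tensor_def cls_mult monomial_append)

text \<open>The inverse of taking coordinates, in one degree.\<close>

definition of_coeffs :: "nat \<Rightarrow> (nat list \<Rightarrow> 'k) \<Rightarrow> ('v word \<Rightarrow>\<^sub>0 'k) set" where
  "of_coeffs m a = cls (\<Sum>ws\<in>words m. Poly_Mapping.single 0 (a ws) * monomial (map e ws))"

lemma of_coeffs_carrier [simp]: "of_coeffs m a \<in> carrier T"
  by (simp add: of_coeffs_def)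

lemma coeff_of_coeffs: "coeff ws (of_coeffs m a) = (if ws \<in> words m then a ws else 0)"
proof -
  have "coeff ws (of_coeffs m a) = (\<Sum>w\<in>words m. if w = ws then a w else 0)"
    unfolding of_coeffs_def coeff_cls free_coord_simps
    by (rule sum.cong) (auto simp: words_def word_coord_basis)
  then show ?thesis by simp
qed

text \<open>
  Homogeneity in terms of coordinates, independent of the choice of a homogeneous representative.
\<close>

lemma tensor_power_altdef:
  "tensor_power scale m = {t \<in> carrier T. \<forall>ws. length ws \<noteq> m \<longrightarrow> coeff ws t = 0}"
proof (intro equalityI subsetI)
  fix t assume "t \<in> tensor_power scale m"
  then obtain z where z: "t = cls z" "\<forall>w\<in>Poly_Mapping.keys z. length (letters w) = m"
    by (auto simp: tensor_power_def)
  have "coeff ws t = 0" if "length ws \<noteq> m" for ws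
    unfolding z coeff_cls free_coord_def extend_linearly_def
    by (rule sum.neutral) (use z that in \<open>auto intro!: word_coord_length\<close>)
  with z show "t \<in> {t \<in> carrier T. \<forall>ws. length ws \<noteq> m \<longrightarrow> coeff ws t = 0}" by simp
next
  fix t assume t: "t \<in> {t \<in> carrier T. \<forall>ws. length ws \<noteq> m \<longrightarrow> coeff ws t = 0}"
  let ?z = "\<Sum>ws\<in>words m. Poly_Mapping.single 0 (coeff ws t) * monomial (map e ws)"
  have "t = of_coeffs m (\<lambda>ws. coeff ws t)"
  proof (rule T_eqI)
    show "coeff ws t = coeff ws (of_coeffs m (\<lambda>ws. coeff ws t))" for ws
    proof (cases "set ws \<subseteq> {1..n}")
      case True
      with t show ?thesis by (simp add: coeff_of_coeffs words_def)
    next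
      case False
      then show ?thesis using coeff_outside[of t ws] t by (simp add: coeff_of_coeffs words_def)
    qed
  qed (use t in auto)
  moreover have "length (letters w) = m" if "w \<in> Poly_Mapping.keys ?z" for w
  proof -
    have "w \<in> (\<Union>ws\<in>words m. Poly_Mapping.keys (Poly_Mapping.single 0 (coeff ws t) * monomial (map e ws)))"
      by (rule subsetD[OF keys_sum that])
    then obtain ws where "ws \<in> words m" "w \<in> Poly_Mapping.keys (Poly_Mapping.single (Word (map e ws)) (coeff ws t))"
      by (auto simp: monomial_def mult_single)
    then show ?thesis by (simp add: words_def split: if_splits)
  qed
  ultimately show "t \<in> tensor_power scale m"
    unfolding tensor_power_def of_coeffs_def by blast
qed

lemma of_coeffs_tensor_power [simp]: "of_coeffs m a \<in> tensor_power scale m"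
  by (auto simp: tensor_power_altdef coeff_of_coeffs words_def)

lemma tensor_tensor_power [simp]: "length xs = m \<Longrightarrow> tensor scale xs \<in> tensor_power scale m"
  by (auto simp: tensor_power_altdef word_coord_length)

lemma tensor_power_carrier: "t \<in> tensor_power scale m \<Longrightarrow> t \<in> carrier T"
  by (simp add: tensor_power_altdef)

lemma tensor_power_closed:
  "s \<in> tensor_power scale m \<Longrightarrow> t \<in> tensor_power scale m \<Longrightarrow> s \<oplus>\<^bsub>T\<^esub> t \<in> tensor_power scale m"
  "t \<in> tensor_power scale m \<Longrightarrow> c \<odot>\<^bsub>T\<^esub> t \<in> tensor_power scale m"
  "\<zero>\<^bsub>T\<^esub> \<in> tensor_power scale m"
  by (auto simp: tensor_power_altdef)

lemma tensor_power_eqI: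
  assumes "s \<in> tensor_power scale m" "t \<in> tensor_power scale m"
    "\<And>ws. ws \<in> words m \<Longrightarrow> coeff ws s = coeff ws t"
  shows "s = t"
proof (rule T_eqI)
  show "coeff ws s = coeff ws t" for ws
  proof (cases "set ws \<subseteq> {1..n}")
    case True
    then show ?thesis
      using assms by (cases "length ws = m") (simp_all add: tensor_power_altdef words_def)
  next
    case False
    then show ?thesis using coeff_outside[of s ws] coeff_outside[of t ws] assms
      by (simp add: tensor_power_altdef)
  qed
qed (use assms tensor_power_carrier in auto)

lemma tensor_power_induct [consumes 1, case_names zero basis add]:
  assumes "t \<in> tensor_power scale m"
    and "P \<zero>\<^bsub>T\<^esub>" "\<And>c ws. ws \<in> words m \<Longrightarrow> P (c \<odot>\<^bsub>T\<^esub> tensor scale (map e ws))"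
    and add: "\<And>s t. \<lbrakk>s \<in> tensor_power scale m; t \<in> tensor_power scale m; P s; P t\<rbrakk> \<Longrightarrow> P (s \<oplus>\<^bsub>T\<^esub> t)"
  shows "P t"
proof -
  have "cls (\<Sum>ws\<in>A. Poly_Mapping.single 0 (coeff ws t) * monomial (map e ws)) \<in> tensor_power scale m \<and>
      P (cls (\<Sum>ws\<in>A. Poly_Mapping.single 0 (coeff ws t) * monomial (map e ws)))"
    if "A \<subseteq> words m" for A
    using finite_subset[OF that finite_words] that
  proof (induction A rule: finite_induct)
    case empty
    then show ?case using assms(2) tensor_power_closed(3)[of m] by (simp add: zero_T)
  next
    case (insert w A)
    let ?s = "coeff w t \<odot>\<^bsub>T\<^esub> tensor scale (map e w)"
    have "?s = cls (Poly_Mapping.single 0 (coeff w t) * monomial (map e w))"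
      by (simp add: tensor_def cls_smult)
    moreover have "?s \<in> tensor_power scale m" "P ?s"
      using insert.prems assms(3) by (auto intro!: tensor_power_closed simp: words_def)
    ultimately show ?case
      using insert add tensor_power_closed(1) by (simp add: cls_add[symmetric])
  qed
  from this[of "words m"] have "P (of_coeffs m (\<lambda>ws. coeff ws t))" by (simp add: of_coeffs_def)
  moreover have "of_coeffs m (\<lambda>ws. coeff ws t) = t"
    by (rule tensor_power_eqI[of _ m]) (use assms(1) in \<open>auto simp: coeff_of_coeffs\<close>)
  ultimately show ?thesis by simp
qed

lemma coeff_mult_homogeneous:
  assumes "s \<in> tensor_power scale a" "t \<in> carrier T"
  shows "coeff ws (s \<otimes>\<^bsub>T\<^esub> t) = (if a \<le> length ws then coeff (take a ws) s * coeff (drop a ws) t else 0)"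
proof -
  have "coeff ws (s \<otimes>\<^bsub>T\<^esub> t) = (\<Sum>k\<le>length ws. if k = a then coeff (take a ws) s * coeff (drop a ws) t else 0)"
    unfolding coeff_mult[OF tensor_power_carrier[OF assms(1)] assms(2)]
    by (rule sum.cong) (use assms(1) in \<open>auto simp: tensor_power_altdef\<close>)
  then show ?thesis by simp
qed

lemma tensor_power_mult:
  assumes "s \<in> tensor_power scale a" "t \<in> tensor_power scale b"
  shows "s \<otimes>\<^bsub>T\<^esub> t \<in> tensor_power scale (a + b)"
proof -
  have "coeff ws (s \<otimes>\<^bsub>T\<^esub> t) = 0" if "length ws \<noteq> a + b" for ws
    using coeff_mult_homogeneous[OF assms(1) tensor_power_carrier[OF assms(2)], of ws] assms(2) that
    by (auto simp: tensor_power_altdef)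
  then show ?thesis using assms by (simp add: tensor_power_altdef)
qed

lemma tensor_power_0:
  assumes "t \<in> tensor_power scale 0"
  shows "t = coeff [] t \<odot>\<^bsub>T\<^esub> \<one>\<^bsub>T\<^esub>"
proof -
  have one: "\<one>\<^bsub>T\<^esub> = tensor scale []" by (simp add: one_T tensor_def monomial_Nil)
  show ?thesis
    by (rule tensor_power_eqI[of _ 0])
      (use assms tensor_power_closed in \<open>auto simp: one words_0\<close>)
qed

end

section \<open>Additive maps and generated subgroups\<close>

lemma additive_on_zero:
  assumes "abelian_group X" "abelian_group Y" "additive_on D X Y h" "\<zero>\<^bsub>X\<^esub> \<in> D"
  shows "h \<zero>\<^bsub>X\<^esub> = \<zero>\<^bsub>Y\<^esub>"
proof -
  interpret X: abelian_group X by (rule assms)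
  interpret Y: abelian_group Y by (rule assms)
  have "h \<zero>\<^bsub>X\<^esub> \<in> carrier Y" using assms(3,4) by (auto simp: additive_on_def)
  moreover have "h (\<zero>\<^bsub>X\<^esub> \<oplus>\<^bsub>X\<^esub> \<zero>\<^bsub>X\<^esub>) = h \<zero>\<^bsub>X\<^esub> \<oplus>\<^bsub>Y\<^esub> h \<zero>\<^bsub>X\<^esub>"
    using assms(3,4) unfolding additive_on_def by blast
  ultimately show ?thesis by simp
qed

lemma additive_on_finsum:
  assumes "abelian_group X" "abelian_group Y" "additive_on D X Y h" "D \<subseteq> carrier X" "\<zero>\<^bsub>X\<^esub> \<in> D"
    and add: "\<And>x y. x \<in> D \<Longrightarrow> y \<in> D \<Longrightarrow> x \<oplus>\<^bsub>X\<^esub> y \<in> D"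
    and "finite A" "g \<in> A \<rightarrow> D"
  shows "finsum X g A \<in> D \<and> h (finsum X g A) = finsum Y (\<lambda>i. h (g i)) A"
proof -
  interpret X: abelian_group X by (rule assms)
  interpret Y: abelian_group Y by (rule assms)
  have hD: "h x \<in> carrier Y" if "x \<in> D" for x using assms(3) that by (auto simp: additive_on_def)
  have hadd: "h (x \<oplus>\<^bsub>X\<^esub> y) = h x \<oplus>\<^bsub>Y\<^esub> h y" if "x \<in> D" "y \<in> D" for x y
    using assms(3) that by (simp add: additive_on_def)
  show ?thesis using assms(7,8)
  proof (induction A rule: finite_induct)
    case empty
    then show ?case using additive_on_zero[OF assms(1-3,5)] assms(5) by simp
  next
    case (insert a A)
    then have g: "g a \<in> D" "g \<in> A \<rightarrow> D" by auto
    have "finsum X g (insert a A) = g a \<oplus>\<^bsub>X\<^esub> finsum X g A"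
      using g insert.hyps assms(4) by (intro X.finsum_insert) auto
    moreover have "finsum Y (\<lambda>i. h (g i)) (insert a A) = h (g a) \<oplus>\<^bsub>Y\<^esub> finsum Y (\<lambda>i. h (g i)) A"
      using g insert.hyps hD by (intro Y.finsum_insert) auto
    ultimately show ?case using insert.IH[OF g(2)] g(1) add hadd by simp
  qed
qed

lemma (in abelian_group) generate_induct_add [consumes 2, case_names zero base minus add]:
  assumes "t \<in> generate (add_monoid G) S" "S \<subseteq> carrier G"
    and "P \<zero>" "\<And>s. s \<in> S \<Longrightarrow> P s" "\<And>s. s \<in> S \<Longrightarrow> P (\<ominus> s)"
    and "\<And>s t. \<lbrakk>s \<in> generate (add_monoid G) S; t \<in> generate (add_monoid G) S; P s; P t\<rbrakk> \<Longrightarrow> P (s \<oplus> t)"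
  shows "P t"
  using assms(1)
proof (induction t rule: generate.induct)
  case one
  then show ?case using assms(3) by simp
next
  case (inv s)
  then show ?case using assms(5)[of s] by (simp only: a_inv_def)
next
  case (eng s t)
  then show ?case using assms(6)[of s t] by simp
qed (use assms in auto)

lemma (in abelian_group) generate_add_closed:
  assumes "S \<subseteq> carrier G"
  shows "generate (add_monoid G) S \<subseteq> carrier G" "\<zero> \<in> generate (add_monoid G) S"
    "\<lbrakk>s \<in> generate (add_monoid G) S; t \<in> generate (add_monoid G) S\<rbrakk> \<Longrightarrow>
       s \<oplus> t \<in> generate (add_monoid G) S"
proof -
  show "generate (add_monoid G) S \<subseteq> carrier G"
    using add.generate_incl assms by auto
  show "\<zero> \<in> generate (add_monoid G) S" using generate.one[of "add_monoid G" S] by simp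
  show "\<lbrakk>s \<in> generate (add_monoid G) S; t \<in> generate (add_monoid G) S\<rbrakk> \<Longrightarrow>
       s \<oplus> t \<in> generate (add_monoid G) S"
    using generate.eng[of s "add_monoid G" S t] by simp
qed

lemma (in abelian_group) finsum_in_generate:
  assumes "S \<subseteq> carrier G" "finite A" "g \<in> A \<rightarrow> S"
  shows "finsum G g A \<in> generate (add_monoid G) S"
  using assms(2,3)
proof (induction A rule: finite_induct)
  case empty
  then show ?case using generate_add_closed[OF assms(1)] by simp
next
  case (insert a A)
  then have "finsum G g (insert a A) = g a \<oplus> finsum G g A"
    using assms(1) by (intro finsum_insert) auto
  then show ?case using insert generate_add_closed(3)[OF assms(1)] by (auto intro: generate.incl)
qed

context based_space
begin

section \<open>The antisymmetrizer\<close>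

lemma antisym_word_coord:
  assumes "length ws = length xs"
  shows "(\<Sum>\<sigma> | \<sigma> permutes {1..length xs}. of_int (sign \<sigma>) * word_coord ws (perm_list \<sigma> xs))
    = antisym (\<lambda>w. word_coord w xs) ws"
proof -
  have "(\<Sum>\<sigma> | \<sigma> permutes {1..length xs}. of_int (sign \<sigma>) * word_coord ws (perm_list \<sigma> xs))
      = (\<Sum>\<sigma> | \<sigma> permutes {1..length xs}.
          of_int (sign (inv_into UNIV \<sigma>)) * word_coord (perm_list (inv_into UNIV \<sigma>) ws) xs)"
    by (rule sum.cong)
      (use assms in \<open>auto simp: word_coord_perm_list sign_inv_permutes\<close>)
  also have "\<dots> = (\<Sum>\<sigma> | \<sigma> permutes {1..length xs}. of_int (sign \<sigma>) * word_coord (perm_list \<sigma> ws) xs)"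
    by (rule sum_permutations_inverse[symmetric])
  finally show ?thesis using assms by (simp add: antisym_def)
qed

lemma antisym_coeff_outside:
  assumes "t \<in> carrier T" "\<not> set ws \<subseteq> {1..n}"
  shows "antisym (\<lambda>w. coeff w t) ws = 0"
proof -
  have "antisym (\<lambda>w. coeff w t) ws = antisym (\<lambda>w. 0) ws"
    by (rule antisym_cong) (use assms coeff_outside in auto)
  then show ?thesis by (simp add: antisym_def)
qed

lemma linear_on_tensor_power_unique:
  assumes h: "linear_on (tensor_power scale m) T Y h" "linear_on (tensor_power scale m) T Y h'"
    and Y: "abelian_group Y"
    and eq: "\<And>ws. ws \<in> words m \<Longrightarrow> h (tensor scale (map e ws)) = h' (tensor scale (map e ws))"
    and t: "t \<in> tensor_power scale m"
  shows "h t = h' t"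
  using t
proof (induction t rule: tensor_power_induct)
  case zero
  have "additive_on (tensor_power scale m) T Y h" "additive_on (tensor_power scale m) T Y h'"
    using h by (auto simp: linear_on_def)
  then show ?case
    using additive_on_zero[OF T.abelian_group_axioms Y _ tensor_power_closed(3)] by metis
next
  case (basis c ws)
  have "tensor scale (map e ws) \<in> tensor_power scale m" using basis by (simp add: words_def)
  then show ?case using h eq[OF basis] by (simp add: linear_on_def)
next
  case (add s t)
  then show ?case using h by (simp add: linear_on_def additive_on_def)
qed

text \<open>
  The map prescribed on coordinates by antisymmetrization has the required values on all tensors
  \<open>x\<^sub>1 \<dots> x\<^sub>m\<close>, and it is the only one because the basis words span; hence the definite description in
  \<open>Ant\<close> is meaningful.
\<close>

lemma Ant_eq:
  "Ant scale m = restrict (\<lambda>t. of_coeffs m (antisym (\<lambda>w. coeff w t))) (tensor_power scale m)"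
  unfolding Ant_def
proof (rule the_equality, intro conjI allI impI)
  let ?h = "restrict (\<lambda>t. of_coeffs m (antisym (\<lambda>w. coeff w t))) (tensor_power scale m)"
  show lin: "linear_on (tensor_power scale m) T T ?h"
    unfolding linear_on_def additive_on_def
  proof (intro conjI ballI allI)
    show "?h \<in> tensor_power scale m \<rightarrow> carrier T" by auto
    fix s t assume st: "s \<in> tensor_power scale m" "t \<in> tensor_power scale m"
    show "?h (s \<oplus>\<^bsub>T\<^esub> t) = ?h s \<oplus>\<^bsub>T\<^esub> ?h t"
      by (rule T_eqI) (use st tensor_power_closed(1)[OF st] tensor_power_carrier in
        \<open>auto simp: coeff_of_coeffs antisym_add\<close>)
  next
    fix c t assume t: "t \<in> tensor_power scale m"
    show "?h (c \<odot>\<^bsub>T\<^esub> t) = c \<odot>\<^bsub>T\<^esub> ?h t"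
      by (rule T_eqI) (use t tensor_power_closed(2)[OF t] tensor_power_carrier in
        \<open>auto simp: coeff_of_coeffs antisym_scale\<close>)
  qed
  show val: "?h (tensor scale xs) =
      (\<Oplus>\<^bsub>T\<^esub>\<sigma>\<in>{\<sigma>. \<sigma> permutes {1..m}}. [sign \<sigma>] \<cdot>\<^bsub>T\<^esub> tensor scale (perm_list \<sigma> xs))"
    if len: "length xs = m" for xs
  proof (rule T_eqI)
    have fin: "finite {\<sigma>. \<sigma> permutes {1..m}}" by (simp add: finite_permutations)
    have cl: "(\<lambda>\<sigma>. [sign \<sigma>] \<cdot>\<^bsub>T\<^esub> tensor scale (perm_list \<sigma> xs)) \<in> {\<sigma>. \<sigma> permutes {1..m}} \<rightarrow> carrier T"
      by (auto intro: coeff_sign)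
    show "?h (tensor scale xs) \<in> carrier T" using len by simp
    show "(\<Oplus>\<^bsub>T\<^esub>\<sigma>\<in>{\<sigma>. \<sigma> permutes {1..m}}. [sign \<sigma>] \<cdot>\<^bsub>T\<^esub> tensor scale (perm_list \<sigma> xs)) \<in> carrier T"
      using cl by (rule T.finsum_closed)
    fix ws
    have "coeff ws (\<Oplus>\<^bsub>T\<^esub>\<sigma>\<in>{\<sigma>. \<sigma> permutes {1..m}}. [sign \<sigma>] \<cdot>\<^bsub>T\<^esub> tensor scale (perm_list \<sigma> xs))
        = (\<Sum>\<sigma> | \<sigma> permutes {1..length xs}. of_int (sign \<sigma>) * word_coord ws (perm_list \<sigma> xs))"
      unfolding coeff_finsum[OF fin cl] len by (simp add: coeff_sign)
    also have "\<dots> = (if length ws = m then antisym (\<lambda>w. word_coord w xs) ws else 0)"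
      using len antisym_word_coord[of ws xs] by (simp add: word_coord_length)
    also have "\<dots> = coeff ws (?h (tensor scale xs))"
      using len antisym_coeff_outside[of "tensor scale xs" ws]
      by (auto simp: coeff_of_coeffs words_def)
    finally show "coeff ws (?h (tensor scale xs)) =
      coeff ws (\<Oplus>\<^bsub>T\<^esub>\<sigma>\<in>{\<sigma>. \<sigma> permutes {1..m}}. [sign \<sigma>] \<cdot>\<^bsub>T\<^esub> tensor scale (perm_list \<sigma> xs))" ..
  qed
  show "?h \<in> extensional (tensor_power scale m)" by simp
  fix h
  assume h: "h \<in> extensional (tensor_power scale m) \<and> linear_on (tensor_power scale m) T T h \<and>
    (\<forall>xs. length xs = m \<longrightarrow> h (tensor scale xs) =
      (\<Oplus>\<^bsub>T\<^esub>\<sigma>\<in>{\<sigma>. \<sigma> permutes {1..m}}. [sign \<sigma>] \<cdot>\<^bsub>T\<^esub> tensor scale (perm_list \<sigma> xs)))"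
  have "h t = ?h t" if "t \<in> tensor_power scale m" for t
    by (rule linear_on_tensor_power_unique[OF _ lin T.abelian_group_axioms _ that])
      (use h val in \<open>auto simp: words_def\<close>)
  then show "h = ?h" using h by (intro extensionalityI[of _ "tensor_power scale m"]) auto
qed

lemma Ant_tensor_power [simp]: "t \<in> tensor_power scale m \<Longrightarrow> Ant scale m t \<in> tensor_power scale m"
  by (simp add: Ant_eq)

lemma coeff_Ant:
  assumes "t \<in> tensor_power scale m"
  shows "coeff ws (Ant scale m t) = (if length ws = m then antisym (\<lambda>w. coeff w t) ws else 0)"
  using assms antisym_coeff_outside[OF tensor_power_carrier[OF assms], of ws]
  by (auto simp: Ant_eq coeff_of_coeffs words_def)

lemma Ant_add:
  "s \<in> tensor_power scale m \<Longrightarrow> t \<in> tensor_power scale m \<Longrightarrow>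
    Ant scale m (s \<oplus>\<^bsub>T\<^esub> t) = Ant scale m s \<oplus>\<^bsub>T\<^esub> Ant scale m t"
  by (rule T_eqI)
    (simp_all add: tensor_power_closed tensor_power_carrier[of _ m] coeff_Ant antisym_add)

lemma Ant_smult:
  "t \<in> tensor_power scale m \<Longrightarrow> Ant scale m (c \<odot>\<^bsub>T\<^esub> t) = c \<odot>\<^bsub>T\<^esub> Ant scale m t"
  by (rule T_eqI)
    (simp_all add: tensor_power_closed tensor_power_carrier[of _ m] coeff_Ant antisym_scale)

definition alternating_tensors :: "nat \<Rightarrow> ('v word \<Rightarrow>\<^sub>0 'k) set set" where
  "alternating_tensors m = {t \<in> tensor_power scale m. alternating m (\<lambda>ws. coeff ws t)}"

abbreviation "Inc m \<equiv> increasing_lists m {1..n}"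

lemma Inc_words: "Inc m \<subseteq> words m"
  by (auto simp: increasing_lists_def words_def)

lemma finite_Inc [simp]: "finite (Inc m)"
  by (rule finite_increasing_lists) simp

lemma Inc_length: "is \<in> Inc m \<Longrightarrow> length is = m"
  by (simp add: increasing_lists_def)

definition ant_basis :: "nat list \<Rightarrow> ('v word \<Rightarrow>\<^sub>0 'k) set" where
  "ant_basis is = Ant scale (length is) (tensor scale (map e is))"

lemma coeff_ant_basis:
  assumes "set is \<subseteq> {1..n}"
  shows "coeff ws (ant_basis is) = (if length ws = length is then perm_sign ws is else 0)"
  using assms by (simp add: ant_basis_def coeff_Ant word_coord_basis perm_sign_def)

lemma Ant_alternating:
  assumes "t \<in> tensor_power scale m"
  shows "Ant scale m t \<in> alternating_tensors m"
proof -
  have "alternating m (\<lambda>ws. coeff ws (Ant scale m t))"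
    unfolding alternating_def
  proof (intro allI impI)
    fix us vs :: "nat list" and i j :: nat
    assume len: "Suc (Suc (length us + length vs)) = m"
    have "antisym (\<lambda>w. coeff w t) (us @ j # i # vs) = - antisym (\<lambda>w. coeff w t) (us @ i # j # vs)"
      "antisym (\<lambda>w. coeff w t) (us @ i # i # vs) = 0"
      by (rule alternatingD[OF alternating_antisym len])+
    then
    show "coeff (us @ j # i # vs) (Ant scale m t) = - coeff (us @ i # j # vs) (Ant scale m t) \<and>
        coeff (us @ i # i # vs) (Ant scale m t) = 0"
      using assms len by (simp add: coeff_Ant)
  qed
  with assms show ?thesis by (simp add: alternating_tensors_def)
qed

lemma ant_basis_alternating: "is \<in> Inc m \<Longrightarrow> ant_basis is \<in> alternating_tensors m"
  using Ant_alternating[of "tensor scale (map e is)" m]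
  by (simp add: ant_basis_def increasing_lists_def)

lemma alternating_tensors_expansion:
  assumes "t \<in> alternating_tensors m" "ws \<in> words m"
  shows "coeff ws t = (\<Sum>is\<in>Inc m. coeff is t * perm_sign ws is)"
  by (rule alternating_expansion) (use assms in \<open>auto simp: alternating_tensors_def words_def\<close>)

definition increasing_part :: "nat \<Rightarrow> (nat list \<Rightarrow> 'k) \<Rightarrow> ('v word \<Rightarrow>\<^sub>0 'k) set" where
  "increasing_part m a = of_coeffs m (\<lambda>ws. if ws \<in> Inc m then a ws else 0)"

lemma increasing_part_tensor_power [simp]: "increasing_part m a \<in> tensor_power scale m"
  by (simp add: increasing_part_def)

lemma coeff_increasing_part: "coeff ws (increasing_part m a) = (if ws \<in> Inc m then a ws else 0)"
  using Inc_words by (auto simp: increasing_part_def coeff_of_coeffs)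

text \<open>
  An alternating tensor is the antisymmetrization of its part supported on increasing words. This
  avoids dividing by a factorial.
\<close>

lemma Ant_increasing_part:
  assumes "t \<in> alternating_tensors m"
  shows "Ant scale m (increasing_part m (\<lambda>ws. coeff ws t)) = t"
proof (rule tensor_power_eqI)
  show "t \<in> tensor_power scale m" using assms by (simp add: alternating_tensors_def)
  fix ws assume ws: "ws \<in> words m"
  have "coeff ws (Ant scale m (increasing_part m (\<lambda>ws. coeff ws t)))
      = antisym (\<lambda>w. if w \<in> Inc m then coeff w t else 0) ws"
    using ws by (simp add: coeff_Ant coeff_increasing_part words_def)
  also have "\<dots> = antisym (\<lambda>w. \<Sum>is\<in>Inc m. coeff is t * of_bool (w = is)) ws"
    by (rule antisym_cong) (simp add: of_bool_def if_distrib cong: if_cong)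
  also have "\<dots> = (\<Sum>is\<in>Inc m. coeff is t * perm_sign ws is)"
    by (simp only: antisym_sum antisym_scale perm_sign_def)
  also have "\<dots> = coeff ws t" by (rule alternating_tensors_expansion[OF assms ws, symmetric])
  finally show "coeff ws (Ant scale m (increasing_part m (\<lambda>ws. coeff ws t))) = coeff ws t" .
qed simp

lemma Ant_image: "Ant scale m ` tensor_power scale m = alternating_tensors m"
proof (intro equalityI subsetI)
  fix t assume "t \<in> alternating_tensors m"
  then show "t \<in> Ant scale m ` tensor_power scale m"
    using Ant_increasing_part[of t m] increasing_part_tensor_power by (metis imageI)
qed (auto intro: Ant_alternating)


section \<open>The exterior algebra and the isomorphism with antisymmetric tensors\<close>

abbreviation ecls :: "('v word \<Rightarrow>\<^sub>0 'k) set \<Rightarrow> ('v word \<Rightarrow>\<^sub>0 'k) set set" where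
  "ecls t \<equiv> ext_ideal scale +>\<^bsub>T\<^esub> t"

lemma smult_one_mult: "t \<in> carrier T \<Longrightarrow> (c \<odot>\<^bsub>T\<^esub> \<one>\<^bsub>T\<^esub>) \<otimes>\<^bsub>T\<^esub> t = c \<odot>\<^bsub>T\<^esub> t"
  by (auto simp: carrier_T one_T cls_smult cls_mult)

lemma mult_smult_one: "t \<in> carrier T \<Longrightarrow> t \<otimes>\<^bsub>T\<^esub> (c \<odot>\<^bsub>T\<^esub> \<one>\<^bsub>T\<^esub>) = c \<odot>\<^bsub>T\<^esub> t"
  by (auto simp: carrier_T one_T cls_smult cls_mult single_zero_commute)

lemma ideal_ext_ideal: "ideal (ext_ideal scale) T"
  unfolding ext_ideal_def by (rule T.genideal_ideal) auto

interpretation E: ideal "ext_ideal scale" T by (rule ideal_ext_ideal)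

lemma ecls_add: "s \<in> carrier T \<Longrightarrow> t \<in> carrier T \<Longrightarrow> ecls s \<oplus>\<^bsub>ext_alg scale\<^esub> ecls t = ecls (s \<oplus>\<^bsub>T\<^esub> t)"
  unfolding ext_alg_def by (rule quot_alg_add[OF ideal_ext_ideal])

lemma ecls_smult: "t \<in> carrier T \<Longrightarrow> c \<odot>\<^bsub>ext_alg scale\<^esub> ecls t = ecls (c \<odot>\<^bsub>T\<^esub> t)"
  unfolding ext_alg_def by (simp add: quot_alg_smult[OF ideal_ext_ideal] smult_one_mult)

lemma ecls_eq_iff: "s \<in> carrier T \<Longrightarrow> t \<in> carrier T \<Longrightarrow> ecls s = ecls t \<longleftrightarrow> s \<ominus>\<^bsub>T\<^esub> t \<in> ext_ideal scale"
  by (rule coset_eq_iff[OF ideal_ext_ideal])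

text \<open>
  The coordinates of \<open>u x x v\<close> are symmetric in the two positions occupied by \<open>x\<close>.
\<close>

lemma antisym_square:
  "antisym (\<lambda>w. free_coord w (y * monomial [x, x] * z)) ws = 0"
proof (induction y rule: poly_mapping_monomial_induct)
  case (single u c)
  show ?case
  proof (induction z rule: poly_mapping_monomial_induct)
    case (single v d)
    let ?xs = "letters u @ x # x # letters v"
    have letters: "letters (u + Word [x, x] + v) = ?xs" by (simp add: plus_word_def)
    have "antisym (\<lambda>w. word_coord w ?xs) ws = 0"
    proof (cases "length ws = length ?xs")
      case True
      show ?thesis
      proof (rule antisym_symmetric_eq_0)
        fix us vs :: "nat list" and i j :: nat
        assume "length us = length (letters u)"
        then show "word_coord (us @ j # i # vs) ?xs = word_coord (us @ i # j # vs) ?xs"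
          by (simp add: word_coord_append_same)
      qed (use True in simp)
    next
      case False
      then have "antisym (\<lambda>w. word_coord w ?xs) ws = antisym (\<lambda>w. 0) ws"
        by (intro antisym_cong word_coord_length) simp
      then show ?thesis by (simp add: antisym_def)
    qed
    then show ?case
      using antisym_scale[of "c * d" "\<lambda>w. word_coord w ?xs" ws]
      by (simp add: mult_single monomial_def letters)
  qed (simp_all add: distrib_left antisym_add, simp_all add: antisym_def)
qed (simp_all add: distrib_right antisym_add, simp_all add: antisym_def)

text \<open>
  The elements all of whose two-sided multiples have vanishing antisymmetrized coordinates form an
  ideal; quantifying over the multiples makes the closure under multiplication automatic.
\<close>

lemma ext_ideal_antisym:
  assumes "t \<in> ext_ideal scale"
  shows "antisym (\<lambda>w. coeff w t) ws = 0"
proof -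
  let ?K = "{t \<in> carrier T. \<forall>u\<in>carrier T. \<forall>v\<in>carrier T. \<forall>ws.
    antisym (\<lambda>w. coeff w (u \<otimes>\<^bsub>T\<^esub> t \<otimes>\<^bsub>T\<^esub> v)) ws = 0}"
  have "ideal ?K T"
  proof (rule idealI[OF ring_T])
    show "subgroup ?K (add_monoid T)"
    proof (rule subgroup.intro)
      fix x y assume "x \<in> ?K" "y \<in> ?K"
      then show "x \<otimes>\<^bsub>add_monoid T\<^esub> y \<in> ?K"
        by (auto simp: T.l_distr T.r_distr antisym_add)
    next
      fix x assume x: "x \<in> ?K"
      have "antisym (\<lambda>w. - coeff w (u \<otimes>\<^bsub>T\<^esub> x \<otimes>\<^bsub>T\<^esub> v)) ws = 0"
        if "u \<in> carrier T" "v \<in> carrier T" for u v ws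
        using x that antisym_scale[of "-1" "\<lambda>w. coeff w (u \<otimes>\<^bsub>T\<^esub> x \<otimes>\<^bsub>T\<^esub> v)" ws] by simp
      then show "inv\<^bsub>add_monoid T\<^esub> x \<in> ?K"
        unfolding a_inv_def[symmetric] using x by (auto simp: T.l_minus T.r_minus)
    qed (auto simp: antisym_def)
    fix a x assume a: "a \<in> ?K" and x: "x \<in> carrier T"
    have "u \<otimes>\<^bsub>T\<^esub> (x \<otimes>\<^bsub>T\<^esub> a) \<otimes>\<^bsub>T\<^esub> v = (u \<otimes>\<^bsub>T\<^esub> x) \<otimes>\<^bsub>T\<^esub> a \<otimes>\<^bsub>T\<^esub> v"
      "u \<otimes>\<^bsub>T\<^esub> (a \<otimes>\<^bsub>T\<^esub> x) \<otimes>\<^bsub>T\<^esub> v = u \<otimes>\<^bsub>T\<^esub> a \<otimes>\<^bsub>T\<^esub> (x \<otimes>\<^bsub>T\<^esub> v)"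
      if "u \<in> carrier T" "v \<in> carrier T" for u v
      using a x that by (simp_all add: T.m_assoc)
    then show "x \<otimes>\<^bsub>T\<^esub> a \<in> ?K" "a \<otimes>\<^bsub>T\<^esub> x \<in> ?K" using a x by simp_all
  qed
  moreover have "{tensor scale [x, x] | x. True} \<subseteq> ?K"
    by (auto simp: carrier_T tensor_def cls_mult coeff_cls antisym_square)
  ultimately have "ext_ideal scale \<subseteq> ?K"
    unfolding ext_ideal_def by (rule T.genideal_minimal)
  with assms have t: "t \<in> ?K" by blast
  then have "antisym (\<lambda>w. coeff w (\<one>\<^bsub>T\<^esub> \<otimes>\<^bsub>T\<^esub> t \<otimes>\<^bsub>T\<^esub> \<one>\<^bsub>T\<^esub>)) ws = 0" by blast
  with t show ?thesis by simp
qed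

lemma Ant_ext_ideal_cong:
  assumes "s \<in> tensor_power scale m" "t \<in> tensor_power scale m" "ecls s = ecls t"
  shows "Ant scale m s = Ant scale m t"
proof (rule tensor_power_eqI)
  note carr = assms(1,2)[THEN tensor_power_carrier]
  fix ws assume ws: "ws \<in> words m"
  have "s \<ominus>\<^bsub>T\<^esub> t \<in> ext_ideal scale" using assms(3) carr by (simp add: ecls_eq_iff)
  from ext_ideal_antisym[OF this, of ws]
  have "antisym (\<lambda>w. coeff w s + (-1) * coeff w t) ws = 0" using carr by simp
  then have "antisym (\<lambda>w. coeff w s) ws = antisym (\<lambda>w. coeff w t) ws"
    unfolding antisym_add antisym_scale by simp
  then show "coeff ws (Ant scale m s) = coeff ws (Ant scale m t)"
    using assms(1,2) ws by (simp add: coeff_Ant words_def)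
qed (use assms in auto)

lemma square_in_ext_ideal: "tensor scale (us @ x # x # vs) \<in> ext_ideal scale"
proof -
  have "tensor scale [x, x] \<in> ext_ideal scale"
    unfolding ext_ideal_def by (rule subsetD[OF T.genideal_self]) auto
  then have "tensor scale us \<otimes>\<^bsub>T\<^esub> (tensor scale [x, x] \<otimes>\<^bsub>T\<^esub> tensor scale vs) \<in> ext_ideal scale"
    by (simp add: E.I_l_closed E.I_r_closed)
  then show ?thesis by (simp flip: tensor_append)
qed

text \<open>
  Polarization of the squares: expand \<open>u (x + y) (x + y) v\<close>.
\<close>

lemma swap_in_ext_ideal:
  "tensor scale (us @ x # y # vs) \<oplus>\<^bsub>T\<^esub> tensor scale (us @ y # x # vs) \<in> ext_ideal scale"
proof -
  have wc: "word_coord ws (us @ (x + y) # (x + y) # vs) = word_coord ws (us @ x # x # vs)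
      + word_coord ws (us @ y # y # vs) + (word_coord ws (us @ x # y # vs) + word_coord ws (us @ y # x # vs))"
    for ws
  proof -
    have "word_coord w ((x + y) # (x + y) # vs) = word_coord w (x # x # vs) + word_coord w (y # y # vs)
      + (word_coord w (x # y # vs) + word_coord w (y # x # vs))" for w
    proof (cases "length w = Suc (Suc (length vs))")
      case True
      then obtain i j w' where "w = i # j # w'" by (auto simp: length_Suc_conv)
      then show ?thesis by (simp add: coord_add algebra_simps)
    qed (simp add: word_coord_length)
    then show ?thesis
      by (simp only: word_coord_append distrib_left sum.distrib)
  qed
  have "tensor scale (us @ x # y # vs) \<oplus>\<^bsub>T\<^esub> tensor scale (us @ y # x # vs)
      = tensor scale (us @ (x + y) # (x + y) # vs) \<ominus>\<^bsub>T\<^esub> tensor scale (us @ x # x # vs)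
        \<ominus>\<^bsub>T\<^esub> tensor scale (us @ y # y # vs)"
    by (rule T_eqI) (simp_all add: wc)
  also have "\<dots> \<in> ext_ideal scale"
    unfolding a_minus_def by (intro E.a_closed E.a_inv_closed square_in_ext_ideal)
  finally show ?thesis .
qed

lemma basis_word_normal_form:
  assumes "ws \<in> words m"
  shows "tensor scale (map e ws) \<ominus>\<^bsub>T\<^esub> increasing_part m (\<lambda>is. perm_sign ws is) \<in> ext_ideal scale"
proof -
  have len: "length ws = m" and set: "set ws \<subseteq> {1..n}" using assms by (auto simp: words_def)
  note carr = tensor_power_carrier[OF increasing_part_tensor_power]
  show ?thesis using len set
  proof (induction ws rule: bubble_sort_induct)
    case (increasing ws)
    have "tensor scale (map e ws) \<ominus>\<^bsub>T\<^esub> increasing_part m (\<lambda>is. perm_sign ws is) = \<zero>\<^bsub>T\<^esub>"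
      by (rule T_eqI) (use increasing in \<open>auto simp: carr coeff_increasing_part word_coord_basis
        perm_sign_increasing increasing_lists_def\<close>)
    then show ?case by (metis E.zero_closed)
  next
    case (repeated us i vs)
    have "increasing_part m (\<lambda>is. perm_sign (us @ i # i # vs) is) = \<zero>\<^bsub>T\<^esub>"
      by (rule T_eqI)
        (auto simp: carr coeff_increasing_part alternatingD(2)[OF alternating_perm_sign repeated(1)])
    then show ?case using square_in_ext_ideal[of "map e us" "e i" "map e vs"] by (simp add: a_minus_def)
  next
    case (swap us i j vs)
    let ?s = "tensor scale (map e (us @ i # j # vs))" and ?t = "tensor scale (map e (us @ j # i # vs))"
    let ?p = "increasing_part m (\<lambda>is. perm_sign (us @ i # j # vs) is)"
    have 1: "?s \<oplus>\<^bsub>T\<^esub> ?t \<in> ext_ideal scale"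
      using swap_in_ext_ideal[of "map e us" "e i" "e j" "map e vs"] by simp
    have 2: "?s \<ominus>\<^bsub>T\<^esub> ?p \<in> ext_ideal scale" by (rule swap(3))
    have "?t \<ominus>\<^bsub>T\<^esub> increasing_part m (\<lambda>is. perm_sign (us @ j # i # vs) is) = (?s \<oplus>\<^bsub>T\<^esub> ?t) \<ominus>\<^bsub>T\<^esub> (?s \<ominus>\<^bsub>T\<^esub> ?p)"
      by (rule T_eqI) (simp_all add: carr coeff_increasing_part
        alternatingD(1)[OF alternating_perm_sign swap(1), of j i])
    also have "\<dots> \<in> ext_ideal scale"
      unfolding a_minus_def[of T "?s \<oplus>\<^bsub>T\<^esub> ?t"]
      by (rule E.a_closed[OF 1 E.a_inv_closed[OF 2]])
    finally show ?case .
  qed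
qed

text \<open>
  Sorting a basis word by adjacent exchanges changes it by its sign modulo the exterior ideal, and both
  sides are linear.  In particular, \<open>t\<close> lies in the exterior ideal as soon as \<open>Ant\<close> kills it.
\<close>

lemma tensor_normal_form:
  assumes "t \<in> tensor_power scale m"
  shows "t \<ominus>\<^bsub>T\<^esub> increasing_part m (antisym (\<lambda>w. coeff w t)) \<in> ext_ideal scale"
  using assms
proof (induction t rule: tensor_power_induct)
  case zero
  have "\<zero>\<^bsub>T\<^esub> \<ominus>\<^bsub>T\<^esub> increasing_part m (antisym (\<lambda>w. coeff w \<zero>\<^bsub>T\<^esub>)) = \<zero>\<^bsub>T\<^esub>"
    by (rule T_eqI) (auto simp: tensor_power_carrier[of _ m] coeff_increasing_part antisym_def)
  then show ?case by (metis E.zero_closed)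
next
  case (basis c ws)
  let ?t = "tensor scale (map e ws)" and ?p = "increasing_part m (\<lambda>is. perm_sign ws is)"
  note carr = tensor_power_carrier[OF increasing_part_tensor_power, of m]
  have ps: "antisym (\<lambda>w. word_coord w (map e ws)) is = perm_sign ws is" if "is \<in> Inc m" for "is"
    using basis that perm_sign_commute[where 'k = 'k, of ws "is"]
    by (simp add: words_def increasing_lists_def word_coord_basis perm_sign_def)
  have "c \<odot>\<^bsub>T\<^esub> ?t \<ominus>\<^bsub>T\<^esub> increasing_part m (antisym (\<lambda>w. coeff w (c \<odot>\<^bsub>T\<^esub> ?t)))
      = (c \<odot>\<^bsub>T\<^esub> \<one>\<^bsub>T\<^esub>) \<otimes>\<^bsub>T\<^esub> (?t \<ominus>\<^bsub>T\<^esub> ?p)"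
    by (rule T_eqI)
      (auto simp: carr smult_one_mult coeff_increasing_part antisym_scale ps algebra_simps)
  also have "\<dots> \<in> ext_ideal scale"
    by (rule E.I_l_closed[OF basis_word_normal_form[OF basis]]) simp
  finally show ?case .
next
  case (add s t)
  note carr = add(1,2)[THEN tensor_power_carrier] tensor_power_carrier[OF increasing_part_tensor_power, of m]
  have "s \<oplus>\<^bsub>T\<^esub> t \<ominus>\<^bsub>T\<^esub> increasing_part m (antisym (\<lambda>w. coeff w (s \<oplus>\<^bsub>T\<^esub> t)))
      = (s \<ominus>\<^bsub>T\<^esub> increasing_part m (antisym (\<lambda>w. coeff w s))) \<oplus>\<^bsub>T\<^esub>
        (t \<ominus>\<^bsub>T\<^esub> increasing_part m (antisym (\<lambda>w. coeff w t)))"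
    by (rule T_eqI) (auto simp: carr coeff_increasing_part antisym_add)
  then show ?case using add by simp
qed

lemma wedge_eq: "wedge scale xs = ecls (tensor scale xs)"
  by (simp add: wedge_def)

lemma ext_power_cases:
  assumes "X \<in> ext_power scale m"
  obtains t where "t \<in> tensor_power scale m" "X = ecls t"
  using assms by (auto simp: ext_power_def)

lemma ecls_ext_power [simp]: "t \<in> tensor_power scale m \<Longrightarrow> ecls t \<in> ext_power scale m"
  by (simp add: ext_power_def)

lemma linear_on_ecls:
  assumes "linear_on (ext_power scale m) (ext_alg scale) Y h"
  shows "linear_on (tensor_power scale m) T Y (\<lambda>t. h (ecls t))"
  unfolding linear_on_def additive_on_def
proof (intro conjI ballI allI)
  show "(\<lambda>t. h (ecls t)) \<in> tensor_power scale m \<rightarrow> carrier Y"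
    using assms by (auto simp: linear_on_def additive_on_def)
  fix s t assume "s \<in> tensor_power scale m" "t \<in> tensor_power scale m"
  then show "h (ecls (s \<oplus>\<^bsub>T\<^esub> t)) = h (ecls s) \<oplus>\<^bsub>Y\<^esub> h (ecls t)"
    using assms by (simp add: linear_on_def additive_on_def tensor_power_carrier flip: ecls_add)
next
  fix c t assume "t \<in> tensor_power scale m"
  then show "h (ecls (c \<odot>\<^bsub>T\<^esub> t)) = c \<odot>\<^bsub>Y\<^esub> h (ecls t)"
    using assms by (simp add: linear_on_def tensor_power_carrier flip: ecls_smult)
qed

lemma linear_on_increasing_part:
  assumes h: "linear_on (tensor_power scale m) T Y h" and Y: "abelian_group Y"
  shows "h (increasing_part m a) = (\<Oplus>\<^bsub>Y\<^esub>is\<in>Inc m. a is \<odot>\<^bsub>Y\<^esub> h (tensor scale (map e is)))"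
proof -
  interpret Y: abelian_group Y by (rule Y)
  have sub: "tensor_power scale m \<subseteq> carrier T" by (auto intro: tensor_power_carrier)
  have g: "tensor scale (map e is) \<in> tensor_power scale m" if "is \<in> Inc m" for "is"
    using that by (simp add: increasing_lists_def)
  have g': "(\<lambda>is. a is \<odot>\<^bsub>T\<^esub> tensor scale (map e is)) \<in> Inc m \<rightarrow> tensor_power scale m"
    using g by (auto intro: tensor_power_closed)
  then have gT: "(\<lambda>is. a is \<odot>\<^bsub>T\<^esub> tensor scale (map e is)) \<in> Inc m \<rightarrow> carrier T" using sub by blast
  have "increasing_part m a = (\<Oplus>\<^bsub>T\<^esub>is\<in>Inc m. a is \<odot>\<^bsub>T\<^esub> tensor scale (map e is))"
  proof (rule T_eqI)
    fix ws
    have "coeff ws (\<Oplus>\<^bsub>T\<^esub>is\<in>Inc m. a is \<odot>\<^bsub>T\<^esub> tensor scale (map e is))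
        = (\<Sum>is\<in>Inc m. if is = ws then a is else 0)"
      unfolding coeff_finsum[OF finite_Inc gT]
      by (intro sum.cong) (auto simp: word_coord_basis increasing_lists_def)
    then show "coeff ws (increasing_part m a)
        = coeff ws (\<Oplus>\<^bsub>T\<^esub>is\<in>Inc m. a is \<odot>\<^bsub>T\<^esub> tensor scale (map e is))"
      by (simp add: coeff_increasing_part)
  qed (auto intro!: T.finsum_closed tensor_power_carrier[of _ m])
  also have "h \<dots> = (\<Oplus>\<^bsub>Y\<^esub>is\<in>Inc m. h (a is \<odot>\<^bsub>T\<^esub> tensor scale (map e is)))"
    using additive_on_finsum[OF T.abelian_group_axioms Y _ sub tensor_power_closed(3,1) finite_Inc g'] h
    by (simp add: linear_on_def)
  also have "\<dots> = (\<Oplus>\<^bsub>Y\<^esub>is\<in>Inc m. a is \<odot>\<^bsub>Y\<^esub> h (tensor scale (map e is)))"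
  proof (rule Y.finsum_cong')
    have eq: "h (a is \<odot>\<^bsub>T\<^esub> tensor scale (map e is)) = a is \<odot>\<^bsub>Y\<^esub> h (tensor scale (map e is))"
      if "is \<in> Inc m" for "is"
      using h g[OF that] by (simp add: linear_on_def)
    have "h (a is \<odot>\<^bsub>T\<^esub> tensor scale (map e is)) \<in> carrier Y" if "is \<in> Inc m" for "is"
      using h tensor_power_closed(2)[OF g[OF that]] by (auto simp: linear_on_def additive_on_def)
    then show "(\<lambda>is. a is \<odot>\<^bsub>Y\<^esub> h (tensor scale (map e is))) \<in> Inc m \<rightarrow> carrier Y"
      using eq by auto
    show "h (a is \<odot>\<^bsub>T\<^esub> tensor scale (map e is)) = a is \<odot>\<^bsub>Y\<^esub> h (tensor scale (map e is))"
      if "is \<in> Inc m" for "is" using eq that .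
  qed simp
  finally show ?thesis .
qed

lemma ecls_increasing_part:
  assumes "t \<in> tensor_power scale m"
  shows "ecls t = ecls (increasing_part m (antisym (\<lambda>w. coeff w t)))"
  using assms tensor_normal_form[OF assms] by (simp add: ecls_eq_iff tensor_power_carrier[of _ m])

text \<open>
  The map induced by \<open>Ant\<close> on classes satisfies the description of \<open>phi\<close>, and linear maps on the
  exterior power are determined by their values on increasing wedges, by the normal form.
\<close>

lemma phi_ecls:
  assumes "t \<in> tensor_power scale m"
  shows "phi scale e n m (ecls t) = Ant scale m t"
proof -
  define h where "h = restrict (\<lambda>X. Ant scale m (SOME t. t \<in> tensor_power scale m \<and> X = ecls t))
    (ext_power scale m)"
  have h: "h (ecls t) = Ant scale m t" if t: "t \<in> tensor_power scale m" for t
  proof -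
    let ?s = "SOME s. s \<in> tensor_power scale m \<and> ecls t = ecls s"
    have "?s \<in> tensor_power scale m \<and> ecls t = ecls ?s" by (rule someI[of _ t]) (use t in simp)
    then show ?thesis using t Ant_ext_ideal_cong[of ?s m t] by (simp add: h_def)
  qed
  have "phi scale e n m = h"
    unfolding phi_def
  proof (rule the_equality, intro conjI allI impI)
    show "h \<in> extensional (ext_power scale m)" by (simp add: h_def)
    show lin: "linear_on (ext_power scale m) (ext_alg scale) T h"
      unfolding linear_on_def additive_on_def
      by (auto elim!: ext_power_cases simp: h ecls_add ecls_smult tensor_power_carrier[of _ m]
        tensor_power_closed Ant_add Ant_smult)
    show val: "h (wedge scale (map e is)) = Ant scale m (tensor scale (map e is))"
      if "length is = m \<and> set is \<subseteq> {1..n} \<and> sorted_wrt (<) is" for "is"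
      using that by (simp add: wedge_eq h)
    fix h'
    assume h': "h' \<in> extensional (ext_power scale m) \<and>
      linear_on (ext_power scale m) (ext_alg scale) T h' \<and>
      (\<forall>is. length is = m \<and> set is \<subseteq> {1..n} \<and> sorted_wrt (<) is \<longrightarrow>
        h' (wedge scale (map e is)) = Ant scale m (tensor scale (map e is)))"
    have "h' X = h X" if X: "X \<in> ext_power scale m" for X
    proof -
      obtain t where t: "t \<in> tensor_power scale m" "X = ecls t" using X by (rule ext_power_cases)
      have eq: "h' (ecls (tensor scale (map e is))) = h (ecls (tensor scale (map e is)))"
        if "is \<in> Inc m" for "is"
        using that h' val by (simp add: wedge_eq increasing_lists_def)
      have cl: "h (ecls (tensor scale (map e is))) \<in> carrier T" if "is \<in> Inc m" for "is"
        using that by (simp add: h increasing_lists_def tensor_power_carrier[of _ m])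
      show ?thesis
        unfolding t(2) ecls_increasing_part[OF t(1)]
          linear_on_increasing_part[OF linear_on_ecls[OF lin] T.abelian_group_axioms]
          linear_on_increasing_part[OF linear_on_ecls[OF conjunct1[OF conjunct2[OF h']]] T.abelian_group_axioms]
        by (rule T.finsum_cong') (auto simp: eq cl)
    qed
    then show "h' = h" using h' by (intro extensionalityI[of _ "ext_power scale m"]) (auto simp: h_def)
  qed
  with h assms show ?thesis by simp
qed

text \<open>
  The coefficients of the normal form of \<open>t\<close> are coordinates of \<open>Ant t\<close>.
\<close>

lemma inj_on_phi: "inj_on (phi scale e n m) (ext_power scale m)"
proof (rule inj_onI)
  fix X Y assume "X \<in> ext_power scale m" "Y \<in> ext_power scale m"
    and eq: "phi scale e n m X = phi scale e n m Y"
  then obtain s t where st: "s \<in> tensor_power scale m" "X = ecls s" "t \<in> tensor_power scale m" "Y = ecls t"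
    by (metis ext_power_cases)
  have Ant: "Ant scale m s = Ant scale m t" using eq st by (simp add: phi_ecls)
  have "antisym (\<lambda>w. coeff w s) ws = antisym (\<lambda>w. coeff w t) ws" if "length ws = m" for ws
    using arg_cong[OF Ant, of "coeff ws"] st that by (simp add: coeff_Ant)
  then have "increasing_part m (antisym (\<lambda>w. coeff w s)) = increasing_part m (antisym (\<lambda>w. coeff w t))"
    by (intro T_eqI) (simp_all add: tensor_power_carrier[of _ m] coeff_increasing_part Inc_length)
  then show "X = Y" using st ecls_increasing_part by metis
qed

lemma inv_phi:
  assumes "t \<in> alternating_tensors m"
  shows "inv_into (ext_power scale m) (phi scale e n m) t = ecls (increasing_part m (\<lambda>ws. coeff ws t))"
  by (rule inv_into_f_eq[OF inj_on_phi]) (simp_all add: phi_ecls Ant_increasing_part[OF assms])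


section \<open>The Koszul spaces\<close>

lemma sym_rels_eq: "sym_rels scale N = alternating_tensors N"
  by (simp add: sym_rels_def Ant_image)

lemma coeff_mult_split:
  assumes "s \<in> tensor_power scale a" "t \<in> carrier T" "length us = a"
  shows "coeff (us @ vs) (s \<otimes>\<^bsub>T\<^esub> t) = coeff us s * coeff vs t"
  using assms by (simp add: coeff_mult_homogeneous)

text \<open>
  Being alternating is split into its conditions on single pairs of positions, because each of them
  is additive and can be tested on the generators \<open>u r v\<close> of \<open>V\<^sup>i \<otimes> R \<otimes> V\<^sup>j\<close>.
\<close>

definition alternating_at :: "nat \<Rightarrow> nat \<Rightarrow> ('v word \<Rightarrow>\<^sub>0 'k) set \<Rightarrow> bool" where
  "alternating_at k m t \<longleftrightarrow> (\<forall>us i j vs. length us = k \<longrightarrow> Suc (Suc (k + length vs)) = m \<longrightarrow>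
     coeff (us @ j # i # vs) t = - coeff (us @ i # j # vs) t \<and> coeff (us @ i # i # vs) t = 0)"

lemma alternating_atD:
  assumes "alternating_at k m t" "length us = k" "Suc (Suc (k + length vs)) = m"
  shows "coeff (us @ j # i # vs) t = - coeff (us @ i # j # vs) t \<and> coeff (us @ i # i # vs) t = 0"
  using assms unfolding alternating_at_def by blast

lemma alternating_at_product:
  assumes u: "u \<in> tensor_power scale i" and r: "r \<in> alternating_tensors N" and v: "v \<in> tensor_power scale j"
    and k: "i \<le> k" "Suc (Suc k) \<le> i + N"
  shows "alternating_at k (i + N + j) (u \<otimes>\<^bsub>T\<^esub> r \<otimes>\<^bsub>T\<^esub> v)"
  unfolding alternating_at_def
proof (intro allI impI)
  fix us vs :: "nat list" and p q :: nat
  assume us: "length us = k" and vs: "Suc (Suc (k + length vs)) = i + N + j"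
  define us1 us2 where "us1 = take i us" and "us2 = drop i us"
  define vs1 vs2 where "vs1 = take (i + N - Suc (Suc k)) vs" and "vs2 = drop (i + N - Suc (Suc k)) vs"
  note defs = us1_def us2_def vs1_def vs2_def
  have split: "us = us1 @ us2" "vs = vs1 @ vs2" by (simp_all add: defs)
  have len: "length us1 = i" "Suc (Suc (length us2 + length vs1)) = N"
    using us vs k by (simp_all add: defs)
  have rt: "r \<in> tensor_power scale N" "alternating N (\<lambda>ws. coeff ws r)"
    using r by (auto simp: alternating_tensors_def)
  have ur: "u \<otimes>\<^bsub>T\<^esub> r \<in> tensor_power scale (i + N)" by (rule tensor_power_mult[OF u rt(1)])
  have c: "coeff (us @ p # q # vs) (u \<otimes>\<^bsub>T\<^esub> r \<otimes>\<^bsub>T\<^esub> v)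
      = coeff us1 u * coeff (us2 @ p # q # vs1) r * coeff vs2 v" for p q
  proof -
    have "us @ p # q # vs = (us1 @ (us2 @ p # q # vs1)) @ vs2" by (simp add: split)
    then show ?thesis
      using coeff_mult_split[OF ur tensor_power_carrier[OF v], of "us1 @ (us2 @ p # q # vs1)" vs2]
        coeff_mult_split[OF u tensor_power_carrier[OF rt(1)], of us1 "us2 @ p # q # vs1"] len by simp
  qed
  have swap: "coeff (us2 @ q # p # vs1) r = - coeff (us2 @ p # q # vs1) r"
    by (rule alternatingD(1)[OF rt(2) len(2)])
  show "coeff (us @ q # p # vs) (u \<otimes>\<^bsub>T\<^esub> r \<otimes>\<^bsub>T\<^esub> v) = - coeff (us @ p # q # vs) (u \<otimes>\<^bsub>T\<^esub> r \<otimes>\<^bsub>T\<^esub> v) \<and>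
    coeff (us @ p # p # vs) (u \<otimes>\<^bsub>T\<^esub> r \<otimes>\<^bsub>T\<^esub> v) = 0"
    using alternatingD(2)[OF rt(2) len(2), of p] swap by (simp add: c)
qed

lemma alternating_at_generate:
  assumes t: "t \<in> generate (add_monoid T)
      {u \<otimes>\<^bsub>T\<^esub> r \<otimes>\<^bsub>T\<^esub> v | u r v. u \<in> tensor_power scale i \<and> r \<in> sym_rels scale N \<and> v \<in> tensor_power scale j}"
    (is "_ \<in> generate _ ?S")
    and k: "i \<le> k" "Suc (Suc k) \<le> i + N"
  shows "alternating_at k (i + N + j) t"
proof -
  have S: "?S \<subseteq> carrier T"
    by (auto simp: sym_rels_eq alternating_tensors_def intro: tensor_power_carrier)
  have gen: "alternating_at k (i + N + j) s" if "s \<in> ?S" for s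
    using that alternating_at_product k by (auto simp: sym_rels_eq)
  show ?thesis using t S
  proof (induction t rule: T.generate_induct_add)
    case zero
    then show ?case by (simp add: alternating_at_def)
  next
    case (base s)
    then show ?case by (rule gen)
  next
    case (minus s)
    then have s: "s \<in> carrier T" using S by blast
    show ?case
      unfolding alternating_at_def
    proof (intro allI impI)
      fix us vs :: "nat list" and p q :: nat
      assume len: "length us = k" "Suc (Suc (k + length vs)) = i + N + j"
      show "coeff (us @ q # p # vs) (\<ominus>\<^bsub>T\<^esub> s) = - coeff (us @ p # q # vs) (\<ominus>\<^bsub>T\<^esub> s) \<and>
          coeff (us @ p # p # vs) (\<ominus>\<^bsub>T\<^esub> s) = 0"
        using alternating_atD[OF gen[OF minus] len, of q p] s by simp
    qed
  next
    case (add s t)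
    have st: "s \<in> carrier T" "t \<in> carrier T" using T.generate_add_closed(1)[OF S] add(1,2) by auto
    show ?case
      unfolding alternating_at_def
    proof (intro allI impI)
      fix us vs :: "nat list" and p q :: nat
      assume len: "length us = k" "Suc (Suc (k + length vs)) = i + N + j"
      show "coeff (us @ q # p # vs) (s \<oplus>\<^bsub>T\<^esub> t) = - coeff (us @ p # q # vs) (s \<oplus>\<^bsub>T\<^esub> t) \<and>
          coeff (us @ p # p # vs) (s \<oplus>\<^bsub>T\<^esub> t) = 0"
        using alternating_atD[OF add(3) len, of q p] alternating_atD[OF add(4) len, of q p] st by simp
    qed
  qed
qed

text \<open>
  Each adjacent pair of positions lies in some window of length \<open>N \<ge> 2\<close>; conversely an alternating
  tensor is alternating in each window when the other letters are held fixed.  For \<open>1 < m < N\<close> there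
  is no window at all, and the intersection is the full tensor power.
\<close>

lemma koszul_W_eq:
  assumes N: "2 \<le> N" and m: "m \<le> 1 \<or> N \<le> m"
  shows "koszul_W scale N m = alternating_tensors m"
proof (intro equalityI subsetI)
  fix t assume t: "t \<in> koszul_W scale N m"
  then have tp: "t \<in> tensor_power scale m" by (simp add: koszul_W_def)
  have "alternating m (\<lambda>ws. coeff ws t)"
    unfolding alternating_def
  proof (intro allI impI)
    fix us vs :: "nat list" and p q :: nat
    assume len: "Suc (Suc (length us + length vs)) = m"
    with m have Nm: "N \<le> m" by auto
    \<comment> \<open>a window of length N inside the word that contains the two positions\<close>
    define i where "i = min (length us) (m - N)"
    define j where "j = m - N - i"
    have ij: "i + N + j = m" "i \<le> length us" "Suc (Suc (length us)) \<le> i + N"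
      using Nm N len by (auto simp: i_def j_def min_def)
    have "t \<in> generate (add_monoid T)
      {u \<otimes>\<^bsub>T\<^esub> r \<otimes>\<^bsub>T\<^esub> v | u r v. u \<in> tensor_power scale i \<and> r \<in> sym_rels scale N \<and> v \<in> tensor_power scale j}"
      using t ij(1) unfolding koszul_W_def by blast
    from alternating_at_generate[OF this ij(2,3)]
    show "coeff (us @ q # p # vs) t = - coeff (us @ p # q # vs) t \<and> coeff (us @ p # p # vs) t = 0"
      using len unfolding alternating_at_def ij(1) by blast
  qed
  with tp show "t \<in> alternating_tensors m" by (simp add: alternating_tensors_def)
next
  fix t assume t: "t \<in> alternating_tensors m"
  then have tp: "t \<in> tensor_power scale m" and alt: "alternating m (\<lambda>ws. coeff ws t)"
    by (simp_all add: alternating_tensors_def)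
  have "t \<in> generate (add_monoid T)
      {u \<otimes>\<^bsub>T\<^esub> r \<otimes>\<^bsub>T\<^esub> v | u r v. u \<in> tensor_power scale i \<and> r \<in> sym_rels scale N \<and> v \<in> tensor_power scale j}"
    (is "_ \<in> generate _ ?S") if ij: "i + N + j = m" for i j
  proof -
    have S: "?S \<subseteq> carrier T"
      by (auto simp: sym_rels_eq alternating_tensors_def intro: tensor_power_carrier)
    \<comment> \<open>the middle factors, for fixed letters us on the left and vs on the right\<close>
    define r where "r = (\<lambda>(us, vs). of_coeffs N (\<lambda>w. coeff (us @ w @ vs) t))"
    have cr: "coeff w (r (us, vs)) = (if length w = N then coeff (us @ w @ vs) t else 0)" for w us vs
      using coeff_outside[OF tensor_power_carrier[OF tp], of "us @ w @ vs"]
      by (auto simp: r_def coeff_of_coeffs words_def)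
    have r: "r (us, vs) \<in> alternating_tensors N" if "length us = i" "length vs = j" for us vs
    proof -
      have "alternating N (\<lambda>w. coeff w (r (us, vs)))"
        unfolding alternating_def
      proof (intro allI impI)
        fix ws ws' :: "nat list" and p q :: nat
        assume len: "Suc (Suc (length ws + length ws')) = N"
        have "Suc (Suc (length (us @ ws) + length (ws' @ vs))) = m" using len that ij by simp
        then have "coeff ((us @ ws) @ q # p # (ws' @ vs)) t = - coeff ((us @ ws) @ p # q # (ws' @ vs)) t"
          "coeff ((us @ ws) @ p # p # (ws' @ vs)) t = 0"
          by (rule alternatingD[OF alt])+
        then show "coeff (ws @ q # p # ws') (r (us, vs)) = - coeff (ws @ p # q # ws') (r (us, vs)) \<and>
            coeff (ws @ p # p # ws') (r (us, vs)) = 0"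
          using len by (simp add: cr)
      qed
      then show ?thesis by (simp add: alternating_tensors_def r_def)
    qed
    define g where "g = (\<lambda>(us, vs). tensor scale (map e us) \<otimes>\<^bsub>T\<^esub> r (us, vs) \<otimes>\<^bsub>T\<^esub> tensor scale (map e vs))"
    have g: "g \<in> words i \<times> words j \<rightarrow> ?S"
    proof (rule Pi_I)
      fix x assume "x \<in> words i \<times> words j"
      then obtain us vs where x: "x = (us, vs)" and len: "length us = i" "length vs = j"
        by (auto simp: words_def)
      have "g x = tensor scale (map e us) \<otimes>\<^bsub>T\<^esub> r (us, vs) \<otimes>\<^bsub>T\<^esub> tensor scale (map e vs)"
        by (simp add: g_def x)
      moreover have "tensor scale (map e us) \<in> tensor_power scale i" "r (us, vs) \<in> sym_rels scale N"
        "tensor scale (map e vs) \<in> tensor_power scale j"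
        using r[OF len] len by (simp_all add: sym_rels_eq)
      ultimately show "g x \<in> ?S" by blast
    qed
    then have gT: "g \<in> words i \<times> words j \<rightarrow> carrier T" using S by blast
    have gm: "g (us, vs) \<in> tensor_power scale m" if "us \<in> words i" "vs \<in> words j" for us vs
    proof -
      have "r (us, vs) \<in> tensor_power scale N" by (simp add: r_def)
      then have "tensor scale (map e us) \<otimes>\<^bsub>T\<^esub> r (us, vs) \<in> tensor_power scale (i + N)"
        using that by (intro tensor_power_mult) (simp_all add: words_def)
      from tensor_power_mult[OF this, of "tensor scale (map e vs)" j] show ?thesis
        unfolding g_def case_prod_conv ij[symmetric] using that by (simp add: words_def)
    qed
    have fin: "finite (words i \<times> words j)" by simp
    have "t = finsum T g (words i \<times> words j)"
    proof (rule T_eqI)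
      fix ws
      show "coeff ws t = coeff ws (finsum T g (words i \<times> words j))"
      proof (cases "ws \<in> words m")
        case True
        define w1 w2 w3 where "w1 = take i ws" and "w2 = take N (drop i ws)" and "w3 = drop (i + N) ws"
        note defs = w1_def w2_def w3_def
        have ws: "ws = w1 @ w2 @ w3"
          by (simp add: defs) (metis add.commute append_take_drop_id drop_drop)
        have len: "length w1 = i" "length w2 = N" "length w3 = j"
          using True ij by (auto simp: defs words_def)
        have mem: "w1 \<in> words i" "w3 \<in> words j" using True len by (auto simp: words_def ws)
        have "coeff ws (g (us, vs)) = of_bool ((us, vs) = (w1, w3)) * coeff ws t"
          if "us \<in> words i" "vs \<in> words j" for us vs
        proof -
          have u: "tensor scale (map e us) \<in> tensor_power scale i" "r (us, vs) \<in> tensor_power scale N"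
            using that by (simp_all add: words_def r_def)
          have "coeff ws (g (us, vs)) = coeff (w1 @ w2) (tensor scale (map e us) \<otimes>\<^bsub>T\<^esub> r (us, vs))
              * coeff w3 (tensor scale (map e vs))"
            unfolding g_def case_prod_conv
            using coeff_mult_split[OF tensor_power_mult[OF u], of "tensor scale (map e vs)" "w1 @ w2" w3] len
            by (simp add: ws)
          also have "\<dots> = of_bool (w1 = us) * coeff (us @ w2 @ vs) t * of_bool (w3 = vs)"
            using coeff_mult_split[OF u(1) tensor_power_carrier[OF u(2)], of w1 w2] len that
            by (simp add: cr words_def word_coord_basis)
          finally show ?thesis by (auto simp: ws)
        qed
        then have "(\<Sum>x\<in>words i \<times> words j. coeff ws (g x))
            = (\<Sum>x\<in>words i \<times> words j. if x = (w1, w3) then coeff ws t else 0)"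
          by (intro sum.cong) auto
        also have "\<dots> = coeff ws t" using mem fin by simp
        finally show ?thesis unfolding coeff_finsum[OF fin gT] ..
      next
        case False
        then have zero: "coeff ws s = 0" if "s \<in> tensor_power scale m" for s
          using that coeff_outside[OF tensor_power_carrier[OF that], of ws]
          by (auto simp: tensor_power_altdef words_def)
        then show ?thesis
          unfolding coeff_finsum[OF fin gT] zero[OF tp]
          by (intro sum.neutral[symmetric]) (use zero gm in auto)
      qed
    qed (use tp gT in \<open>auto intro: tensor_power_carrier T.finsum_closed\<close>)
    then show ?thesis using T.finsum_in_generate[OF S fin g] by simp
  qed
  with tp show "t \<in> koszul_W scale N m" unfolding koszul_W_def by blast
qed

end

section \<open>The tensor product of bimodules\<close>

text \<open>
  The relations defining \<open>P \<otimes>\<^sub>A Q\<close> enter through three rules for pure tensors: additivity in both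
  arguments, and moving an element of \<open>A\<close> across.
\<close>

locale bimodule_pair =
  fixes A :: "('k, 'a) module" and P :: "('a, 'p) bimodule" and Q :: "('a, 'q) bimodule"
  assumes bimodule_P: "bimodule A P" and bimodule_Q: "bimodule A Q"
begin

sublocale P: bimodule A P by (rule bimodule_P)
sublocale Q: bimodule A Q by (rule bimodule_Q)

abbreviation "PQ \<equiv> bimodule_tensor A P Q"
abbreviation "FPQ \<equiv> free_Abelian_group (carrier P \<times> carrier Q)"
abbreviation "BPQ \<equiv> balanced_subgroup A P Q"
abbreviation "pure \<equiv> pure_tensor A P Q"

lemma keys_relation:
  assumes "u \<in> S" "v \<in> S" "w \<in> S"
  shows "Poly_Mapping.keys (frag_of u - frag_of v - frag_of w) \<subseteq> S"
    "Poly_Mapping.keys (frag_of u - frag_of v) \<subseteq> S"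
proof -
  show "Poly_Mapping.keys (frag_of u - frag_of v) \<subseteq> S"
    using keys_diff[of "frag_of u" "frag_of v"] assms by auto
  then show "Poly_Mapping.keys (frag_of u - frag_of v - frag_of w) \<subseteq> S"
    using keys_diff[of "frag_of u - frag_of v" "frag_of w"] assms by auto
qed

lemma balanced_rels_carrier: "balanced_rels A P Q \<subseteq> carrier FPQ"
proof
  fix x assume "x \<in> balanced_rels A P Q"
  then show "x \<in> carrier FPQ"
    unfolding balanced_rels_def carrier_free_Abelian_group_iff
    by (elim UnE CollectE exE conjE; hypsubst; intro keys_relation)
      (auto intro: P.ract_closed Q.lact_closed)
qed

lemma subgroup_BPQ: "subgroup BPQ FPQ"
  unfolding balanced_subgroup_def
  by (rule group.generate_is_subgroup[OF group_free_Abelian_group balanced_rels_carrier])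

lemma normal_BPQ: "BPQ \<lhd> FPQ"
  by (rule comm_group.subgroup_imp_normal[OF abelian_free_Abelian_group subgroup_BPQ])

lemma comm_group_quotient: "comm_group (FPQ Mod BPQ)"
  by (rule comm_group.abelian_FactGroup[OF abelian_free_Abelian_group subgroup_BPQ])

lemma PQ_simps:
  "carrier PQ = carrier (FPQ Mod BPQ)" "x \<oplus>\<^bsub>PQ\<^esub> y = x \<otimes>\<^bsub>FPQ Mod BPQ\<^esub> y" "\<zero>\<^bsub>PQ\<^esub> = \<one>\<^bsub>FPQ Mod BPQ\<^esub>"
  by (simp_all add: bimodule_tensor_def Let_def)

lemma abelian_group_PQ: "abelian_group PQ"
proof -
  interpret G: comm_group "FPQ Mod BPQ" by (rule comm_group_quotient)
  show ?thesis
    by (rule abelian_groupI)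
      (auto simp: PQ_simps G.m_ac simp del: mult_FactGroup one_FactGroup
        intro: bexI[of _ "inv\<^bsub>FPQ Mod BPQ\<^esub> _"])
qed

sublocale PQ: abelian_group PQ by (rule abelian_group_PQ)

lemma coset_add:
  assumes "Poly_Mapping.keys x \<subseteq> carrier P \<times> carrier Q" "Poly_Mapping.keys y \<subseteq> carrier P \<times> carrier Q"
  shows "(BPQ #>\<^bsub>FPQ\<^esub> x) \<oplus>\<^bsub>PQ\<^esub> (BPQ #>\<^bsub>FPQ\<^esub> y) = BPQ #>\<^bsub>FPQ\<^esub> (x + y)"
  using normal.rcos_sum[OF normal_BPQ, of x y] assms by (simp add: PQ_simps FactGroup_def)

lemma coset_eqI:
  assumes "Poly_Mapping.keys x \<subseteq> carrier P \<times> carrier Q" "y - x \<in> balanced_rels A P Q"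
  shows "BPQ #>\<^bsub>FPQ\<^esub> y = BPQ #>\<^bsub>FPQ\<^esub> x"
proof -
  have "y - x \<in> BPQ" unfolding balanced_subgroup_def using assms(2) by (rule generate.incl)
  then have "y \<in> BPQ #>\<^bsub>FPQ\<^esub> x" by (force simp: r_coset_def)
  then show ?thesis
    using group.repr_independence[OF group_free_Abelian_group _ _ subgroup_BPQ, of y x] assms(1) by simp
qed

lemma pure_closed [simp]: "x \<in> carrier P \<Longrightarrow> y \<in> carrier Q \<Longrightarrow> pure x y \<in> carrier PQ"
  by (auto simp: pure_tensor_def PQ_simps FactGroup_def RCOSETS_def intro!: bexI[of _ "frag_of (x, y)"])

lemma keys_frag_sum:
  "u \<in> S \<Longrightarrow> v \<in> S \<Longrightarrow> Poly_Mapping.keys (frag_of u + frag_of v) \<subseteq> S"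
  using Poly_Mapping.keys_add[of "frag_of u" "frag_of v"] by auto

lemma pure_add_left:
  assumes "x \<in> carrier P" "x' \<in> carrier P" "y \<in> carrier Q"
  shows "pure (x \<oplus>\<^bsub>P\<^esub> x') y = pure x y \<oplus>\<^bsub>PQ\<^esub> pure x' y"
proof -
  have "BPQ #>\<^bsub>FPQ\<^esub> frag_of (x \<oplus>\<^bsub>P\<^esub> x', y) = BPQ #>\<^bsub>FPQ\<^esub> (frag_of (x, y) + frag_of (x', y))"
    by (rule coset_eqI, rule keys_frag_sum)
      (use assms in \<open>auto simp: balanced_rels_def diff_diff_eq[symmetric]\<close>)
  then show ?thesis using assms by (simp add: pure_tensor_def coset_add)
qed

lemma pure_add_right:
  assumes "x \<in> carrier P" "y \<in> carrier Q" "y' \<in> carrier Q"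
  shows "pure x (y \<oplus>\<^bsub>Q\<^esub> y') = pure x y \<oplus>\<^bsub>PQ\<^esub> pure x y'"
proof -
  have "BPQ #>\<^bsub>FPQ\<^esub> frag_of (x, y \<oplus>\<^bsub>Q\<^esub> y') = BPQ #>\<^bsub>FPQ\<^esub> (frag_of (x, y) + frag_of (x, y'))"
    by (rule coset_eqI, rule keys_frag_sum)
      (use assms in \<open>auto simp: balanced_rels_def diff_diff_eq[symmetric]\<close>)
  then show ?thesis using assms by (simp add: pure_tensor_def coset_add)
qed

lemma pure_balanced:
  assumes "x \<in> carrier P" "a \<in> carrier A" "y \<in> carrier Q"
  shows "pure (rsmult P x a) y = pure x (a \<odot>\<^bsub>Q\<^esub> y)"
  unfolding pure_tensor_def
  by (rule coset_eqI) (use assms Q.lact_closed in \<open>auto simp: balanced_rels_def\<close>)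

lemma pure_finsum_left:
  assumes "finite I" "h \<in> I \<rightarrow> carrier P" "y \<in> carrier Q"
  shows "pure (finsum P h I) y = (\<Oplus>\<^bsub>PQ\<^esub>i\<in>I. pure (h i) y)"
proof -
  have "additive_on (carrier P) P PQ (\<lambda>x. pure x y)"
    using assms by (auto simp: additive_on_def pure_add_left)
  from additive_on_finsum[OF P.abelian_group_axioms abelian_group_PQ this subset_refl _ _ assms(1,2)]
  show ?thesis by simp
qed

lemma pure_finsum_right:
  assumes "finite I" "h \<in> I \<rightarrow> carrier Q" "x \<in> carrier P"
  shows "pure x (finsum Q h I) = (\<Oplus>\<^bsub>PQ\<^esub>i\<in>I. pure x (h i))"
proof -
  have "additive_on (carrier Q) Q PQ (\<lambda>y. pure x y)"
    using assms by (auto simp: additive_on_def pure_add_right)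
  from additive_on_finsum[OF Q.abelian_group_axioms abelian_group_PQ this subset_refl _ _ assms(1,2)]
  show ?thesis by simp
qed

end

lemma (in bimodule) lact_finsum:
  assumes "finite I" "h \<in> I \<rightarrow> carrier P" "a \<in> carrier A"
  shows "a \<odot>\<^bsub>P\<^esub> finsum P h I = (\<Oplus>\<^bsub>P\<^esub>i\<in>I. a \<odot>\<^bsub>P\<^esub> h i)"
proof -
  have "additive_on (carrier P) P P (\<lambda>x. a \<odot>\<^bsub>P\<^esub> x)"
    using assms by (auto simp: additive_on_def lact_add_right lact_closed)
  from additive_on_finsum[OF P.abelian_group_axioms P.abelian_group_axioms this subset_refl _ _ assms(1,2)]
  show ?thesis by simp
qed

lemma bimodule_space_simps [simp]:
  "carrier (bimodule_space A P) = carrier P" "x \<oplus>\<^bsub>bimodule_space A P\<^esub> y = x \<oplus>\<^bsub>P\<^esub> y"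
  "\<zero>\<^bsub>bimodule_space A P\<^esub> = \<zero>\<^bsub>P\<^esub>"
  "c \<odot>\<^bsub>bimodule_space A P\<^esub> x = (c \<odot>\<^bsub>A\<^esub> \<one>\<^bsub>A\<^esub>) \<odot>\<^bsub>P\<^esub> x"
  "finsum (bimodule_space A P) h I = finsum P h I"
  by (simp_all add: bimodule_space_def finsum_def finprod_def)

lemma abelian_group_bimodule_space:
  assumes "bimodule A P"
  shows "abelian_group (bimodule_space A P)"
proof -
  interpret bimodule A P by (rule assms)
  show ?thesis
    by (rule abelian_groupI) (auto simp: P.a_ac intro: bexI[of _ "\<ominus>\<^bsub>P\<^esub> _"] P.l_neg)
qed


section \<open>The map induced by two cochains\<close>

context based_space
begin

lemma ideal_sym_ideal: "ideal (sym_ideal scale N) T"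
  unfolding sym_ideal_def
  by (rule T.genideal_ideal) (auto simp: sym_rels_eq alternating_tensors_def intro: tensor_power_carrier)

lemma sym_class_carrier: "t \<in> carrier T \<Longrightarrow> sym_class scale N t \<in> carrier (sym_alg scale N)"
  unfolding sym_alg_def sym_class_def carrier_quot_alg[OF ideal_sym_ideal] by blast

lemma sym_alg_scalar: "c \<odot>\<^bsub>sym_alg scale N\<^esub> \<one>\<^bsub>sym_alg scale N\<^esub> = sym_class scale N (c \<odot>\<^bsub>T\<^esub> \<one>\<^bsub>T\<^esub>)"
  unfolding sym_alg_def sym_class_def quot_alg_one[OF ideal_sym_ideal]
  by (simp add: quot_alg_smult[OF ideal_sym_ideal])

lemma sym_class_scalar_mult:
  "sym_class scale N (c \<odot>\<^bsub>T\<^esub> \<one>\<^bsub>T\<^esub>) \<otimes>\<^bsub>sym_alg scale N\<^esub> sym_class scale N (d \<odot>\<^bsub>T\<^esub> \<one>\<^bsub>T\<^esub>)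
     = sym_class scale N ((c * d) \<odot>\<^bsub>T\<^esub> \<one>\<^bsub>T\<^esub>)"
proof -
  have "(c \<odot>\<^bsub>T\<^esub> \<one>\<^bsub>T\<^esub>) \<otimes>\<^bsub>T\<^esub> (d \<odot>\<^bsub>T\<^esub> \<one>\<^bsub>T\<^esub>) = (c * d) \<odot>\<^bsub>T\<^esub> \<one>\<^bsub>T\<^esub>"
    by (rule T_eqI) (simp_all add: smult_one_mult mult.assoc)
  then show ?thesis
    unfolding sym_alg_def sym_class_def by (simp add: quot_alg_mult[OF ideal_sym_ideal])
qed

lemma sym_class_scalar_add:
  "sym_class scale N (c \<odot>\<^bsub>T\<^esub> \<one>\<^bsub>T\<^esub>) \<oplus>\<^bsub>sym_alg scale N\<^esub> sym_class scale N (d \<odot>\<^bsub>T\<^esub> \<one>\<^bsub>T\<^esub>)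
     = sym_class scale N ((c + d) \<odot>\<^bsub>T\<^esub> \<one>\<^bsub>T\<^esub>)"
proof -
  have "(c \<odot>\<^bsub>T\<^esub> \<one>\<^bsub>T\<^esub>) \<oplus>\<^bsub>T\<^esub> (d \<odot>\<^bsub>T\<^esub> \<one>\<^bsub>T\<^esub>) = (c + d) \<odot>\<^bsub>T\<^esub> \<one>\<^bsub>T\<^esub>"
    by (rule T_eqI) (simp_all add: distrib_right)
  then show ?thesis
    unfolding sym_alg_def sym_class_def by (simp add: quot_alg_add[OF ideal_sym_ideal])
qed

end

locale koszul_pair = based_space scale e n
  for scale :: "'k::field \<Rightarrow> 'v::ab_group_add \<Rightarrow> 'v" and e :: "nat \<Rightarrow> 'v" and n :: nat +
  fixes N :: nat
    and P :: "(('v word \<Rightarrow>\<^sub>0 'k) set set, 'p) bimodule"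
    and Q :: "(('v word \<Rightarrow>\<^sub>0 'k) set set, 'q) bimodule"
  assumes N: "2 \<le> N"
    and bimodules: "bimodule (sym_alg scale N) P" "bimodule (sym_alg scale N) Q"
begin

abbreviation "A \<equiv> sym_alg scale N"

sublocale bimodule_pair A P Q
  by (rule bimodule_pair.intro) (rule bimodules)+

definition scalar :: "'k \<Rightarrow> ('v word \<Rightarrow>\<^sub>0 'k) set set" where
  "scalar c = sym_class scale N (c \<odot>\<^bsub>T\<^esub> \<one>\<^bsub>T\<^esub>)"

lemma scalar_carrier [simp]: "scalar c \<in> carrier A"
  by (simp add: scalar_def sym_class_carrier)

lemma scalar_eq: "c \<odot>\<^bsub>A\<^esub> \<one>\<^bsub>A\<^esub> = scalar c"
  by (simp add: scalar_def sym_alg_scalar)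

lemma scalar_mult: "scalar c \<otimes>\<^bsub>A\<^esub> scalar d = scalar (c * d)"
  by (simp add: scalar_def sym_class_scalar_mult)

lemma scalar_add: "scalar c \<oplus>\<^bsub>A\<^esub> scalar d = scalar (c + d)"
  by (simp add: scalar_def sym_class_scalar_add)

lemma sym_class_degree_0:
  "u \<in> tensor_power scale 0 \<Longrightarrow> sym_class scale N u = scalar (coeff [] u)"
  by (subst tensor_power_0) (simp_all add: scalar_def)

lemma scalar_central_P: "x \<in> carrier P \<Longrightarrow> rsmult P x (scalar c) = scalar c \<odot>\<^bsub>P\<^esub> x"
  using P.scalars_central[of x c] by (simp add: scalar_eq)

lemma scalar_central_Q: "y \<in> carrier Q \<Longrightarrow> rsmult Q y (scalar c) = scalar c \<odot>\<^bsub>Q\<^esub> y"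
  using Q.scalars_central[of y c] by (simp add: scalar_eq)

definition split_tensors :: "nat \<Rightarrow> nat \<Rightarrow> ('v word \<Rightarrow>\<^sub>0 'k) set set" where
  "split_tensors a b = {u \<otimes>\<^bsub>T\<^esub> s \<otimes>\<^bsub>T\<^esub> v \<otimes>\<^bsub>T\<^esub> t \<otimes>\<^bsub>T\<^esub> w | u s v t w.
     u \<in> tensor_power scale 0 \<and> s \<in> alternating_tensors a \<and>
     v \<in> tensor_power scale 0 \<and> t \<in> alternating_tensors b \<and> w \<in> tensor_power scale 0}"

lemma alternating_tensors_carrier: "t \<in> alternating_tensors m \<Longrightarrow> t \<in> carrier T"
  by (simp add: alternating_tensors_def tensor_power_carrier[of _ m])

lemma split_tensors_carrier: "split_tensors a b \<subseteq> carrier T"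
  by (auto simp: split_tensors_def intro!: T.m_closed
    intro: tensor_power_carrier alternating_tensors_carrier)

text \<open>
  Elements of degree zero are scalars, so that only the words of length \<open>a + b\<close> matter and the
  three outer factors contribute a scalar.
\<close>

lemma coeff_split_tensor:
  assumes "u \<in> tensor_power scale 0" "s \<in> alternating_tensors a" "v \<in> tensor_power scale 0"
    "t \<in> alternating_tensors b" "w \<in> tensor_power scale 0" and "length is = a"
  shows "coeff (is @ js) (u \<otimes>\<^bsub>T\<^esub> s \<otimes>\<^bsub>T\<^esub> v \<otimes>\<^bsub>T\<^esub> t \<otimes>\<^bsub>T\<^esub> w)
    = coeff [] v * coeff [] u * coeff is s * (coeff [] w * coeff js t)"
proof -
  note carr = assms(1,3,5)[THEN tensor_power_carrier] assms(2,4)[THEN alternating_tensors_carrier]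
  obtain \<alpha> \<beta> \<gamma> where scal: "\<alpha> = coeff [] u" "\<beta> = coeff [] v" "\<gamma> = coeff [] w" by blast
  have deg0: "u = \<alpha> \<odot>\<^bsub>T\<^esub> \<one>\<^bsub>T\<^esub>" "v = \<beta> \<odot>\<^bsub>T\<^esub> \<one>\<^bsub>T\<^esub>" "w = \<gamma> \<odot>\<^bsub>T\<^esub> \<one>\<^bsub>T\<^esub>"
    unfolding scal by (rule tensor_power_0; rule assms)+
  have usv: "u \<otimes>\<^bsub>T\<^esub> s \<otimes>\<^bsub>T\<^esub> v = \<beta> \<odot>\<^bsub>T\<^esub> (\<alpha> \<odot>\<^bsub>T\<^esub> s)"
    using carr by (simp add: deg0 smult_one_mult mult_smult_one)
  have "u \<otimes>\<^bsub>T\<^esub> s \<otimes>\<^bsub>T\<^esub> v \<in> tensor_power scale a"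
    unfolding usv using assms(2) by (intro tensor_power_closed) (simp add: alternating_tensors_def)
  moreover have "u \<otimes>\<^bsub>T\<^esub> s \<otimes>\<^bsub>T\<^esub> v \<otimes>\<^bsub>T\<^esub> t \<otimes>\<^bsub>T\<^esub> w = (u \<otimes>\<^bsub>T\<^esub> s \<otimes>\<^bsub>T\<^esub> v) \<otimes>\<^bsub>T\<^esub> (t \<otimes>\<^bsub>T\<^esub> w)"
    using carr by (simp add: T.m_assoc)
  moreover have "t \<otimes>\<^bsub>T\<^esub> w = \<gamma> \<odot>\<^bsub>T\<^esub> t" using carr by (simp add: deg0 mult_smult_one)
  ultimately show ?thesis
    using coeff_mult_split[of "u \<otimes>\<^bsub>T\<^esub> s \<otimes>\<^bsub>T\<^esub> v" a "t \<otimes>\<^bsub>T\<^esub> w" "is" js] carr assms(6)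
    by (simp add: usv mult.assoc flip: scal)
qed

context
  fixes a b :: nat
    and F :: "('v word \<Rightarrow>\<^sub>0 'k) set \<Rightarrow> 'p" and G :: "('v word \<Rightarrow>\<^sub>0 'k) set \<Rightarrow> 'q"
    and fb :: "nat list \<Rightarrow> 'p" and gb :: "nat list \<Rightarrow> 'q"
  assumes fb: "fb \<in> Inc a \<rightarrow> carrier P" and gb: "gb \<in> Inc b \<rightarrow> carrier Q"
    and F: "\<And>s. s \<in> alternating_tensors a \<Longrightarrow> F s = (\<Oplus>\<^bsub>P\<^esub>is\<in>Inc a. scalar (coeff is s) \<odot>\<^bsub>P\<^esub> fb is)"
    and G: "\<And>t. t \<in> alternating_tensors b \<Longrightarrow> G t = (\<Oplus>\<^bsub>Q\<^esub>js\<in>Inc b. scalar (coeff js t) \<odot>\<^bsub>Q\<^esub> gb js)"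
begin

text \<open>
  A cochain on alternating tensors is determined by its values \<open>fb\<close> and \<open>gb\<close> on the
  antisymmetrized increasing words. Each coefficient is linear in \<open>z\<close>, so the formula is additive on
  the whole tensor algebra, whatever the decomposition of \<open>z\<close> into products.
\<close>

definition cup_map :: "('v word \<Rightarrow>\<^sub>0 'k) set \<Rightarrow> (('p \<times> 'q) \<Rightarrow>\<^sub>0 int) set" where
  "cup_map z = (\<Oplus>\<^bsub>PQ\<^esub>is\<in>Inc a. \<Oplus>\<^bsub>PQ\<^esub>js\<in>Inc b.
     pure (scalar (coeff (is @ js) z) \<odot>\<^bsub>P\<^esub> fb is) (gb js))"

lemma scaled_fb [simp]: "is \<in> Inc a \<Longrightarrow> scalar c \<odot>\<^bsub>P\<^esub> fb is \<in> carrier P"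
  using fb by (auto intro: P.lact_closed)

lemma scaled_gb [simp]: "js \<in> Inc b \<Longrightarrow> scalar c \<odot>\<^bsub>Q\<^esub> gb js \<in> carrier Q"
  using gb by (auto intro: Q.lact_closed)

lemma fb_closed [simp]: "is \<in> Inc a \<Longrightarrow> fb is \<in> carrier P"
  and gb_closed [simp]: "js \<in> Inc b \<Longrightarrow> gb js \<in> carrier Q"
  using fb gb by auto

lemma F_closed: "s \<in> alternating_tensors a \<Longrightarrow> F s \<in> carrier P"
  unfolding F by (rule P.finsum_closed) auto

lemma G_closed: "t \<in> alternating_tensors b \<Longrightarrow> G t \<in> carrier Q"
  unfolding G by (rule Q.finsum_closed) auto

lemma cup_map_closed: "cup_map z \<in> carrier PQ"
  unfolding cup_map_def by (intro PQ.finsum_closed Pi_I) auto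

lemma cup_map_add:
  assumes "y \<in> carrier T" "z \<in> carrier T"
  shows "cup_map (y \<oplus>\<^bsub>T\<^esub> z) = cup_map y \<oplus>\<^bsub>PQ\<^esub> cup_map z"
proof -
  have "pure (scalar (coeff (is @ js) (y \<oplus>\<^bsub>T\<^esub> z)) \<odot>\<^bsub>P\<^esub> fb is) (gb js)
      = pure (scalar (coeff (is @ js) y) \<odot>\<^bsub>P\<^esub> fb is) (gb js)
        \<oplus>\<^bsub>PQ\<^esub> pure (scalar (coeff (is @ js) z) \<odot>\<^bsub>P\<^esub> fb is) (gb js)"
    if "is \<in> Inc a" "js \<in> Inc b" for "is" js
    using that assms by (simp add: P.lact_add_left pure_add_left flip: scalar_add)
  then have "cup_map (y \<oplus>\<^bsub>T\<^esub> z) = (\<Oplus>\<^bsub>PQ\<^esub>is\<in>Inc a. \<Oplus>\<^bsub>PQ\<^esub>js\<in>Inc b.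
      pure (scalar (coeff (is @ js) y) \<odot>\<^bsub>P\<^esub> fb is) (gb js)
        \<oplus>\<^bsub>PQ\<^esub> pure (scalar (coeff (is @ js) z) \<odot>\<^bsub>P\<^esub> fb is) (gb js))"
    unfolding cup_map_def by (intro PQ.finsum_cong') (auto intro!: PQ.finsum_closed PQ.finsum_cong')
  also have "\<dots> = (\<Oplus>\<^bsub>PQ\<^esub>is\<in>Inc a.
      (\<Oplus>\<^bsub>PQ\<^esub>js\<in>Inc b. pure (scalar (coeff (is @ js) y) \<odot>\<^bsub>P\<^esub> fb is) (gb js)) \<oplus>\<^bsub>PQ\<^esub>
      (\<Oplus>\<^bsub>PQ\<^esub>js\<in>Inc b. pure (scalar (coeff (is @ js) z) \<odot>\<^bsub>P\<^esub> fb is) (gb js)))"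
    by (intro PQ.finsum_cong') (auto intro!: PQ.finsum_closed PQ.finsum_addf)
  also have "\<dots> = cup_map y \<oplus>\<^bsub>PQ\<^esub> cup_map z"
    unfolding cup_map_def by (intro PQ.finsum_addf) (auto intro!: PQ.finsum_closed)
  finally show ?thesis .
qed

text \<open>
  Both cochain values are expanded over increasing words; all scalars are then moved to the left
  factor, the scalar of \<open>g\<close> crossing the tensor sign as an element of \<open>A\<close> that acts centrally.
\<close>

lemma cup_map_product:
  assumes u: "u \<in> tensor_power scale 0" and s: "s \<in> alternating_tensors a"
    and v: "v \<in> tensor_power scale 0" and t: "t \<in> alternating_tensors b" and w: "w \<in> tensor_power scale 0"
  shows "cup_map (u \<otimes>\<^bsub>T\<^esub> s \<otimes>\<^bsub>T\<^esub> v \<otimes>\<^bsub>T\<^esub> t \<otimes>\<^bsub>T\<^esub> w)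
    = pure (rsmult P (sym_class scale N u \<odot>\<^bsub>P\<^esub> F s) (sym_class scale N v))
        (rsmult Q (G t) (sym_class scale N w))"
proof -
  define \<alpha> \<beta> \<gamma> where "\<alpha> = coeff [] u" and "\<beta> = coeff [] v" and "\<gamma> = coeff [] w"
  note cl = sym_class_degree_0[OF u, folded \<alpha>_def] sym_class_degree_0[OF v, folded \<beta>_def]
    sym_class_degree_0[OF w, folded \<gamma>_def]
  let ?x = "\<lambda>is. scalar (\<beta> * \<alpha> * coeff is s) \<odot>\<^bsub>P\<^esub> fb is"
  let ?y = "\<lambda>js. scalar (\<gamma> * coeff js t) \<odot>\<^bsub>Q\<^esub> gb js"
  have "rsmult P (scalar \<alpha> \<odot>\<^bsub>P\<^esub> F s) (scalar \<beta>) = scalar (\<beta> * \<alpha>) \<odot>\<^bsub>P\<^esub> F s"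
    using F_closed[OF s] by (simp add: scalar_central_P P.lact_closed P.lact_mult flip: scalar_mult)
  also have "\<dots> = (\<Oplus>\<^bsub>P\<^esub>is\<in>Inc a. scalar (\<beta> * \<alpha>) \<odot>\<^bsub>P\<^esub> (scalar (coeff is s) \<odot>\<^bsub>P\<^esub> fb is))"
    unfolding F[OF s] by (rule P.lact_finsum) auto
  also have "\<dots> = finsum P ?x (Inc a)"
    by (rule P.finsum_cong') (auto simp: P.lact_mult simp flip: scalar_mult intro!: P.lact_closed)
  finally have X: "rsmult P (scalar \<alpha> \<odot>\<^bsub>P\<^esub> F s) (scalar \<beta>) = finsum P ?x (Inc a)" .
  have "rsmult Q (G t) (scalar \<gamma>) = scalar \<gamma> \<odot>\<^bsub>Q\<^esub> G t"
    using G_closed[OF t] by (simp add: scalar_central_Q)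
  also have "\<dots> = (\<Oplus>\<^bsub>Q\<^esub>js\<in>Inc b. scalar \<gamma> \<odot>\<^bsub>Q\<^esub> (scalar (coeff js t) \<odot>\<^bsub>Q\<^esub> gb js))"
    unfolding G[OF t] by (rule Q.lact_finsum) auto
  also have "\<dots> = finsum Q ?y (Inc b)"
    by (rule Q.finsum_cong') (auto simp: Q.lact_mult simp flip: scalar_mult intro!: Q.lact_closed)
  finally have Y: "rsmult Q (G t) (scalar \<gamma>) = finsum Q ?y (Inc b)" .
  have move: "pure (?x is) (?y js) = pure (scalar (coeff (is @ js) (u \<otimes>\<^bsub>T\<^esub> s \<otimes>\<^bsub>T\<^esub> v \<otimes>\<^bsub>T\<^esub> t \<otimes>\<^bsub>T\<^esub> w)) \<odot>\<^bsub>P\<^esub> fb is) (gb js)"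
    if "is \<in> Inc a" "js \<in> Inc b" for "is" js
  proof -
    have "coeff (is @ js) (u \<otimes>\<^bsub>T\<^esub> s \<otimes>\<^bsub>T\<^esub> v \<otimes>\<^bsub>T\<^esub> t \<otimes>\<^bsub>T\<^esub> w) = (\<gamma> * coeff js t) * (\<beta> * \<alpha> * coeff is s)"
      using coeff_split_tensor[OF u s v t w Inc_length[OF that(1)], of js]
      by (simp add: \<alpha>_def \<beta>_def \<gamma>_def mult_ac)
    moreover have "pure (?x is) (?y js) = pure (scalar (\<gamma> * coeff js t) \<odot>\<^bsub>P\<^esub> ?x is) (gb js)"
      using that pure_balanced[of "?x is" "scalar (\<gamma> * coeff js t)" "gb js"] by (simp add: scalar_central_P)
    ultimately show ?thesis
      using that by (simp add: P.lact_mult[symmetric] scalar_mult)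
  qed
  have "pure (finsum P ?x (Inc a)) (finsum Q ?y (Inc b)) = (\<Oplus>\<^bsub>PQ\<^esub>is\<in>Inc a. pure (?x is) (finsum Q ?y (Inc b)))"
    by (rule pure_finsum_left) (auto intro!: Q.finsum_closed)
  also have "\<dots> = cup_map (u \<otimes>\<^bsub>T\<^esub> s \<otimes>\<^bsub>T\<^esub> v \<otimes>\<^bsub>T\<^esub> t \<otimes>\<^bsub>T\<^esub> w)"
    unfolding cup_map_def
  proof (rule PQ.finsum_cong')
    fix "is" assume "is": "is \<in> Inc a"
    have "pure (?x is) (finsum Q ?y (Inc b)) = (\<Oplus>\<^bsub>PQ\<^esub>js\<in>Inc b. pure (?x is) (?y js))"
      by (rule pure_finsum_right) (use "is" in auto)
    also have "\<dots> = (\<Oplus>\<^bsub>PQ\<^esub>js\<in>Inc b.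
        pure (scalar (coeff (is @ js) (u \<otimes>\<^bsub>T\<^esub> s \<otimes>\<^bsub>T\<^esub> v \<otimes>\<^bsub>T\<^esub> t \<otimes>\<^bsub>T\<^esub> w)) \<odot>\<^bsub>P\<^esub> fb is) (gb js))"
      by (rule PQ.finsum_cong') (use move "is" in auto)
    finally show "pure (?x is) (finsum Q ?y (Inc b)) = (\<Oplus>\<^bsub>PQ\<^esub>js\<in>Inc b.
        pure (scalar (coeff (is @ js) (u \<otimes>\<^bsub>T\<^esub> s \<otimes>\<^bsub>T\<^esub> v \<otimes>\<^bsub>T\<^esub> t \<otimes>\<^bsub>T\<^esub> w)) \<odot>\<^bsub>P\<^esub> fb is) (gb js))" .
  qed (auto intro!: PQ.finsum_closed)
  finally show ?thesis unfolding cl X Y ..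
qed

lemma additive_map_unique:
  assumes "additive_on (generate (add_monoid T) S) T PQ h" "additive_on (generate (add_monoid T) S) T PQ h'"
    and S: "S \<subseteq> carrier T" and eq: "\<And>s. s \<in> S \<Longrightarrow> h s = h' s"
    and z: "z \<in> generate (add_monoid T) S"
  shows "h z = h' z"
proof -
  note D = T.generate_add_closed[OF S]
  have neg: "g (\<ominus>\<^bsub>T\<^esub> s) = \<ominus>\<^bsub>PQ\<^esub> g s"
    if g: "additive_on (generate (add_monoid T) S) T PQ g" and s: "s \<in> S" for g s
  proof -
    have mem: "s \<in> generate (add_monoid T) S" "\<ominus>\<^bsub>T\<^esub> s \<in> generate (add_monoid T) S"
      using generate.incl[OF s] generate.inv[OF s] by (auto simp: a_inv_def)
    then have cl: "g s \<in> carrier PQ" "g (\<ominus>\<^bsub>T\<^esub> s) \<in> carrier PQ" using g by (auto simp: additive_on_def)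
    have "g (\<ominus>\<^bsub>T\<^esub> s) \<oplus>\<^bsub>PQ\<^esub> g s = g (\<ominus>\<^bsub>T\<^esub> s \<oplus>\<^bsub>T\<^esub> s)" using g mem by (simp add: additive_on_def)
    also have "\<dots> = \<zero>\<^bsub>PQ\<^esub>"
      using s S additive_on_zero[OF T.abelian_group_axioms abelian_group_PQ g D(2)] by (auto simp: T.l_neg)
    finally show ?thesis using cl PQ.minus_equality by metis
  qed
  show ?thesis using z S
  proof (induction z rule: T.generate_induct_add)
    case zero
    then show ?case
      using additive_on_zero[OF T.abelian_group_axioms abelian_group_PQ _ D(2)] assms(1,2) by metis
  next
    case (base s)
    then show ?case by (rule eq)
  next
    case (minus s)
    then show ?case using neg assms(1,2) eq by metis
  next
    case (add s t)
    then show ?case using assms(1,2) by (simp add: additive_on_def)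
  qed
qed

lemma koszul_apply_eq:
  assumes W: "koszul_W scale N a = alternating_tensors a" "koszul_W scale N b = alternating_tensors b"
    and z: "z \<in> generate (add_monoid T) (split_tensors a b)"
  shows "koszul_apply scale N P Q 0 a 0 b 0 F G z = cup_map z"
proof -
  let ?D = "generate (add_monoid T) (split_tensors a b)"
  note D = T.generate_add_closed[OF split_tensors_carrier[of a b]]
  have add: "additive_on ?D T PQ (restrict cup_map ?D)"
    unfolding additive_on_def
  proof (intro conjI ballI)
    fix x y assume "x \<in> ?D" "y \<in> ?D"
    then show "restrict cup_map ?D (x \<oplus>\<^bsub>T\<^esub> y) = restrict cup_map ?D x \<oplus>\<^bsub>PQ\<^esub> restrict cup_map ?D y"
      using D by (auto simp: cup_map_add subset_iff)
  qed (auto intro: cup_map_closed)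
  have gen: "u \<otimes>\<^bsub>T\<^esub> s \<otimes>\<^bsub>T\<^esub> v \<otimes>\<^bsub>T\<^esub> t \<otimes>\<^bsub>T\<^esub> w \<in> ?D"
    if "u \<in> tensor_power scale 0" "s \<in> alternating_tensors a" "v \<in> tensor_power scale 0"
      "t \<in> alternating_tensors b" "w \<in> tensor_power scale 0" for u s v t w
    by (rule generate.incl) (use that in \<open>unfold split_tensors_def, blast\<close>)
  have "koszul_apply scale N P Q 0 a 0 b 0 F G = restrict cup_map ?D"
    unfolding koszul_apply_def Let_def W split_tensors_def[symmetric]
  proof (rule the_equality, intro conjI ballI)
    show "restrict cup_map ?D \<in> extensional ?D" by simp
    show "additive_on ?D T PQ (restrict cup_map ?D)" by (rule add)
    fix u s v t w
    assume "u \<in> tensor_power scale 0" "s \<in> alternating_tensors a" "v \<in> tensor_power scale 0"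
      "t \<in> alternating_tensors b" "w \<in> tensor_power scale 0"
    then show "restrict cup_map ?D (u \<otimes>\<^bsub>T\<^esub> s \<otimes>\<^bsub>T\<^esub> v \<otimes>\<^bsub>T\<^esub> t \<otimes>\<^bsub>T\<^esub> w) =
        pure (rsmult P (sym_class scale N u \<odot>\<^bsub>P\<^esub> F s) (sym_class scale N v)) (rsmult Q (G t) (sym_class scale N w))"
      by (simp add: gen cup_map_product)
  next
    fix h
    assume h: "h \<in> extensional ?D \<and> additive_on ?D T PQ h \<and>
      (\<forall>u\<in>tensor_power scale 0. \<forall>s\<in>alternating_tensors a. \<forall>v\<in>tensor_power scale 0.
       \<forall>t\<in>alternating_tensors b. \<forall>w\<in>tensor_power scale 0.
         h (u \<otimes>\<^bsub>T\<^esub> s \<otimes>\<^bsub>T\<^esub> v \<otimes>\<^bsub>T\<^esub> t \<otimes>\<^bsub>T\<^esub> w) =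
         pure (rsmult P (sym_class scale N u \<odot>\<^bsub>P\<^esub> F s) (sym_class scale N v)) (rsmult Q (G t) (sym_class scale N w)))"
    have eq: "h s = restrict cup_map ?D s" if "s \<in> split_tensors a b" for s
    proof -
      obtain u s' v t w where *: "s = u \<otimes>\<^bsub>T\<^esub> s' \<otimes>\<^bsub>T\<^esub> v \<otimes>\<^bsub>T\<^esub> t \<otimes>\<^bsub>T\<^esub> w" "u \<in> tensor_power scale 0"
        "s' \<in> alternating_tensors a" "v \<in> tensor_power scale 0" "t \<in> alternating_tensors b" "w \<in> tensor_power scale 0"
        using \<open>s \<in> split_tensors a b\<close> unfolding split_tensors_def by blast
      then show ?thesis using h by (simp add: gen cup_map_product)
    qed
    have "h z = restrict cup_map ?D z" if "z \<in> ?D" for z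
      by (rule additive_map_unique[OF _ add split_tensors_carrier eq that]) (use h in auto)
    then show "h = restrict cup_map ?D" using h by (intro extensionalityI[of _ ?D]) auto
  qed
  then show ?thesis using z by simp
qed

end

end

section \<open>Shuffles\<close>

(* Lists of positions are not unfolded from the right. *)
declare upt_Suc [simp del]

lemma sorted_map_upt_iff:
  fixes h :: "nat \<Rightarrow> nat"
  shows "sorted_wrt (<) (map h [i..<j]) \<longleftrightarrow> strict_mono_on {i..<j} h"
proof
  assume sorted: "sorted_wrt (<) (map h [i..<j])"
  show "strict_mono_on {i..<j} h"
  proof (rule strict_mono_onI)
    fix r s assume "r \<in> {i..<j}" "s \<in> {i..<j}" "r < s"
    then show "h r < h s"
      using sorted_wrt_nth_less[OF sorted, of "r - i" "s - i"] by auto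
  qed
next
  assume mono: "strict_mono_on {i..<j} h"
  show "sorted_wrt (<) (map h [i..<j])"
    unfolding sorted_wrt_iff_nth_less
    by (auto intro!: strict_mono_onD[OF mono])
qed

lemma finite_Sh: "finite (Sh a b)"
  by (rule finite_subset[OF _ finite_permutations[of "{1..a + b}"]]) (auto simp: Sh_def)

lemma map_comp_perm_list:
  assumes "\<sigma> permutes {1..m}"
  shows "map (\<lambda>i. h (\<sigma> i)) [1..<Suc m] = perm_list (inv_into UNIV \<sigma>) (map h [1..<Suc m])"
proof (intro nth_equalityI)
  fix i assume "i < length (map (\<lambda>i. h (\<sigma> i)) [1..<Suc m])"
  then have i: "i < m" by simp
  show "map (\<lambda>i. h (\<sigma> i)) [1..<Suc m] ! i = perm_list (inv_into UNIV \<sigma>) (map h [1..<Suc m]) ! i"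
    using i perm_list_index[OF assms i] assms
    by (simp add: nth_perm_list permutes_inv_inv flip: plus_1_eq_Suc)
qed simp

context
  fixes a b :: nat and \<iota> :: "nat \<Rightarrow> nat"
  assumes \<iota>: "strict_mono_on {1..a + b} \<iota>"
begin

abbreviation "block1 \<sigma> \<equiv> map (\<lambda>i. \<iota> (\<sigma> i)) [1..<Suc a]"
abbreviation "block2 \<sigma> \<equiv> map (\<lambda>i. \<iota> (\<sigma> i)) [Suc a..<Suc (a + b)]"
abbreviation "all_letters \<equiv> map \<iota> [1..<Suc (a + b)]"

lemma blocks_append:
  assumes "\<sigma> permutes {1..a + b}"
  shows "block1 \<sigma> @ block2 \<sigma> = perm_list (inv_into UNIV \<sigma>) all_letters"
proof -
  have "[1..<Suc (a + b)] = [1..<Suc a] @ [Suc a..<Suc (a + b)]"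
    using upt_add_eq_append[of 1 "Suc a" b] by simp
  then show ?thesis
    unfolding map_comp_perm_list[OF assms, symmetric] by (simp only: map_append)
qed

lemma strict_mono_on_comp_iff:
  assumes "\<sigma> permutes {1..a + b}" "S \<subseteq> {1..a + b}"
  shows "strict_mono_on S (\<lambda>i. \<iota> (\<sigma> i)) \<longleftrightarrow> strict_mono_on S \<sigma>"
proof -
  have "\<iota> (\<sigma> r) < \<iota> (\<sigma> s) \<longleftrightarrow> \<sigma> r < \<sigma> s" if "r \<in> S" "s \<in> S" for r s
    using strict_mono_on_less[OF \<iota>] permutes_in_image[OF assms(1)] assms(2) that by blast
  then show ?thesis by (auto simp: strict_mono_on_def)
qed

lemma sorted_blocks_iff:
  assumes "\<sigma> permutes {1..a + b}"
  shows "sorted_wrt (<) (block1 \<sigma>) \<and> sorted_wrt (<) (block2 \<sigma>) \<longleftrightarrow> \<sigma> \<in> Sh a b"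
proof -
  have sets: "{1..<Suc a} = {1..a}" "{Suc a..<Suc (a + b)} = {a + 1..a + b}" by auto
  have "strict_mono_on {1..a} (\<lambda>i. \<iota> (\<sigma> i)) \<longleftrightarrow> strict_mono_on {1..a} \<sigma>"
    "strict_mono_on {a + 1..a + b} (\<lambda>i. \<iota> (\<sigma> i)) \<longleftrightarrow> strict_mono_on {a + 1..a + b} \<sigma>"
    by (rule strict_mono_on_comp_iff[OF assms]; auto)+
  then show ?thesis using assms unfolding Sh_def sorted_map_upt_iff sets by blast
qed

lemma sorted_all_letters: "sorted_wrt (<) all_letters"
proof -
  have "{1..<Suc (a + b)} = {1..a + b}" by auto
  with \<iota> show ?thesis unfolding sorted_map_upt_iff by simp
qed

lemma perm_sign_blocks:
  assumes "\<sigma> permutes {1..a + b}"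
  shows "perm_sign (block1 \<sigma> @ block2 \<sigma>) all_letters = (of_int (sign \<sigma>) :: 'k::comm_ring_1)"
proof -
  have "inv_into UNIV \<sigma> permutes {1..length all_letters}" using permutes_inv[OF assms] by simp
  moreover have "distinct all_letters" using sorted_all_letters by (simp add: strict_sorted_iff)
  ultimately show ?thesis
    unfolding blocks_append[OF assms] by (simp add: perm_sign_perm_list sign_inv_permutes[OF assms])
qed

lemma Sh_permutes: "\<sigma> \<in> Sh a b \<Longrightarrow> \<sigma> permutes {1..a + b}"
  by (simp add: Sh_def)

lemma inj_on_blocks: "inj_on (\<lambda>\<sigma>. (block1 \<sigma>, block2 \<sigma>)) (Sh a b)"
proof (rule inj_onI)
  fix \<sigma> \<tau> assume st: "\<sigma> \<in> Sh a b" "\<tau> \<in> Sh a b" and eq: "(block1 \<sigma>, block2 \<sigma>) = (block1 \<tau>, block2 \<tau>)"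
  note p = st[THEN Sh_permutes]
  have "perm_list (inv_into UNIV \<sigma>) all_letters = perm_list (inv_into UNIV \<tau>) all_letters"
    using eq unfolding blocks_append[OF p(1), symmetric] blocks_append[OF p(2), symmetric] by simp
  moreover have "distinct all_letters" using sorted_all_letters by (simp add: strict_sorted_iff)
  ultimately have "inv_into UNIV \<sigma> = inv_into UNIV \<tau>"
    using permutes_inv[OF p(1)] permutes_inv[OF p(2)] by (intro perm_list_inj[of all_letters]) simp_all
  then show "\<sigma> = \<tau>" using p by (metis permutes_inv_inv)
qed

text \<open>
  If a pair of increasing lists is a rearrangement of the increasing list of all letters, then the
  rearranging permutation is monotone on both blocks because \<open>\<iota>\<close> is.
\<close>

lemma blocks_surj:
  assumes "sorted_wrt (<) is" "sorted_wrt (<) js" "length is = a" "length js = b"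
    and "perm_sign (is @ js) all_letters \<noteq> (0 :: 'k::comm_ring_1)"
  shows "(is, js) \<in> (\<lambda>\<sigma>. (block1 \<sigma>, block2 \<sigma>)) ` Sh a b"
proof -
  obtain \<sigma> where \<sigma>: "\<sigma> permutes {1..length (is @ js)}" "perm_list \<sigma> (is @ js) = all_letters"
    using assms(5) by (rule perm_sign_neq_0D)
  have p: "\<sigma> permutes {1..a + b}" using \<sigma>(1) assms by simp
  have "is @ js = perm_list (inv_into UNIV \<sigma>) (perm_list \<sigma> (is @ js))"
    using \<sigma>(1) by (simp add: perm_list_comp permutes_inv permutes_inv_o)
  then have "is @ js = block1 \<sigma> @ block2 \<sigma>"
    unfolding \<sigma>(2) blocks_append[OF p] .
  then have eq: "is = block1 \<sigma>" "js = block2 \<sigma>"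
    using assms(3) by (auto simp: append_eq_append_conv)
  then have "\<sigma> \<in> Sh a b" using sorted_blocks_iff[OF p] assms(1,2) by blast
  with eq show ?thesis by blast
qed

end

context based_space
begin

lemma alternating_tensors_smult:
  "t \<in> alternating_tensors m \<Longrightarrow> c \<odot>\<^bsub>T\<^esub> t \<in> alternating_tensors m"
  using alternating_scale[of m "\<lambda>ws. coeff ws t" c]
  by (simp add: alternating_tensors_def tensor_power_closed tensor_power_carrier[of _ m])

text \<open>
  Expansion of an alternating function in the first block of positions, followed by the expansion
  in the second block with the first one held fixed.
\<close>

lemma alternating_tensors_split:
  assumes z: "z \<in> alternating_tensors (a + b)" and w: "w1 \<in> words a" "w2 \<in> words b"
  shows "coeff (w1 @ w2) z
    = (\<Sum>(is, js)\<in>Inc a \<times> Inc b. coeff (is @ js) z * (perm_sign w1 is * perm_sign w2 js))"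
proof -
  have alt: "alternating (a + b) (\<lambda>ws. coeff ws z)" using z by (simp add: alternating_tensors_def)
  have alt1: "alternating a (\<lambda>w. coeff (w @ w2) z)"
    unfolding alternating_def
  proof (intro allI impI)
    fix us vs :: "nat list" and i j :: nat
    assume "Suc (Suc (length us + length vs)) = a"
    then have "Suc (Suc (length us + length (vs @ w2))) = a + b" using w by (simp add: words_def)
    from alternatingD[OF alt this] show "coeff ((us @ j # i # vs) @ w2) z = - coeff ((us @ i # j # vs) @ w2) z \<and>
        coeff ((us @ i # i # vs) @ w2) z = 0"
      unfolding append_assoc append_Cons by blast
  qed
  have alt2: "alternating b (\<lambda>w. coeff (is @ w) z)" if "is \<in> Inc a" for "is"
    unfolding alternating_def
  proof (intro allI impI)
    fix us vs :: "nat list" and i j :: nat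
    assume "Suc (Suc (length us + length vs)) = b"
    then have "Suc (Suc (length (is @ us) + length vs)) = a + b" using Inc_length[OF that] by simp
    from alternatingD[OF alt this] show "coeff (is @ us @ j # i # vs) z = - coeff (is @ us @ i # j # vs) z \<and>
        coeff (is @ us @ i # i # vs) z = 0"
      unfolding append_assoc by blast
  qed
  have "coeff (w1 @ w2) z = (\<Sum>is\<in>Inc a. coeff (is @ w2) z * perm_sign w1 is)"
    by (rule alternating_expansion[OF alt1]) (use w in \<open>auto simp: words_def\<close>)
  also have "\<dots> = (\<Sum>is\<in>Inc a. (\<Sum>js\<in>Inc b. coeff (is @ js) z * perm_sign w2 js) * perm_sign w1 is)"
  proof (rule sum.cong[OF refl])
    fix "is" assume "is \<in> Inc a"
    have "coeff (is @ w2) z = (\<Sum>js\<in>Inc b. coeff (is @ js) z * perm_sign w2 js)"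
      by (rule alternating_expansion[OF alt2[OF \<open>is \<in> Inc a\<close>]]) (use w in \<open>auto simp: words_def\<close>)
    then show "coeff (is @ w2) z * perm_sign w1 is
        = (\<Sum>js\<in>Inc b. coeff (is @ js) z * perm_sign w2 js) * perm_sign w1 is" by simp
  qed
  also have "\<dots> = (\<Sum>is\<in>Inc a. \<Sum>js\<in>Inc b. coeff (is @ js) z * (perm_sign w1 is * perm_sign w2 js))"
    by (simp add: sum_distrib_left mult_ac)
  finally show ?thesis by (simp add: sum.cartesian_product)
qed

text \<open>
  Expanding the coordinate at \<open>w1 @ w2\<close> over pairs of increasing lists leaves exactly the pairs whose
  concatenation rearranges the whole word, that is, the pairs of blocks of the shuffles.
\<close>

lemma ant_basis_shuffles:
  fixes a b :: nat and \<iota> :: "nat \<Rightarrow> nat"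
  defines "B1 \<equiv> \<lambda>\<sigma>. map (\<lambda>i. \<iota> (\<sigma> i)) [1..<Suc a]" and "B2 \<equiv> \<lambda>\<sigma>. map (\<lambda>i. \<iota> (\<sigma> i)) [Suc a..<Suc (a + b)]"
  assumes \<iota>: "strict_mono_on {1..a + b} \<iota>" "\<iota> \<in> {1..a + b} \<rightarrow> {1..n}"
  shows "\<sigma> \<in> Sh a b \<Longrightarrow> B1 \<sigma> \<in> Inc a" "\<sigma> \<in> Sh a b \<Longrightarrow> B2 \<sigma> \<in> Inc b"
    and "ant_basis (map \<iota> [1..<Suc (a + b)])
      = (\<Oplus>\<^bsub>T\<^esub>\<sigma>\<in>Sh a b. (of_int (sign \<sigma>) \<odot>\<^bsub>T\<^esub> ant_basis (B1 \<sigma>)) \<otimes>\<^bsub>T\<^esub> ant_basis (B2 \<sigma>))"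
proof -
  have rng: "\<iota> (\<sigma> i) \<in> {1..n}" if "\<sigma> \<in> Sh a b" "i \<in> {1..a + b}" for \<sigma> i
    using \<iota>(2) that permutes_in_image[of \<sigma> "{1..a + b}" i] by (auto simp: Sh_def)
  have B1: "B1 \<sigma> \<in> Inc a" and B2: "B2 \<sigma> \<in> Inc b" if "\<sigma> \<in> Sh a b" for \<sigma>
  proof -
    have "sorted_wrt (<) (B1 \<sigma>)" "sorted_wrt (<) (B2 \<sigma>)"
      using sorted_blocks_iff[OF \<iota>(1), of \<sigma>] that unfolding B1_def B2_def by (auto simp: Sh_def)
    moreover have "set (B1 \<sigma>) \<subseteq> {1..n}" "set (B2 \<sigma>) \<subseteq> {1..n}"
      using rng[OF that] by (auto simp: B1_def B2_def)
    moreover have "length (B1 \<sigma>) = a" "length (B2 \<sigma>) = b"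
      by (simp_all add: B1_def B2_def)
    ultimately show "B1 \<sigma> \<in> Inc a" "B2 \<sigma> \<in> Inc b" unfolding increasing_lists_def by blast+
  qed
  show "\<sigma> \<in> Sh a b \<Longrightarrow> B1 \<sigma> \<in> Inc a" by (rule B1)
  show "\<sigma> \<in> Sh a b \<Longrightarrow> B2 \<sigma> \<in> Inc b" by (rule B2)
  let ?L = "map \<iota> [1..<Suc (a + b)]"
  let ?g = "\<lambda>\<sigma>. (of_int (sign \<sigma>) \<odot>\<^bsub>T\<^esub> ant_basis (B1 \<sigma>)) \<otimes>\<^bsub>T\<^esub> ant_basis (B2 \<sigma>)"
  have L: "?L \<in> Inc (a + b)"
  proof -
    have "set ?L \<subseteq> {1..n}" using \<iota>(2) by (auto)
    then show ?thesis using sorted_all_letters[OF \<iota>(1)] by (simp add: increasing_lists_def)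
  qed
  have tp: "t \<in> tensor_power scale m" if "t \<in> alternating_tensors m" for t m
    using that by (simp add: alternating_tensors_def)
  have g1: "of_int (sign \<sigma>) \<odot>\<^bsub>T\<^esub> ant_basis (B1 \<sigma>) \<in> tensor_power scale a"
    and g2: "ant_basis (B2 \<sigma>) \<in> tensor_power scale b" if "\<sigma> \<in> Sh a b" for \<sigma>
    using tp[OF ant_basis_alternating] B1[OF that] B2[OF that] by (auto intro: tensor_power_closed)
  have g: "?g \<sigma> \<in> tensor_power scale (a + b)" if "\<sigma> \<in> Sh a b" for \<sigma>
    by (rule tensor_power_mult[OF g1[OF that] g2[OF that]])
  have gT: "?g \<in> Sh a b \<rightarrow> carrier T" using g tensor_power_carrier by blast
  show "ant_basis ?L = finsum T ?g (Sh a b)"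
  proof (rule tensor_power_eqI[of _ "a + b"])
    show "ant_basis ?L \<in> tensor_power scale (a + b)" by (rule tp[OF ant_basis_alternating[OF L]])
    show "finsum T ?g (Sh a b) \<in> tensor_power scale (a + b)"
      using g coeff_finsum[OF finite_Sh gT] T.finsum_closed[OF gT]
      by (auto simp: tensor_power_altdef intro!: sum.neutral)
    fix ws assume "ws \<in> words (a + b)"
    then obtain w1 w2 where ws: "ws = w1 @ w2" and w: "w1 \<in> words a" "w2 \<in> words b"
      by (intro that[of "take a ws" "drop a ws"])
        (auto simp: words_def dest: in_set_takeD in_set_dropD)
    let ?f = "\<lambda>(is, js). perm_sign (is @ js) ?L * (perm_sign w1 is * perm_sign w2 js) :: 'k"
    let ?\<theta> = "\<lambda>\<sigma>. (B1 \<sigma>, B2 \<sigma>)"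
    have "coeff ws (ant_basis ?L)
        = (\<Sum>(is, js)\<in>Inc a \<times> Inc b. coeff (is @ js) (ant_basis ?L) * (perm_sign w1 is * perm_sign w2 js))"
      unfolding ws by (rule alternating_tensors_split[OF ant_basis_alternating[OF L] w])
    also have "\<dots> = sum ?f (Inc a \<times> Inc b)"
      using L by (intro sum.cong) (auto simp: coeff_ant_basis increasing_lists_def)
    also have "\<dots> = sum ?f (?\<theta> ` Sh a b)"
    proof (rule sum.mono_neutral_right)
      show "?\<theta> ` Sh a b \<subseteq> Inc a \<times> Inc b" using B1 B2 by blast
      show "\<forall>x\<in>Inc a \<times> Inc b - ?\<theta> ` Sh a b. ?f x = 0"
      proof
        fix x assume "x \<in> Inc a \<times> Inc b - ?\<theta> ` Sh a b"
        then obtain "is" js where x: "x = (is, js)" and "is \<in> Inc a" "js \<in> Inc b" "(is, js) \<notin> ?\<theta> ` Sh a b"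
          by blast
        then have "perm_sign (is @ js) ?L = (0 :: 'k)"
          using blocks_surj[OF \<iota>(1), of "is" js] unfolding B1_def B2_def increasing_lists_def by blast
        then show "?f x = 0" by (simp add: x)
      qed
    qed simp
    also have "\<dots> = (\<Sum>\<sigma>\<in>Sh a b. ?f (?\<theta> \<sigma>))"
      by (rule sum.reindex[unfolded comp_def]) (use inj_on_blocks[OF \<iota>(1)] in \<open>simp add: B1_def B2_def\<close>)
    also have "\<dots> = (\<Sum>\<sigma>\<in>Sh a b. coeff ws (?g \<sigma>))"
    proof (rule sum.cong[OF refl])
      fix \<sigma> assume \<sigma>: "\<sigma> \<in> Sh a b"
      have len: "length (B1 \<sigma>) = a" "length (B2 \<sigma>) = b" "set (B1 \<sigma>) \<subseteq> {1..n}" "set (B2 \<sigma>) \<subseteq> {1..n}"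
        using B1[OF \<sigma>] B2[OF \<sigma>] by (auto simp: increasing_lists_def)
      have "coeff ws (?g \<sigma>) = of_int (sign \<sigma>) * perm_sign w1 (B1 \<sigma>) * perm_sign w2 (B2 \<sigma>)"
        unfolding ws using w len ant_basis_alternating[OF B1[OF \<sigma>], THEN tp, THEN tensor_power_carrier]
        by (subst coeff_mult_split[OF g1[OF \<sigma>] tensor_power_carrier[OF g2[OF \<sigma>]]])
          (auto simp: words_def coeff_ant_basis)
      then show "?f (?\<theta> \<sigma>) = coeff ws (?g \<sigma>)"
        using perm_sign_blocks[OF \<iota>(1), of \<sigma>, where 'k = 'k] \<sigma>
        by (simp add: Sh_def B1_def B2_def mult.assoc)
    qed
    also have "\<dots> = coeff ws (finsum T ?g (Sh a b))" by (rule coeff_finsum[OF finite_Sh gT, symmetric])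
    finally show "coeff ws (ant_basis ?L) = coeff ws (finsum T ?g (Sh a b))" .
  qed
qed


section \<open>The Koszul cup product on wedges\<close>

lemma nu_cases: "2 \<le> N \<Longrightarrow> nu N p \<le> 1 \<or> N \<le> nu N p"
  by (cases "p div 2") (auto simp: nu_def)

lemma koszul_W_nu: "2 \<le> N \<Longrightarrow> koszul_W scale N (nu N p) = alternating_tensors (nu N p)"
  by (rule koszul_W_eq) (auto dest: nu_cases)

lemma koszul_cochain_expansion:
  assumes N: "2 \<le> N" and B: "bimodule (sym_alg scale N) B"
    and f: "linear_on (ext_power scale (nu N p)) (ext_alg scale) (bimodule_space (sym_alg scale N) B) f"
    and s: "s \<in> alternating_tensors (nu N p)"
  shows "koszul_cochain scale e n N p f s = (\<Oplus>\<^bsub>B\<^esub>is\<in>Inc (nu N p).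
    (coeff is s \<odot>\<^bsub>sym_alg scale N\<^esub> \<one>\<^bsub>sym_alg scale N\<^esub>) \<odot>\<^bsub>B\<^esub> f (wedge scale (map e is)))"
  using linear_on_increasing_part[OF linear_on_ecls[OF f] abelian_group_bimodule_space[OF B], of "\<lambda>ws. coeff ws s"] s
  by (simp add: koszul_cochain_def koszul_W_nu[OF N] inv_phi wedge_eq)

lemma phi_wedge: "is \<in> Inc m \<Longrightarrow> phi scale e n m (wedge scale (map e is)) = ant_basis is"
  using Inc_length[of "is" m] by (simp add: wedge_eq phi_ecls ant_basis_def)

lemma koszul_cochain_ant_basis:
  assumes "2 \<le> N" "is \<in> Inc (nu N p)"
  shows "koszul_cochain scale e n N p f (ant_basis is) = f (wedge scale (map e is))"
proof -
  have "inv_into (ext_power scale (nu N p)) (phi scale e n (nu N p)) (ant_basis is) = wedge scale (map e is)"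
    by (rule inv_into_f_eq[OF inj_on_phi])
      (use assms Inc_length[of "is"] in \<open>simp_all add: phi_wedge, simp add: wedge_eq\<close>)
  then show ?thesis
    using ant_basis_alternating[OF assms(2)] by (simp add: koszul_cochain_def koszul_W_nu[OF assms(1)])
qed

end

lemma (in abelian_group) sign_add_pow:
  assumes "x \<in> carrier G"
  shows "[sign \<sigma>] \<cdot> x = (if sign \<sigma> = 1 then x else \<ominus> x)"
  using add.int_pow_1[OF assms] add.int_pow_neg[OF assms, of 1] assms
  by (simp add: sign_def a_inv_def)

context koszul_pair
begin

lemma sym_class_one: "sym_class scale N \<one>\<^bsub>T\<^esub> = \<one>\<^bsub>A\<^esub>"
  unfolding sym_alg_def sym_class_def quot_alg_one[OF ideal_sym_ideal] ..

lemma one_degree_0: "\<one>\<^bsub>T\<^esub> \<in> tensor_power scale 0"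
  using tensor_tensor_power[of "[]" 0] by (simp add: one_T tensor_def monomial_Nil)

text \<open>
  With \<open>i = l = j = 0\<close>, the map induced by \<open>F\<close> and \<open>G\<close> is applied to each term of the shuffle
  decomposition, where it gives a pure tensor of values on wedges.
\<close>

lemma koszul_apply_wedge:
  fixes p q :: nat and f :: "('v word \<Rightarrow>\<^sub>0 'k) set set \<Rightarrow> 'p" and g :: "('v word \<Rightarrow>\<^sub>0 'k) set set \<Rightarrow> 'q"
  defines "a \<equiv> nu N p" and "b \<equiv> nu N q"
  defines "F \<equiv> koszul_cochain scale e n N p f" and "G \<equiv> koszul_cochain scale e n N q g"
  assumes f: "linear_on (ext_power scale a) (ext_alg scale) (bimodule_space A P) f"
    and g: "linear_on (ext_power scale b) (ext_alg scale) (bimodule_space A Q) g"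
    and \<iota>: "strict_mono_on {1..a + b} \<iota>" "\<iota> \<in> {1..a + b} \<rightarrow> {1..n}"
  shows "koszul_apply scale N P Q 0 a 0 b 0 F G (ant_basis (map \<iota> [1..<Suc (a + b)])) =
    (\<Oplus>\<^bsub>PQ\<^esub>\<sigma>\<in>Sh a b. [sign \<sigma>] \<cdot>\<^bsub>PQ\<^esub>
      pure (f (wedge scale (map (\<lambda>i. e (\<iota> (\<sigma> i))) [1..<Suc a])))
        (g (wedge scale (map (\<lambda>i. e (\<iota> (\<sigma> i))) [Suc a..<Suc (a + b)]))))"
proof -
  define fb gb where "fb = (\<lambda>is. f (wedge scale (map e is)))" and "gb = (\<lambda>js. g (wedge scale (map e js)))"
  define B1 where "B1 \<sigma> = map (\<lambda>i. \<iota> (\<sigma> i)) [1..<Suc a]" for \<sigma>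
  define B2 where "B2 \<sigma> = map (\<lambda>i. \<iota> (\<sigma> i)) [Suc a..<Suc (a + b)]" for \<sigma>
  note sh = ant_basis_shuffles[OF \<iota>, folded B1_def B2_def]
  have fb: "fb \<in> Inc a \<rightarrow> carrier P" and gb: "gb \<in> Inc b \<rightarrow> carrier Q"
    using f g Inc_length by (auto simp: fb_def gb_def linear_on_def additive_on_def wedge_eq)
  have F: "F s = (\<Oplus>\<^bsub>P\<^esub>is\<in>Inc a. scalar (coeff is s) \<odot>\<^bsub>P\<^esub> fb is)" if "s \<in> alternating_tensors a" for s
    using koszul_cochain_expansion[OF N bimodules(1) f[unfolded a_def] that[unfolded a_def]]
    by (simp add: F_def fb_def a_def scalar_eq)
  have G: "G s = (\<Oplus>\<^bsub>Q\<^esub>is\<in>Inc b. scalar (coeff is s) \<odot>\<^bsub>Q\<^esub> gb is)" if "s \<in> alternating_tensors b" for s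
    using koszul_cochain_expansion[OF N bimodules(2) g[unfolded b_def] that[unfolded b_def]]
    by (simp add: G_def gb_def b_def scalar_eq)
  define h where "h = cup_map a b fb gb"
  have h_add: "additive_on (carrier T) T PQ h"
    using cup_map_add[OF fb gb] cup_map_closed[OF fb gb] by (simp add: additive_on_def h_def)
  have prod: "h (s \<otimes>\<^bsub>T\<^esub> t) = pure (F s) (G t)" and split: "s \<otimes>\<^bsub>T\<^esub> t \<in> split_tensors a b"
    if st: "s \<in> alternating_tensors a" "t \<in> alternating_tensors b" for s t
  proof -
    note carr = st[THEN alternating_tensors_carrier]
    have eq: "s \<otimes>\<^bsub>T\<^esub> t = \<one>\<^bsub>T\<^esub> \<otimes>\<^bsub>T\<^esub> s \<otimes>\<^bsub>T\<^esub> \<one>\<^bsub>T\<^esub> \<otimes>\<^bsub>T\<^esub> t \<otimes>\<^bsub>T\<^esub> \<one>\<^bsub>T\<^esub>" using carr by simp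
    have cl: "F s \<in> carrier P" "G t \<in> carrier Q"
      using F_closed[OF fb gb F G st(1)] G_closed[OF fb gb F G st(2)] by auto
    show "h (s \<otimes>\<^bsub>T\<^esub> t) = pure (F s) (G t)"
      using cl cup_map_product[OF fb gb F G one_degree_0 st(1) one_degree_0 st(2) one_degree_0]
      unfolding h_def eq by (simp add: sym_class_one P.lact_one P.ract_one Q.ract_one)
    show "s \<otimes>\<^bsub>T\<^esub> t \<in> split_tensors a b"
      unfolding eq split_tensors_def using st one_degree_0 by blast
  qed
  let ?g = "\<lambda>\<sigma>. (of_int (sign \<sigma>) \<odot>\<^bsub>T\<^esub> ant_basis (B1 \<sigma>)) \<otimes>\<^bsub>T\<^esub> ant_basis (B2 \<sigma>)"
  have alt: "ant_basis (B1 \<sigma>) \<in> alternating_tensors a" "ant_basis (B2 \<sigma>) \<in> alternating_tensors b"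
    if "\<sigma> \<in> Sh a b" for \<sigma>
    using sh(1,2) that by (auto intro: ant_basis_alternating)
  have gs: "?g \<in> Sh a b \<rightarrow> split_tensors a b"
    using alt by (auto intro!: split alternating_tensors_smult)
  have hg: "h (?g \<sigma>) = [sign \<sigma>] \<cdot>\<^bsub>PQ\<^esub> pure (fb (B1 \<sigma>)) (gb (B2 \<sigma>))" if \<sigma>: "\<sigma> \<in> Sh a b" for \<sigma>
  proof -
    let ?t = "ant_basis (B1 \<sigma>) \<otimes>\<^bsub>T\<^esub> ant_basis (B2 \<sigma>)"
    note carr = alt[OF \<sigma>, THEN alternating_tensors_carrier]
    have val: "h ?t = pure (fb (B1 \<sigma>)) (gb (B2 \<sigma>))"
      using prod[OF alt[OF \<sigma>]] sh(1,2)[OF \<sigma>]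
      by (simp add: F_def G_def fb_def gb_def a_def b_def koszul_cochain_ant_basis[OF N])
    have cl: "h ?t \<in> carrier PQ" using h_add carr by (auto simp: additive_on_def)
    show ?thesis
    proof (cases "sign \<sigma> = 1")
      case True
      have "?g \<sigma> = ?t" unfolding True
        by (rule arg_cong[of _ _ "\<lambda>s. s \<otimes>\<^bsub>T\<^esub> _"], rule T_eqI) (simp_all add: carr)
      then show ?thesis using True cl by (simp add: val PQ.sign_add_pow)
    next
      case False
      then have sg: "sign \<sigma> = -1" by (auto simp: sign_def)
      have "of_int (sign \<sigma>) \<odot>\<^bsub>T\<^esub> ant_basis (B1 \<sigma>) = \<ominus>\<^bsub>T\<^esub> ant_basis (B1 \<sigma>)"
        unfolding sg by (rule T_eqI) (simp_all add: carr)
      then have "?g \<sigma> = \<ominus>\<^bsub>T\<^esub> ?t" using carr by (simp add: T.l_minus)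
      moreover have "h (\<ominus>\<^bsub>T\<^esub> ?t) = \<ominus>\<^bsub>PQ\<^esub> h ?t"
      proof (rule PQ.minus_equality[symmetric])
        have "h (\<ominus>\<^bsub>T\<^esub> ?t) \<oplus>\<^bsub>PQ\<^esub> h ?t = h (\<ominus>\<^bsub>T\<^esub> ?t \<oplus>\<^bsub>T\<^esub> ?t)"
          using h_add carr by (simp add: additive_on_def)
        then show "h (\<ominus>\<^bsub>T\<^esub> ?t) \<oplus>\<^bsub>PQ\<^esub> h ?t = \<zero>\<^bsub>PQ\<^esub>"
          using additive_on_zero[OF T.abelian_group_axioms abelian_group_PQ h_add] carr by (simp add: T.l_neg)
        show "h (\<ominus>\<^bsub>T\<^esub> ?t) \<in> carrier PQ" using h_add carr by (auto simp: additive_on_def)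
      qed (rule cl)
      ultimately show ?thesis using False cl by (simp add: val PQ.sign_add_pow)
    qed
  qed
  have z: "ant_basis (map \<iota> [1..<Suc (a + b)]) \<in> generate (add_monoid T) (split_tensors a b)"
    unfolding sh(3) by (rule T.finsum_in_generate[OF split_tensors_carrier finite_Sh gs])
  have gT: "?g \<in> Sh a b \<rightarrow> carrier T" using gs split_tensors_carrier by blast
  have "koszul_apply scale N P Q 0 a 0 b 0 F G (ant_basis (map \<iota> [1..<Suc (a + b)]))
      = h (ant_basis (map \<iota> [1..<Suc (a + b)]))"
    unfolding h_def
    by (rule koszul_apply_eq[OF fb gb F G _ _ z]) (simp_all add: a_def b_def koszul_W_nu[OF N])
  also have "\<dots> = (\<Oplus>\<^bsub>PQ\<^esub>\<sigma>\<in>Sh a b. h (?g \<sigma>))"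
    unfolding sh(3)
    using additive_on_finsum[OF T.abelian_group_axioms abelian_group_PQ h_add subset_refl _ _ finite_Sh gT] by simp
  also have "\<dots> = (\<Oplus>\<^bsub>PQ\<^esub>\<sigma>\<in>Sh a b. [sign \<sigma>] \<cdot>\<^bsub>PQ\<^esub> pure (fb (B1 \<sigma>)) (gb (B2 \<sigma>)))"
  proof (rule PQ.finsum_cong')
    show "(\<lambda>\<sigma>. [sign \<sigma>] \<cdot>\<^bsub>PQ\<^esub> pure (fb (B1 \<sigma>)) (gb (B2 \<sigma>))) \<in> Sh a b \<rightarrow> carrier PQ"
    proof
      fix \<sigma> assume "\<sigma> \<in> Sh a b"
      then have "pure (fb (B1 \<sigma>)) (gb (B2 \<sigma>)) \<in> carrier PQ"
        by (intro pure_closed funcset_mem[OF fb] funcset_mem[OF gb] sh(1,2))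
      then show "[sign \<sigma>] \<cdot>\<^bsub>PQ\<^esub> pure (fb (B1 \<sigma>)) (gb (B2 \<sigma>)) \<in> carrier PQ"
        by (simp add: PQ.sign_add_pow)
    qed
  qed (simp_all add: hg)
  finally show ?thesis by (simp add: fb_def gb_def B1_def B2_def comp_def)
qed

end

theorem mainTheorem1:
  fixes scale :: "'k::field \<Rightarrow> 'v::ab_group_add \<Rightarrow> 'v"
    and e :: "nat \<Rightarrow> 'v"
    and n N p q :: nat
    and P :: "(('v word \<Rightarrow>\<^sub>0 'k) set set, 'p) bimodule"
    and Q :: "(('v word \<Rightarrow>\<^sub>0 'k) set set, 'q) bimodule"
    and f :: "('v word \<Rightarrow>\<^sub>0 'k) set set \<Rightarrow> 'p"
    and g :: "('v word \<Rightarrow>\<^sub>0 'k) set set \<Rightarrow> 'q"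
    and \<iota> :: "nat \<Rightarrow> nat"
  defines "A \<equiv> sym_alg scale N"
  defines "PQ \<equiv> bimodule_tensor A P Q"
  defines "x \<equiv> (\<lambda>i. e (\<iota> i))"
  assumes "n \<ge> 2"
    and basis: "finite_dimensional_vector_space scale (e ` {1..n})" "inj_on e {1..n}"
    and "2 \<le> N" "N \<le> n"
    and "bimodule A P" "bimodule A Q"
    and "nu N (p + q) = nu N p + nu N q"
    and f: "linear_on (ext_power scale (nu N p)) (ext_alg scale) (bimodule_space A P) f"
    and g: "linear_on (ext_power scale (nu N q)) (ext_alg scale) (bimodule_space A Q) g"
    and increasing: "\<iota> \<in> {1..nu N (p + q)} \<rightarrow> {1..n}" "strict_mono_on {1..nu N (p + q)} \<iota>"
  shows
    "koszul_cup scale N P Q p q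
        (koszul_cochain scale e n N p f) (koszul_cochain scale e n N q g)
        (phi scale e n (nu N (p + q)) (wedge scale (map x [1..<Suc (nu N (p + q))]))) =
     [((- 1 :: int) ^ (p * q))] \<cdot>\<^bsub>PQ\<^esub>
       (\<Oplus>\<^bsub>PQ\<^esub>\<sigma>\<in>Sh (nu N p) (nu N q).
          [sign \<sigma>] \<cdot>\<^bsub>PQ\<^esub>
            pure_tensor A P Q
              (f (wedge scale (map (\<lambda>i. x (\<sigma> i)) [1..<Suc (nu N p)])))
              (g (wedge scale (map (\<lambda>i. x (\<sigma> i)) [Suc (nu N p)..<Suc (nu N (p + q))]))))"
proof -
  let ?a = "nu N p" and ?b = "nu N q"
  note nu = \<open>nu N (p + q) = nu N p + nu N q\<close>
  interpret koszul_pair scale e n N P Q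
    using basis \<open>2 \<le> N\<close> \<open>bimodule A P\<close> \<open>bimodule A Q\<close>
    unfolding koszul_pair_def koszul_pair_axioms_def based_space_def based_space_axioms_def A_def by blast
  note inc = increasing[unfolded nu]
  define L where "L = map \<iota> [1..<Suc (?a + ?b)]"
  define F where "F = koszul_cochain scale e n N p f"
  define G where "G = koszul_cochain scale e n N q g"
  define z where "z = phi scale e n (nu N (p + q)) (wedge scale (map x [1..<Suc (nu N (p + q))]))"
  define R where "R = (\<Oplus>\<^bsub>PQ\<^esub>\<sigma>\<in>Sh ?a ?b. [sign \<sigma>] \<cdot>\<^bsub>PQ\<^esub> pure_tensor A P Q
    (f (wedge scale (map (\<lambda>i. x (\<sigma> i)) [1..<Suc ?a])))
    (g (wedge scale (map (\<lambda>i. x (\<sigma> i)) [Suc ?a..<Suc (?a + ?b)]))))"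
  have L: "L \<in> Inc (?a + ?b)"
  proof -
    have "set L \<subseteq> {1..n}" using inc(1) by (auto simp: L_def)
    then show ?thesis
      using sorted_all_letters[OF inc(2)] by (simp add: L_def increasing_lists_def)
  qed
  have z: "z = ant_basis L"
    using phi_wedge[OF L] by (simp add: z_def nu x_def L_def comp_def)
  have zW: "z \<in> koszul_W scale N (nu N (p + q))"
    using ant_basis_alternating[OF L] koszul_W_nu[OF \<open>2 \<le> N\<close>, of "p + q"] by (simp add: z nu)
  have R: "koszul_apply scale N P Q 0 ?a 0 ?b 0 F G z = R"
    using koszul_apply_wedge[OF f[unfolded A_def] g[unfolded A_def] inc(2,1)]
    by (simp add: z L_def R_def F_def G_def PQ_def A_def x_def)
  interpret PQ: abelian_group PQ unfolding PQ_def A_def by (rule abelian_group_PQ)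
  have Rcl: "R \<in> carrier PQ"
    unfolding R_def
  proof (rule PQ.finsum_closed, rule Pi_I)
    fix \<sigma> assume \<sigma>: "\<sigma> \<in> Sh ?a ?b"
    have "f (wedge scale (map (\<lambda>i. x (\<sigma> i)) [1..<Suc ?a])) \<in> carrier P"
      "g (wedge scale (map (\<lambda>i. x (\<sigma> i)) [Suc ?a..<Suc (?a + ?b)])) \<in> carrier Q"
      using f g by (auto simp: linear_on_def additive_on_def wedge_eq)
    then have "pure_tensor A P Q (f (wedge scale (map (\<lambda>i. x (\<sigma> i)) [1..<Suc ?a])))
      (g (wedge scale (map (\<lambda>i. x (\<sigma> i)) [Suc ?a..<Suc (?a + ?b)]))) \<in> carrier PQ"
      using pure_closed by (simp add: PQ_def A_def)
    then show "[sign \<sigma>] \<cdot>\<^bsub>PQ\<^esub> pure_tensor A P Q (f (wedge scale (map (\<lambda>i. x (\<sigma> i)) [1..<Suc ?a])))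
      (g (wedge scale (map (\<lambda>i. x (\<sigma> i)) [Suc ?a..<Suc (?a + ?b)]))) \<in> carrier PQ"
      by simp
  qed
  have "koszul_cup scale N P Q p q F G z = [((- 1 :: int) ^ (p * q))] \<cdot>\<^bsub>PQ\<^esub> R"
  proof (cases "odd p \<and> odd q")
    case True
    then obtain p' q' where pq: "p = 2 * p' + 1" "q = 2 * q' + 1" by (auto elim!: oddE)
    have "nu N (p + q) = N * (p' + q') + N" "nu N p + nu N q = N * (p' + q') + 2"
      by (simp_all add: pq nu_def algebra_simps)
    \<comment> \<open>the two lengths differ by N - 2\<close>
    with nu have "N = 2" by simp
    then have idx: "{(i, j). i + j \<le> N - 2} = {(0, 0)}" by auto
    have "finsum PQ (\<lambda>(i, j). koszul_apply scale N P Q i ?a (N - 2 - i - j) ?b j F G z)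
        {(i, j). i + j \<le> N - 2} = R"
      unfolding idx using R Rcl \<open>N = 2\<close> by simp
    then have "koszul_cup scale N P Q p q F G z = \<ominus>\<^bsub>PQ\<^esub> R"
      using True zW unfolding koszul_cup_def PQ_def A_def by simp
    moreover have "(- 1 :: int) ^ (p * q) = -1" using True by simp
    ultimately show ?thesis
      using PQ.add.int_pow_neg[OF Rcl, of 1] PQ.add.int_pow_1[OF Rcl] by (simp add: a_inv_def)
  next
    case False
    then have "(- 1 :: int) ^ (p * q) = 1" by auto
    moreover have "koszul_cup scale N P Q p q F G z = R"
      using False zW R unfolding koszul_cup_def by auto
    ultimately show ?thesis using PQ.add.int_pow_1[OF Rcl] by simp
  qed
  then show ?thesis unfolding z_def F_def G_def R_def nu .
qed

end
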